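(* Let $M$ be a combinatorial $d$-manifold with underlying simplicial complex $K$, and let $g\colon K\to\mathbb{R}$ be a discrete Morse function. Then $g$ induces a PL Morse function on $M$ as follows: there is a derived subdivision $K'$ of $K$, with one vertex $v_S$ for each cell $S\in K$, and a generic PL function $f\colon M\to\mathbb{R}$, linear on the cells of $K'$, such that $f$ is a PL Morse function and (i) for every non-critical cell $S$ of $g$, the vertex $v_S$ is strongly regular for $f$; (ii) for every critical cell $S$ of $g$ of dimension $k$, the vertex $v_S$ is non-degenerate critical for $f$ of index $k$.
   Context: A combinatorial $d$-manifold is a finite simplicial complex in which the link of every $k$-simplex is a combinatorial (PL) $(d-k-1)$-sphere; it is regarded as a compact PL $d$-manifold (without boundary). Discrete Morse function (Forman): a map $g$ from the cells (nonempty simplices) of $K$ to $\mathbb{R}$ such that for each $k$-cell there is at most one (exceptional) $(k-1)$-face whose value is not strictly smaller and at most one (exceptional) $(k+1)$-coface whose value is not strictly larger. A $k$-cell is critical if it has no exceptional $(k-1)$-face and no exceptional $(k+1)$-coface. Derived subdivision: a subdivision of $K$ obtained by choosing a point $v_S$ in the relative interior of each cell $S$; its simplices are spanned by $v_{S_0},\dots,v_{S_j}$ for chains $S_0\subsetneq\dots\subsetneq S_j$ (the barycentric subdivision is an example). Generic PL with respect to $K'$: linear on each simplex of $K'$ and with distinct values at distinct vertices of $K'$. A point $p$ is strongly regular for $f$ if there is a PL chart around $p$ (with $p$ at the origin) in which $f(x_1,\dots,x_d)=f(p)+x_d$. A vertex $v$ is non-degenerate critical of index $k$ if there is a PL chart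 around $v$ (with $v$ at the origin) in which $f(x_1,\dots,x_d)=f(v)-|x_1|-\cdots-|x_k|+|x_{k+1}|+\cdots+|x_d|$. A generic PL function is a PL Morse function if every vertex is either non-degenerate critical or strongly regular. *)

theory Defs
  imports "HOL-Analysis.Analysis"
begin

text \<open>
  A finite simplicial complex is a geometric one, as in \<^const>\<open>simplicial_complex\<close>, with
  polyhedron \<open>\<Union>K\<close> in a Euclidean space. Nonempty complexes in the sense of the library contain
  the empty simplex; the cells are the nonempty simplices, and the dimension of a cell is its
  \<^const>\<open>aff_dim\<close>.
\<close>

definition cells :: "'a::euclidean_space set set \<Rightarrow> 'a set set"
  where "cells K = K - {{}}"


subsection \<open>Piecewise linear maps\<close>

definition affine_on :: "'a::real_vector set \<Rightarrow> ('a \<Rightarrow> 'b::real_vector) \<Rightarrow> bool"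
  where "affine_on S f \<longleftrightarrow>
    (\<forall>x\<in>S. \<forall>y\<in>S. \<forall>u\<in>{0..1}.
      f ((1 - u) *\<^sub>R x + u *\<^sub>R y) = (1 - u) *\<^sub>R f x + u *\<^sub>R f y)"

text \<open>PL maps on a compact polyhedron; continuity is implied, as the pieces are finitely many
  compact sets.\<close>

definition pl_map_on :: "'a::euclidean_space set \<Rightarrow> ('a \<Rightarrow> 'b::euclidean_space) \<Rightarrow> bool"
  where "pl_map_on X f \<longleftrightarrow>
    (\<exists>T. simplicial_complex T \<and> \<Union>T = X \<and> (\<forall>S\<in>T. affine_on S f))"

definition pl_homeomorphic :: "'a::euclidean_space set \<Rightarrow> 'b::euclidean_space set \<Rightarrow> bool"
  where "pl_homeomorphic X Y \<longleftrightarrow>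
    (\<exists>f h. homeomorphism X Y f h \<and> pl_map_on X f \<and> pl_map_on Y h)"


subsection \<open>Combinatorial manifolds\<close>

text \<open>
  The model of the PL sphere of dimension \<open>m\<close> is the boundary of an \<open>(m+1)\<close>-simplex; for
  \<open>m = -1\<close> this is the empty set. The model simplex may be taken in the ambient space of \<open>X\<close>,
  because a space that contains a topological \<open>m\<close>-sphere has dimension at least \<open>m + 1\<close>.
\<close>

definition pl_sphere :: "int \<Rightarrow> 'a::euclidean_space set \<Rightarrow> bool"
  where "pl_sphere m X \<longleftrightarrow>
    m \<ge> -1 \<and> (\<exists>D::'a set. (m + 1) simplex D \<and> pl_homeomorphic X (rel_frontier D))"

definition link_of :: "'a::euclidean_space set \<Rightarrow> 'a set set \<Rightarrow> 'a set set"
  where "link_of S K = {T \<in> K. S \<inter> T = {} \<and> (\<exists>R\<in>K. S \<subseteq> R \<and> T \<subseteq> R)}"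

definition combinatorial_manifold :: "nat \<Rightarrow> 'a::euclidean_space set set \<Rightarrow> bool"
  where "combinatorial_manifold d K \<longleftrightarrow>
    simplicial_complex K \<and>
    (\<forall>S\<in>cells K. pl_sphere (int d - aff_dim S - 1) (\<Union>(link_of S K)))"


subsection \<open>Discrete Morse functions\<close>

text \<open>\<^const>\<open>facet_of\<close> is the relation of being a nonempty face of codimension one, so vertices have
  no facets.\<close>

definition exceptional_face ::
    "'a::euclidean_space set set \<Rightarrow> ('a set \<Rightarrow> real) \<Rightarrow> 'a set \<Rightarrow> 'a set \<Rightarrow> bool"
  where "exceptional_face K g S F \<longleftrightarrow> F \<in> cells K \<and> F facet_of S \<and> \<not> g F < g S"

definition exceptional_coface ::
    "'a::euclidean_space set set \<Rightarrow> ('a set \<Rightarrow> real) \<Rightarrow> 'a set \<Rightarrow> 'a set \<Rightarrow> bool"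
  where "exceptional_coface K g S T \<longleftrightarrow> T \<in> cells K \<and> S facet_of T \<and> \<not> g S < g T"

definition discrete_morse :: "'a::euclidean_space set set \<Rightarrow> ('a set \<Rightarrow> real) \<Rightarrow> bool"
  where "discrete_morse K g \<longleftrightarrow>
    (\<forall>S\<in>cells K. (\<exists>\<^sub>\<le>\<^sub>1F. exceptional_face K g S F) \<and> (\<exists>\<^sub>\<le>\<^sub>1T. exceptional_coface K g S T))"

definition critical_cell :: "'a::euclidean_space set set \<Rightarrow> ('a set \<Rightarrow> real) \<Rightarrow> 'a set \<Rightarrow> bool"
  where "critical_cell K g S \<longleftrightarrow>
    S \<in> cells K \<and> (\<nexists>F. exceptional_face K g S F) \<and> (\<nexists>T. exceptional_coface K g S T)"


subsection \<open>Derived subdivisions\<close>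

definition derived_subdivision ::
    "'a::euclidean_space set set \<Rightarrow> ('a set \<Rightarrow> 'a) \<Rightarrow> 'a set set \<Rightarrow> bool"
  where "derived_subdivision K v K' \<longleftrightarrow>
    (\<forall>S\<in>cells K. v S \<in> rel_interior S) \<and>
    K' = {convex hull (v ` C) | C. C \<subseteq> cells K \<and> chain\<^sub>\<subseteq> C}"


subsection \<open>PL Morse functions\<close>

definition vertices :: "'a::euclidean_space set set \<Rightarrow> 'a set"
  where "vertices K = {x. {x} \<in> K}"

definition generic_pl :: "'a::euclidean_space set set \<Rightarrow> ('a \<Rightarrow> real) \<Rightarrow> bool"
  where "generic_pl K f \<longleftrightarrow> (\<forall>S\<in>K. affine_on S f) \<and> inj_on f (vertices K)"

text \<open>
  A PL chart of the polyhedron \<open>M\<close> around \<open>p\<close>, with \<open>p\<close> at the origin: a homeomorphism from an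
  open neighbourhood \<open>U\<close> of \<open>p\<close> in \<open>M\<close> onto an open subset of \<open>d\<close>-space that is the restriction
  of a PL map on a compact polyhedron in \<open>M\<close>. Every PL chart becomes one of this form after
  shrinking its domain. The inverse is again PL, being affine on the images of the simplices.
  The space \<^term>\<open>Euclidean_space d\<close> has the coordinates \<open>0, \<dots>, d - 1\<close>, and \<open>d = 0\<close> is allowed.
  Its points are functions, which are not an instance of \<^class>\<open>real_vector\<close>, hence the
  coordinatewise formulation of affinity.
\<close>

definition pl_chart ::
    "nat \<Rightarrow> 'a::euclidean_space set \<Rightarrow> 'a \<Rightarrow> 'a set \<Rightarrow> ('a \<Rightarrow> nat \<Rightarrow> real) \<Rightarrow> bool"
  where "pl_chart d M p U \<phi> \<longleftrightarrow>
    openin (top_of_set M) U \<and> p \<in> U \<and>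
    openin (Euclidean_space d) (\<phi> ` U) \<and>
    homeomorphic_map (top_of_set U) (subtopology (Euclidean_space d) (\<phi> ` U)) \<phi> \<and>
    (\<exists>T. simplicial_complex T \<and> U \<subseteq> \<Union>T \<and> \<Union>T \<subseteq> M \<and>
         (\<forall>S\<in>T. \<forall>i<d. affine_on S (\<lambda>x. \<phi> x i))) \<and>
    (\<forall>i. \<phi> p i = 0)"

text \<open>Coordinates are numbered from 0, so the last one is the coordinate \<open>d - 1\<close>, which exists
  only for \<open>d > 0\<close>.\<close>

definition strongly_regular ::
    "nat \<Rightarrow> 'a::euclidean_space set \<Rightarrow> ('a \<Rightarrow> real) \<Rightarrow> 'a \<Rightarrow> bool"
  where "strongly_regular d M f p \<longleftrightarrow>
    d > 0 \<and> (\<exists>U \<phi>. pl_chart d M p U \<phi> \<and> (\<forall>x\<in>U. f x = f p + \<phi> x (d - 1)))"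

definition nondegenerate_critical ::
    "nat \<Rightarrow> 'a::euclidean_space set \<Rightarrow> ('a \<Rightarrow> real) \<Rightarrow> nat \<Rightarrow> 'a \<Rightarrow> bool"
  where "nondegenerate_critical d M f k p \<longleftrightarrow>
    k \<le> d \<and> (\<exists>U \<phi>. pl_chart d M p U \<phi> \<and>
      (\<forall>x\<in>U. f x = f p - (\<Sum>i<k. \<bar>\<phi> x i\<bar>) + (\<Sum>i=k..<d. \<bar>\<phi> x i\<bar>)))"

definition pl_morse :: "nat \<Rightarrow> 'a::euclidean_space set set \<Rightarrow> ('a \<Rightarrow> real) \<Rightarrow> bool"
  where "pl_morse d K f \<longleftrightarrow>
    generic_pl K f \<and>
    (\<forall>p\<in>vertices K.
      (\<exists>k. nondegenerate_critical d (\<Union>K) f k p) \<or> strongly_regular d (\<Union>K) f p)"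

end

theory Submission
  imports Defs
begin

text \<open>
  Let \<open>K'\<close> be the barycentric subdivision. Give a cell \<open>S\<close> the value \<open>g T\<close> if it is matched with an
  exceptional coface \<open>T\<close>, and \<open>g S\<close> otherwise. This is constant on matched pairs and strictly monotone
  along all other inclusions of cells, so a perturbation yields distinct values that are monotone
  except on matched pairs, where the order is reversed by an arbitrarily small amount. Let \<open>f\<close> be the
  linear extension of these values.

  Near \<open>v\<^sub>S\<close> the manifold is the product of the cones over \<open>\<partial>S\<close> and over the link of \<open>S\<close>, and
  \<open>f - f v\<^sub>S\<close> is a sum of two homogeneous PL functions, one on each factor. Two homogeneous PL functions
  with the same signs differ by a PL homeomorphism preserving rays. Hence only the signs matter: if \<open>S\<close>
  is critical, the summands are negative and positive, and become \<open>\<ell>\<^sup>1\<close>-norms. If \<open>S\<close> is matched,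
  one summand has the wrong sign at exactly one vertex \<open>q\<close>. If the reversal is small enough, the
  region of the wrong sign lies in the star of \<open>q\<close> for any fixed PL structure on the link, and this
  makes the summand equivalent to a function that is strictly monotone in the direction of \<open>q\<close>. Such a
  function is a coordinate.
\<close>


subsection \<open>Piecewise affine maps on unions of polytopes\<close>

text \<open>The obstacle is that the PL homeomorphism from a link to a model sphere is affine only
  on a subdivision that has nothing to do with \<open>K'\<close>. On the cone over the sphere
  \<open>f\<close> is therefore just some homogeneous PL function, and it need not be linear in the
  direction of \<open>q\<close> throughout the region of the wrong sign, unless that region is
  forced into the pieces of the subdivision that contain \<open>q\<close>. How small the reversal
  must be depends on the homeomorphisms chosen for the finitely many links but not on the values. So
  the bound \<eta> is fixed first, and the values are chosen afterwards, with all correct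
  differences at least 1. That only one of the two summands has a wrong sign rests on Forman's
  observation that no cell has both an exceptional face and an exceptional coface. Computations with
  \<open>f\<close> avoid the simplices of \<open>K'\<close>. Barycentric weights are written as a
  combination of indicator functions of a chain of vertex sets, and \<open>f\<close> is a sum over
  this chain. The formula is homogeneous, so it makes sense for unnormalised weights, that is, on
  cones.\<close>

lemma affine_onD:
  assumes "affine_on S f" "x \<in> S" "y \<in> S" "0 \<le> u" "u \<le> 1"
  shows "f ((1 - u) *\<^sub>R x + u *\<^sub>R y) = (1 - u) *\<^sub>R f x + u *\<^sub>R f y"
  using assms unfolding affine_on_def by auto

lemma affine_on_subset: "affine_on S f \<Longrightarrow> T \<subseteq> S \<Longrightarrow> affine_on T f"
  unfolding affine_on_def by blast

lemma affine_on_cong: "affine_on S f \<Longrightarrow> (\<And>x. x \<in> S \<Longrightarrow> f x = g x) \<Longrightarrow> convex S \<Longrightarrow> affine_on S g"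
  unfolding affine_on_def convex_alt by (simp add: convex_alt)

lemma affine_on_compose:
  assumes "affine_on S f" "affine_on T g" "f ` S \<subseteq> T"
  shows "affine_on S (\<lambda>x. g (f x))"
  using assms unfolding affine_on_def by (simp add: image_subset_iff)

lemma affine_on_linear: "linear L \<Longrightarrow> affine_on S f \<Longrightarrow> affine_on S (\<lambda>x. L (f x))"
  unfolding affine_on_def by (simp add: linear_add linear_scale)

lemma affine_on_const [simp]: "affine_on S (\<lambda>x. c)"
  unfolding affine_on_def by (simp add: algebra_simps flip: scaleR_add_left)

lemma affine_on_id [simp]: "affine_on S (\<lambda>x. x)"
  unfolding affine_on_def by simp

lemma affine_on_add: "affine_on S f \<Longrightarrow> affine_on S g \<Longrightarrow> affine_on S (\<lambda>x. f x + g x)"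
  unfolding affine_on_def by (simp add: scaleR_right_distrib add.assoc add.left_commute)

lemma affine_on_scaleR: "affine_on S f \<Longrightarrow> affine_on S (\<lambda>x. c *\<^sub>R f x)"
  unfolding affine_on_def by (simp add: scaleR_right_distrib mult.commute)

lemma affine_on_scaleR_left: "affine_on S f \<Longrightarrow> affine_on S (\<lambda>x. f x *\<^sub>R v)"
  unfolding affine_on_def by (simp add: scaleR_left_distrib)

lemma affine_on_diff: "affine_on S f \<Longrightarrow> affine_on S g \<Longrightarrow> affine_on S (\<lambda>x. f x - g x)"
  using affine_on_add[of S f "\<lambda>x. (-1) *\<^sub>R g x"] affine_on_scaleR[of S g "-1"] by simp

lemma affine_on_Pair: "affine_on S f \<Longrightarrow> affine_on S g \<Longrightarrow> affine_on S (\<lambda>x. (f x, g x))"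
  unfolding affine_on_def by simp

lemma affine_on_sum:
  assumes "\<And>i. i \<in> I \<Longrightarrow> affine_on S (f i)" shows "affine_on S (\<lambda>x. \<Sum>i\<in>I. f i x)"
  using assms by (induction I rule: infinite_finite_induct) (auto intro: affine_on_add)

lemma affine_on_convex_image:
  assumes "affine_on S f" "convex S" shows "convex (f ` S)"
  unfolding convex_alt
proof clarify
  fix a b and u :: real assume "a \<in> S" "b \<in> S" and u: "0 \<le> u" "u \<le> 1"
  then have "(1 - u) *\<^sub>R f a + u *\<^sub>R f b = f ((1 - u) *\<^sub>R a + u *\<^sub>R b)"
    using affine_onD[OF assms(1)] by simp
  moreover have "(1 - u) *\<^sub>R a + u *\<^sub>R b \<in> S" using \<open>a \<in> S\<close> \<open>b \<in> S\<close> u assms(2) by (simp add: convex_alt)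
  ultimately show "(1 - u) *\<^sub>R f a + u *\<^sub>R f b \<in> f ` S" by auto
qed

text \<open>The graph of \<open>f\<close> over \<open>S\<close> is the image of a convex set under
  an affine map, hence convex; a convex combination of points of the graph is therefore again on the
  graph.\<close>

lemma affine_on_convex_sum:
  assumes f: "affine_on S f" and S: "convex S"
    and "finite I" "\<And>i. i \<in> I \<Longrightarrow> 0 \<le> a i" "sum a I = 1" "\<And>i. i \<in> I \<Longrightarrow> y i \<in> S"
  shows "f (\<Sum>i\<in>I. a i *\<^sub>R y i) = (\<Sum>i\<in>I. a i *\<^sub>R f (y i))"
proof -
  have "convex ((\<lambda>x. (x, f x)) ` S)"
    by (rule affine_on_convex_image[OF affine_on_Pair[OF affine_on_id f] S])
  then have "(\<Sum>i\<in>I. a i *\<^sub>R (y i, f (y i))) \<in> (\<lambda>x. (x, f x)) ` S"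
    by (intro convex_sum) (use assms in auto)
  then show ?thesis
    by (auto simp: scaleR_prod_def sum_prod)
qed

lemma affine_on_convex_hull_image:
  assumes f: "affine_on (convex hull V) f"
  shows "f ` (convex hull V) = convex hull (f ` V)"
proof
  show "convex hull (f ` V) \<subseteq> f ` (convex hull V)"
    by (rule hull_minimal) (auto intro: affine_on_convex_image[OF f] hull_inc)
  show "f ` (convex hull V) \<subseteq> convex hull (f ` V)"
  proof clarify
    fix x assume "x \<in> convex hull V"
    then obtain S u where S: "finite S" "S \<subseteq> V" "\<forall>x\<in>S. 0 \<le> u x" "sum u S = 1" "(\<Sum>v\<in>S. u v *\<^sub>R v) = x"
      unfolding convex_hull_explicit by blast
    have "f x = (\<Sum>v\<in>S. u v *\<^sub>R f v)"
      using affine_on_convex_sum[OF f convex_convex_hull S(1), of u "\<lambda>v. v"] S by (auto simp: hull_inc subsetD)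
    also have "\<dots> \<in> convex hull (f ` V)"
      by (rule convex_sum) (use S in \<open>auto simp: hull_inc subsetD\<close>)
    finally show "f x \<in> convex hull (f ` V)" .
  qed
qed

lemma polytope_affine_on_image:
  assumes "polytope P" "affine_on P f" shows "polytope (f ` P)"
  using assms unfolding polytope_def by (metis affine_on_convex_hull_image finite_imageI)

text \<open>Closed graph theorem: the graph is an affine image of \<open>P\<close>, hence a polytope
  and closed, and the image of \<open>P\<close> is compact.\<close>

lemma affine_on_continuous:
  fixes f :: "'a::euclidean_space \<Rightarrow> 'b::euclidean_space"
  assumes "polytope P" "affine_on P f" shows "continuous_on P f"
proof (rule continuous_from_closed_graph)
  show "compact (f ` P)" using polytope_affine_on_image[OF assms] by (rule polytope_imp_compact)
  show "f \<in> P \<rightarrow> f ` P" by auto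
  show "closed ((\<lambda>x. (x, f x)) ` P)"
    by (intro polytope_imp_closed polytope_affine_on_image affine_on_Pair assms) auto
qed

text \<open>Intersecting the graph, a polytope, with \<open>P \<times> Q\<close> and projecting to
  the first factor exhibits the preimage as a polytope.\<close>

lemma polytope_affine_on_vimage:
  fixes f :: "'a::euclidean_space \<Rightarrow> 'b::euclidean_space"
  assumes "polytope P" "affine_on P f" "polytope Q" shows "polytope {x \<in> P. f x \<in> Q}"
proof -
  have "{x \<in> P. f x \<in> Q} = fst ` ((\<lambda>x. (x, f x)) ` P \<inter> P \<times> Q)" by force
  moreover have "polytope ((\<lambda>x. (x, f x)) ` P)"
    by (intro polytope_affine_on_image affine_on_Pair assms) auto
  ultimately show ?thesis
    by (metis polytope_Int polytope_Times assms(1,3) polytope_linear_image linear_fst)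
qed

text \<open>The pieces need not fit together along faces. Without that condition, closure under
  composition, pairing and restriction is a matter of intersecting pieces; a simplicial complex is
  recovered by \<open>pwa_triangulation\<close> where a chart demands one.\<close>

definition pwa :: "'a::euclidean_space set \<Rightarrow> ('a \<Rightarrow> 'b::real_vector) \<Rightarrow> bool"
  where "pwa X f \<longleftrightarrow> (\<exists>\<P>. finite \<P> \<and> \<Union>\<P> = X \<and> (\<forall>P\<in>\<P>. polytope P \<and> affine_on P f))"

lemma pwaI: "finite \<P> \<Longrightarrow> \<Union>\<P> = X \<Longrightarrow> (\<And>P. P \<in> \<P> \<Longrightarrow> polytope P) \<Longrightarrow> (\<And>P. P \<in> \<P> \<Longrightarrow> affine_on P f) \<Longrightarrow> pwa X f"
  unfolding pwa_def by blast

lemma pwaE: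
  assumes "pwa X f"
  obtains \<P> where "finite \<P>" "\<Union>\<P> = X" "\<And>P. P \<in> \<P> \<Longrightarrow> polytope P" "\<And>P. P \<in> \<P> \<Longrightarrow> affine_on P f"
  using assms unfolding pwa_def by blast

lemma pwa_affine: "polytope P \<Longrightarrow> affine_on P f \<Longrightarrow> pwa P f"
  by (rule pwaI[of "{P}"]) auto

lemma pwa_map:
  assumes "pwa X f" "\<And>P. polytope P \<Longrightarrow> P \<subseteq> X \<Longrightarrow> affine_on P f \<Longrightarrow> affine_on P g"
  shows "pwa X g"
proof -
  obtain \<P> where P: "finite \<P>" "\<Union>\<P> = X" "\<And>P. P \<in> \<P> \<Longrightarrow> polytope P" "\<And>P. P \<in> \<P> \<Longrightarrow> affine_on P f"
    using assms(1) by (rule pwaE) blast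
  show ?thesis by (rule pwaI[OF P(1,2,3)]) (use P assms(2) in blast)+
qed

lemma pwa_cong:
  assumes "pwa X f" "\<And>x. x \<in> X \<Longrightarrow> f x = g x" shows "pwa X g"
  by (rule pwa_map[OF assms(1)]) (use affine_on_cong[of _ f g] assms(2) polytope_imp_convex in blast)

lemma pwa_continuous:
  fixes f :: "'a::euclidean_space \<Rightarrow> 'b::euclidean_space"
  assumes "pwa X f" shows "continuous_on X f"
proof -
  obtain \<P> where "finite \<P>" "\<Union>\<P> = X" "\<And>P. P \<in> \<P> \<Longrightarrow> polytope P" "\<And>P. P \<in> \<P> \<Longrightarrow> affine_on P f"
    using assms by (rule pwaE) blast
  then show ?thesis
    using continuous_on_closed_Union[of \<P> "\<lambda>P. P" f] by (auto simp: affine_on_continuous polytope_imp_closed)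
qed

lemma pwa_compact: "pwa X f \<Longrightarrow> compact X"
  unfolding pwa_def by (metis compact_Union polytope_imp_compact)

lemma pwa_compose:
  fixes f :: "'a::euclidean_space \<Rightarrow> 'b::euclidean_space"
  assumes "pwa X f" "pwa Y g" "f ` X \<subseteq> Y" shows "pwa X (\<lambda>x. g (f x))"
proof -
  obtain \<P> where P: "finite \<P>" "\<Union>\<P> = X" "\<And>P. P \<in> \<P> \<Longrightarrow> polytope P" "\<And>P. P \<in> \<P> \<Longrightarrow> affine_on P f"
    using assms(1) by (rule pwaE) blast
  obtain \<Q> where Q: "finite \<Q>" "\<Union>\<Q> = Y" "\<And>P. P \<in> \<Q> \<Longrightarrow> polytope P" "\<And>P. P \<in> \<Q> \<Longrightarrow> affine_on P g"
    using assms(2) by (rule pwaE) blast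
  define \<R> where "\<R> = (\<lambda>(P,Q). {x \<in> P. f x \<in> Q}) ` (\<P> \<times> \<Q>)"
  show ?thesis
  proof (rule pwaI[of \<R>])
    show "finite \<R>" using P Q by (simp add: \<R>_def)
    show "\<Union>\<R> = X" using P(2) Q(2) assms(3) unfolding \<R>_def by fastforce
    show "polytope R" if "R \<in> \<R>" for R
      using that P Q by (auto simp: \<R>_def intro: polytope_affine_on_vimage)
    show "affine_on R (\<lambda>x. g (f x))" if "R \<in> \<R>" for R
      using that P Q by (auto simp: \<R>_def intro!: affine_on_compose[where f=f and g=g] intro: affine_on_subset)
  qed
qed

text \<open>The function \<open>g\<close> serves to certify that \<open>Y\<close> is a finite union
  of polytopes.\<close>

lemma pwa_restrict:
  assumes "pwa X f" "pwa Y (g :: _ \<Rightarrow> 'c::real_vector)" "Y \<subseteq> X" shows "pwa Y f"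
proof (rule pwa_compose[of Y "\<lambda>x. x" X f])
  from assms(2) show "pwa Y (\<lambda>x. x)" by (rule pwa_map) simp
qed (use assms in auto)

text \<open>The pieces are intersections of one piece for each function. \<open>g\<close> stands
  apart so that it may have another codomain and so that there are pieces even for empty
  \<open>I\<close>.\<close>

lemma pwa_common:
  assumes "finite I" "\<And>i. i \<in> I \<Longrightarrow> pwa X (f i)" "pwa X (g :: _ \<Rightarrow> 'c::real_vector)"
  obtains \<P> where "finite \<P>" "\<Union>\<P> = X" "\<And>P. P \<in> \<P> \<Longrightarrow> polytope P" "\<And>P. P \<in> \<P> \<Longrightarrow> affine_on P g"
    "\<And>P i. P \<in> \<P> \<Longrightarrow> i \<in> I \<Longrightarrow> affine_on P (f i)"
proof -
  have "\<exists>\<P>. finite \<P> \<and> \<Union>\<P> = X \<and> (\<forall>P\<in>\<P>. polytope P \<and> affine_on P g \<and> (\<forall>i\<in>I. affine_on P (f i)))"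
    using assms(1,2)
  proof (induction I)
    case empty
    then show ?case using assms(3) unfolding pwa_def by auto
  next
    case (insert j I)
    then obtain \<P> where P: "finite \<P>" "\<Union>\<P> = X" "\<forall>P\<in>\<P>. polytope P \<and> affine_on P g \<and> (\<forall>i\<in>I. affine_on P (f i))"
      by auto
    from insert.prems[of j] obtain \<Q> where Q: "finite \<Q>" "\<Union>\<Q> = X" "\<And>P. P \<in> \<Q> \<Longrightarrow> polytope P" "\<And>P. P \<in> \<Q> \<Longrightarrow> affine_on P (f j)"
      by (auto elim: pwaE)
    define \<R> where "\<R> = (\<lambda>(P,Q). P \<inter> Q) ` (\<P> \<times> \<Q>)"
    have "finite \<R>" using P Q by (simp add: \<R>_def)
    moreover have "\<Union>\<R> = \<Union>\<P> \<inter> \<Union>\<Q>" unfolding \<R>_def by auto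
    then have "\<Union>\<R> = X" using P(2) Q(2) by simp
    moreover have "\<forall>P\<in>\<R>. polytope P \<and> affine_on P g \<and> (\<forall>i\<in>insert j I. affine_on P (f i))"
    proof
      fix R assume "R \<in> \<R>"
      then obtain P Q where "R = P \<inter> Q" "P \<in> \<P>" "Q \<in> \<Q>" by (auto simp: \<R>_def)
      then show "polytope R \<and> affine_on R g \<and> (\<forall>i\<in>insert j I. affine_on R (f i))"
        using P(3) Q(3,4) by (auto intro: polytope_Int affine_on_subset[OF _ Int_lower1] affine_on_subset[OF _ Int_lower2])
    qed
    ultimately show ?case by (intro exI[of _ \<R>] conjI)
  qed
  then obtain \<P> where "finite \<P> \<and> \<Union>\<P> = X \<and> (\<forall>P\<in>\<P>. polytope P \<and> affine_on P g \<and> (\<forall>i\<in>I. affine_on P (f i)))" ..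
  then show ?thesis by (intro that[of \<P>]) blast+
qed

lemma pwa_Pair:
  assumes "pwa X f" "pwa X g" shows "pwa X (\<lambda>x. (f x, g x))"
proof -
  obtain \<P> where P:
    "finite \<P>" "\<Union>\<P> = X" "\<And>P. P \<in> \<P> \<Longrightarrow> polytope P" "\<And>P. P \<in> \<P> \<Longrightarrow> affine_on P g" "\<And>P i. P \<in> \<P> \<Longrightarrow> i \<in> {()} \<Longrightarrow> affine_on P f"
    by (rule pwa_common[of "{()}" X "\<lambda>_. f" g]) (use assms in simp_all)
  show ?thesis by (rule pwaI[OF P(1,2,3)]) (use P in \<open>auto intro: affine_on_Pair\<close>)
qed

lemma pwa_linear: "linear L \<Longrightarrow> pwa X f \<Longrightarrow> pwa X (\<lambda>x. L (f x))"
  by (erule pwa_map) (rule affine_on_linear)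

lemma pwa_add: "pwa X f \<Longrightarrow> pwa X g \<Longrightarrow> pwa X (\<lambda>x. f x + g x)"
  using pwa_linear[OF _ pwa_Pair, of "\<lambda>p. fst p + snd p" X f g]
  by (simp add: linear_compose_add linear_fst linear_snd)

lemma pwa_scaleR: "pwa X f \<Longrightarrow> pwa X (\<lambda>x. c *\<^sub>R f x)"
  by (erule pwa_map) (rule affine_on_scaleR)

lemma pwa_scaleR_left: "pwa X f \<Longrightarrow> pwa X (\<lambda>x. f x *\<^sub>R v)"
  by (erule pwa_map) (rule affine_on_scaleR_left)

lemma pwa_diff: "pwa X f \<Longrightarrow> pwa X g \<Longrightarrow> pwa X (\<lambda>x. f x - g x)"
  using pwa_add[of X f "\<lambda>x. (-1) *\<^sub>R g x"] pwa_scaleR[of X g "-1"] by simp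

lemma pwa_const: "pwa X f \<Longrightarrow> pwa X (\<lambda>x. c)"
  by (erule pwa_map) simp

lemma pwa_ident: "pwa X f \<Longrightarrow> pwa X (\<lambda>x. x)"
  by (erule pwa_map) simp

lemma pwa_sum:
  assumes "pwa X (g :: _ \<Rightarrow> 'c::real_vector)" "\<And>i. i \<in> I \<Longrightarrow> pwa X (f i)"
  shows "pwa X (\<lambda>x. \<Sum>i\<in>I. f i x)"
  using assms(2) by (induction I rule: infinite_finite_induct) (auto intro: pwa_add pwa_const[OF assms(1)])

lemma pwa_abs:
  fixes f :: "'a::euclidean_space \<Rightarrow> real"
  assumes "pwa X f" shows "pwa X (\<lambda>x. \<bar>f x\<bar>)"
proof -
  \<comment> \<open>Pieces are bounded, so the absolute value is PL only on an interval, which is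
    taken large enough for the compact image of \<open>f\<close>.\<close>
  have "compact (f ` X)"
    using assms by (intro compact_continuous_image pwa_continuous pwa_compact)
  then have "bounded (f ` X)" by (rule compact_imp_bounded)
  then obtain B where B: "B > 0" "\<And>y. y \<in> f ` X \<Longrightarrow> norm y \<le> B" unfolding bounded_pos by blast
  have "pwa {-B..B} (\<lambda>x::real. \<bar>x\<bar>)"
  proof (rule pwaI[of "{{-B..0},{0..B}}"])
    show "polytope P" if "P \<in> {{-B..0},{0..B}}" for P
      using that polytope_interval[of "-B" 0] polytope_interval[of 0 B] by auto
    show "affine_on P (\<lambda>x::real. \<bar>x\<bar>)" if P: "P \<in> {{-B..0},{0..B}}" for P
    proof -
      consider "P = {-B..0}" | "P = {0..B}" using P by auto
      then show ?thesis
      proof cases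
        case 1
        have "affine_on P (\<lambda>x::real. (-1) *\<^sub>R x)" by (intro affine_on_scaleR affine_on_id)
        then show ?thesis by (rule affine_on_cong) (auto simp: 1)
      next
        case 2
        show ?thesis by (rule affine_on_cong[OF affine_on_id]) (auto simp: 2)
      qed
    qed
  qed (use B in auto)
  moreover have "f ` X \<subseteq> {-B..B}"
  proof
    fix y assume "y \<in> f ` X"
    from B(2)[OF this] show "y \<in> {-B..B}" by (simp add: abs_le_iff minus_le_iff)
  qed
  ultimately show ?thesis by (rule pwa_compose[OF assms])
qed

lemma pwa_simplicial:
  assumes "simplicial_complex T" "\<And>S. S \<in> T \<Longrightarrow> affine_on S f" shows "pwa (\<Union>T) f"
  using assms by (intro pwaI[of T]) (auto simp: simplicial_complex_def intro: simplex_imp_polytope)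

lemma pl_map_on_pwa: "pl_map_on X f \<Longrightarrow> pwa X f"
  unfolding pl_map_on_def using pwa_simplicial by blast

text \<open>A large box is cut along all hyperplanes that bound some polytope of the family. Each
  polytope then meets each cell of the box in a face, so these intersections form a cell complex,
  and a simplicial subdivision of it has every simplex inside one polytope.\<close>

lemma polytopes_triangulation:
  fixes \<P> :: "'a::euclidean_space set set"
  assumes fin: "finite \<P>" and poly: "\<And>P. P \<in> \<P> \<Longrightarrow> polytope P"
  obtains T where "simplicial_complex T" "\<Union>T = \<Union>\<P>" "\<And>S. S \<in> T \<Longrightarrow> \<exists>P\<in>\<P>. S \<subseteq> P"
proof -
  have "bounded (\<Union>\<P>)" by (simp add: assms bounded_Union polytope_imp_bounded)
  then obtain c where c: "\<Union>\<P> \<subseteq> cbox (-c) c" using bounded_subset_cbox_symmetric by metis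
  have "\<forall>P\<in>\<P>. \<exists>F. finite F \<and> P = \<Inter>F \<and> (\<forall>h\<in>F. \<exists>a b. a \<noteq> 0 \<and> h = {x. a \<bullet> x \<le> b})"
    using polytope_imp_polyhedron[OF poly] unfolding polyhedron_def by blast
  then obtain \<F> where \<F>: "\<And>P. P \<in> \<P> \<Longrightarrow> finite (\<F> P)" "\<And>P. P \<in> \<P> \<Longrightarrow> P = \<Inter>(\<F> P)"
      "\<And>P h. P \<in> \<P> \<Longrightarrow> h \<in> \<F> P \<Longrightarrow> \<exists>a b. h = {x. a \<bullet> x \<le> b}"
    by metis
  define \<H> where "\<H> = \<Union>(\<F> ` \<P>)"
  have "finite \<H>" using \<F>(1) fin by (simp add: \<H>_def)
  have "\<forall>h\<in>\<H>. \<exists>p. h = {x. fst p \<bullet> x \<le> snd p}" using \<F>(3) unfolding \<H>_def by fastforce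
  then obtain hp where hp: "\<And>h. h \<in> \<H> \<Longrightarrow> h = {x. fst (hp h) \<bullet> x \<le> snd (hp h)}" by metis
  have "\<exists>\<G>. \<Union>\<G> = \<Union>{cbox (-c) c} \<and> finite \<G> \<and>
                 (\<forall>C \<in> \<G>. \<exists>D. D \<in> {cbox (-c) c} \<and> C \<subseteq> D) \<and>
                 (\<forall>C \<in> {cbox (-c) c}. \<forall>x \<in> C. \<exists>D. D \<in> \<G> \<and> x \<in> D \<and> D \<subseteq> C) \<and>
                 (\<forall>X \<in> \<G>. polytope X) \<and> (\<forall>X \<in> \<G>. aff_dim X \<le> DIM('a)) \<and>
                 (\<forall>X \<in> \<G>. \<forall>Y \<in> \<G>. X \<inter> Y face_of X) \<and>
                 (\<forall>X \<in> \<G>. \<forall>x \<in> X. \<forall>y \<in> X. \<forall>a b. (a,b) \<in> hp ` \<H> \<longrightarrow>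
                     a \<bullet> x \<le> b \<and> a \<bullet> y \<le> b \<or> a \<bullet> x \<ge> b \<and> a \<bullet> y \<ge> b)"
    by (rule cell_subdivision_lemma)
      (use \<open>finite \<H>\<close> in \<open>auto simp: polytope_interval face_of_refl convex_box aff_dim_le_DIM\<close>)
  then obtain \<G> where G: "\<Union>\<G> = cbox (-c) c" "finite \<G>" "\<And>X. X \<in> \<G> \<Longrightarrow> polytope X"
      "\<And>X Y. X \<in> \<G> \<Longrightarrow> Y \<in> \<G> \<Longrightarrow> X \<inter> Y face_of X"
    and sides: "\<And>X x y a b. X \<in> \<G> \<Longrightarrow> x \<in> X \<Longrightarrow> y \<in> X \<Longrightarrow> (a,b) \<in> hp ` \<H> \<Longrightarrow>
        a \<bullet> x \<le> b \<and> a \<bullet> y \<le> b \<or> a \<bullet> x \<ge> b \<and> a \<bullet> y \<ge> b"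
    by auto
  \<comment> \<open>A cell lies on one side of each hyperplane: it is contained in the half-space
    \<open>h\<close> as soon as one of its points is strictly inside, and otherwise it meets
    \<open>h\<close> only in the bounding hyperplane, which then supports the cell.\<close>
  have face1: "C \<inter> h face_of C" if "C \<in> \<G>" "h \<in> \<H>" for C h
  proof -
    obtain a b where ab: "hp h = (a, b)" by force
    have h: "h = {x. a \<bullet> x \<le> b}" using hp[OF that(2)] ab by simp
    have cvx: "convex C" using G(3) that polytope_imp_convex by blast
    show ?thesis
    proof (cases "\<exists>x\<in>C. a \<bullet> x < b")
      case True
      then obtain x where x: "x \<in> C" "a \<bullet> x < b" by auto
      have "C \<subseteq> h"
      proof
        fix y assume "y \<in> C"
        have "(a, b) \<in> hp ` \<H>" using that(2) ab by (metis image_eqI)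
        from sides[OF that(1) x(1) \<open>y \<in> C\<close> this] x show "y \<in> h" by (simp add: h)
      qed
      then have "C \<inter> h = C" by auto
      then show ?thesis using cvx by (simp add: face_of_refl)
    next
      case False
      then have "C \<inter> h = C \<inter> {x. a \<bullet> x = b}" by (force simp: h)
      then show ?thesis using False face_of_Int_supporting_hyperplane_ge[OF cvx, where a=a and b=b] by force
    qed
  qed
  have face2: "C \<inter> P face_of C" if "C \<in> \<G>" "P \<in> \<P>" for C P
  proof -
    have cvx: "convex C" using G(3) that polytope_imp_convex by blast
    have "C \<inter> P = \<Inter>(insert C ((\<lambda>h. C \<inter> h) ` \<F> P))" using \<F>(2)[OF that(2)] by auto
    also have "\<dots> face_of C"
      by (rule face_of_Inter) (use face1 that cvx in \<open>auto simp: \<H>_def face_of_refl\<close>)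
    finally show ?thesis .
  qed
  define \<C> where "\<C> = (\<lambda>(C,P). C \<inter> P) ` (\<G> \<times> \<P>)"
  have "finite \<C>" using G fin by (simp add: \<C>_def)
  moreover have "polytope X" if "X \<in> \<C>" for X
    using that G(3) poly by (auto simp: \<C>_def intro: polytope_Int)
  moreover have "X \<inter> Y face_of X" if "X \<in> \<C>" "Y \<in> \<C>" for X Y
  proof -
    obtain C P C' P' where X: "X = C \<inter> P" "Y = C' \<inter> P'" "C \<in> \<G>" "P \<in> \<P>" "C' \<in> \<G>" "P' \<in> \<P>"
      using \<open>X \<in> \<C>\<close> \<open>Y \<in> \<C>\<close> by (auto simp: \<C>_def)
    have "X \<inter> Y face_of C \<inter> C'" using X face2 by (simp add: face_of_Int_Int)
    then have "X \<inter> Y face_of C" using G(4)[OF X(3,5)] face_of_trans by blast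
    then show ?thesis by (rule face_of_subset) (auto simp: X)
  qed
  ultimately obtain T where T: "simplicial_complex T" "\<Union>T = \<Union>\<C>" "\<And>S. S \<in> T \<Longrightarrow> \<exists>C\<in>\<C>. S \<subseteq> C"
    using simplicial_subdivision_of_cell_complex[of \<C>] by metis
  show ?thesis
  proof
    have "\<Union>\<C> = \<Union>\<G> \<inter> \<Union>\<P>" unfolding \<C>_def by auto
    then show "\<Union>T = \<Union>\<P>" using c G(1) T(2) by auto
    show "\<exists>P\<in>\<P>. S \<subseteq> P" if "S \<in> T" for S
      using T(3)[OF that] by (auto simp: \<C>_def)
  qed (fact T(1))
qed

lemma pwa_triangulation:
  assumes "pwa X f"
  obtains T where "simplicial_complex T" "\<Union>T = X" "\<And>S. S \<in> T \<Longrightarrow> affine_on S f"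
proof -
  obtain \<P> where P: "finite \<P>" "\<Union>\<P> = X" "\<And>P. P \<in> \<P> \<Longrightarrow> polytope P" "\<And>P. P \<in> \<P> \<Longrightarrow> affine_on P f"
    using assms(1) by (rule pwaE) blast
  from polytopes_triangulation[OF P(1,3)] obtain T where
    "simplicial_complex T" "\<Union>T = \<Union>\<P>" "\<And>S. S \<in> T \<Longrightarrow> \<exists>P\<in>\<P>. S \<subseteq> P" by metis
  then show ?thesis using that P by (meson affine_on_subset)
qed


subsection \<open>Barycentric coordinates of a simplicial complex\<close>

text \<open>Simplices are handled through their vertex sets, so that faces become subsets and
  intersections of simplices become intersections of sets.\<close>

definition vsets :: "'a::euclidean_space set set \<Rightarrow> 'a set set"
  where "vsets T = {C. \<not> affine_dependent C \<and> convex hull C \<in> T}"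

text \<open>The total need not be 1: such a weight is a point of the abstract cone over
  \<open>T\<close>, with the zero weight as apex.\<close>

definition weight :: "'a::euclidean_space set set \<Rightarrow> ('a \<Rightarrow> real) \<Rightarrow> bool"
  where "weight T \<beta> \<longleftrightarrow> (\<forall>u. 0 \<le> \<beta> u) \<and> {u. \<beta> u \<noteq> 0} \<in> vsets T"

definition bary :: "'a::euclidean_space set set \<Rightarrow> 'a \<Rightarrow> 'a \<Rightarrow> real"
  where "bary T x = (SOME \<beta>. weight T \<beta> \<and> (\<Sum>u\<in>vertices T. \<beta> u) = 1 \<and> (\<Sum>u\<in>vertices T. \<beta> u *\<^sub>R u) = x)"

lemma convex_hull_inj_affine_independent:
  fixes C D :: "'a::euclidean_space set"
  assumes "\<not> affine_dependent C" "\<not> affine_dependent D" "convex hull C = convex hull D" shows "C = D"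
  using extreme_point_of_convex_hull_affine_independent[OF assms(1)]
    extreme_point_of_convex_hull_affine_independent[OF assms(2)] assms(3) by auto

lemma affine_independent_weights_unique:
  assumes "\<not> affine_dependent C" "finite C" "sum \<beta> C = sum \<gamma> C" "(\<Sum>u\<in>C. \<beta> u *\<^sub>R u) = (\<Sum>u\<in>C. \<gamma> u *\<^sub>R u)" "u \<in> C"
  shows "\<beta> u = \<gamma> u"
proof (rule ccontr)
  assume "\<beta> u \<noteq> \<gamma> u"
  moreover have "(\<Sum>u\<in>C. \<beta> u - \<gamma> u) = 0" "(\<Sum>u\<in>C. (\<beta> u - \<gamma> u) *\<^sub>R u) = 0"
    using assms(3,4) by (simp_all add: sum_subtractf scaleR_left_diff_distrib)
  ultimately have "affine_dependent C"
    unfolding affine_dependent_explicit_finite[OF assms(2)]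
    by (intro exI[of _ "\<lambda>u. \<beta> u - \<gamma> u"] conjI bexI[of _ u]) (use assms(5) in simp_all)
  with assms(1) show False ..
qed

context
  fixes T :: "'a::euclidean_space set set"
  assumes T: "simplicial_complex T"
begin

lemma vsets_finite: "C \<in> vsets T \<Longrightarrow> finite C"
  unfolding vsets_def by (simp add: aff_independent_finite)

lemma vsets_subset: assumes "C \<in> vsets T" "D \<subseteq> C" shows "D \<in> vsets T"
proof -
  have "\<not> affine_dependent D" using assms affine_dependent_subset unfolding vsets_def by blast
  moreover have "convex hull D face_of convex hull C"
    using assms unfolding vsets_def by (auto simp: face_of_convex_hull_affine_independent)
  moreover have "F \<in> T" if "S \<in> T" "F face_of S" for F S
    using T that unfolding simplicial_complex_def by blast
  ultimately show ?thesis
    using assms unfolding vsets_def by blast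
qed

lemma simplex_vsets: assumes "S \<in> T" obtains C where "C \<in> vsets T" "S = convex hull C"
proof -
  obtain n where "n simplex S" using T assms by (auto simp: simplicial_complex_def)
  then show ?thesis using that assms by (auto simp: vsets_def simplex_def)
qed

text \<open>The intersection is a face of both simplices, hence spanned by a subset of
  \<open>C\<close> and also by a subset of \<open>D\<close>; affine independence makes these two
  subsets equal.\<close>

lemma vsets_Int_hull: assumes C: "C \<in> vsets T" and D: "D \<in> vsets T"
  shows "convex hull C \<inter> convex hull D = convex hull (C \<inter> D)"
proof
  have TT: "S \<inter> S' face_of S" if "S \<in> T" "S' \<in> T" for S S' using T that by (simp add: simplicial_complex_def)
  have "convex hull C \<inter> convex hull D face_of convex hull C" "convex hull D \<inter> convex hull C face_of convex hull D"
    using assms by (auto simp: vsets_def intro: TT)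
  then obtain C' D' where CD: "C' \<subseteq> C" "convex hull C \<inter> convex hull D = convex hull C'"
     "D' \<subseteq> D" "convex hull D \<inter> convex hull C = convex hull D'"
    using C D unfolding vsets_def by (auto simp: face_of_convex_hull_affine_independent)
  have "C' \<in> vsets T" "D' \<in> vsets T" using vsets_subset C D CD by blast+
  moreover have "convex hull C' = convex hull D'" using CD(2,4) by blast
  ultimately have "C' = D'" by (simp add: convex_hull_inj_affine_independent vsets_def)
  then have "C' \<subseteq> C \<inter> D" using CD by blast
  then show "convex hull C \<inter> convex hull D \<subseteq> convex hull (C \<inter> D)" using CD(2) hull_mono by metis
  show "convex hull (C \<inter> D) \<subseteq> convex hull C \<inter> convex hull D" by (simp add: hull_mono)
qed

lemma vsets_hull_subset:
  assumes "C \<in> vsets T" "D \<in> vsets T" "convex hull C \<subseteq> convex hull D" shows "C \<subseteq> D"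
proof -
  have "convex hull C = convex hull (C \<inter> D)" using vsets_Int_hull[OF assms(1,2)] assms(3) by blast
  moreover have "\<not> affine_dependent C" "\<not> affine_dependent (C \<inter> D)"
    using assms vsets_subset[OF assms(1), of "C \<inter> D"] by (auto simp: vsets_def)
  ultimately have "C = C \<inter> D" by (rule convex_hull_inj_affine_independent[rotated 2])
  then show ?thesis by blast
qed

lemma vsets_vertices: assumes "C \<in> vsets T" shows "C \<subseteq> vertices T"
proof
  fix x assume "x \<in> C"
  then have "{x} \<in> vsets T" using vsets_subset[OF assms] by simp
  then show "x \<in> vertices T" by (simp add: vsets_def vertices_def)
qed

lemma finite_vertices: "finite (vertices T)"
proof -
  have "inj_on (\<lambda>x. {x}) (vertices T)" by simp
  moreover have "(\<lambda>x. {x}) ` vertices T \<subseteq> T" by (auto simp: vertices_def)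
  moreover have "finite T" using T by (simp add: simplicial_complex_def)
  ultimately show ?thesis by (meson finite_imageD finite_subset)
qed

lemma finite_vsets: "finite (vsets T)"
  by (rule finite_subset[of _ "Pow (vertices T)"]) (use vsets_vertices finite_vertices in auto)

lemma hull_vsets_in: "C \<in> vsets T \<Longrightarrow> convex hull C \<in> T"
  by (simp add: vsets_def)

lemma weight_ge0: "weight T \<beta> \<Longrightarrow> 0 \<le> \<beta> u"
  by (simp add: weight_def)

lemma weight_sum:
  assumes "{u. \<beta> u \<noteq> 0} \<subseteq> C" "C \<subseteq> vertices T"
  shows "(\<Sum>u\<in>vertices T. \<beta> u) = (\<Sum>u\<in>C. \<beta> u)" "(\<Sum>u\<in>vertices T. \<beta> u *\<^sub>R u) = (\<Sum>u\<in>C. \<beta> u *\<^sub>R u)"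
proof -
  have "\<forall>u\<in>vertices T - C. \<beta> u = 0" using assms(1) by auto
  then show "(\<Sum>u\<in>vertices T. \<beta> u) = (\<Sum>u\<in>C. \<beta> u)" "(\<Sum>u\<in>vertices T. \<beta> u *\<^sub>R u) = (\<Sum>u\<in>C. \<beta> u *\<^sub>R u)"
    using assms(2) by (auto intro!: sum.mono_neutral_right finite_vertices)
qed

lemma weight_vsetsI:
  assumes "C \<in> vsets T" "{u. \<beta> u \<noteq> 0} \<subseteq> C" "\<And>u. 0 \<le> \<beta> u" shows "weight T \<beta>"
  using assms vsets_subset by (auto simp: weight_def)

lemma weight_point:
  assumes "weight T \<beta>" "(\<Sum>u\<in>vertices T. \<beta> u) = 1" "{u. \<beta> u \<noteq> 0} \<subseteq> C" "C \<in> vsets T"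
  shows "(\<Sum>u\<in>vertices T. \<beta> u *\<^sub>R u) \<in> convex hull C"
proof -
  have "(\<Sum>u\<in>C. \<beta> u *\<^sub>R u) \<in> convex hull C"
    by (rule convex_sum)
      (use assms weight_sum[OF assms(3) vsets_vertices[OF assms(4)]] vsets_finite in \<open>auto simp: weight_def hull_inc\<close>)
  then show ?thesis using weight_sum[OF assms(3) vsets_vertices[OF assms(4)]] by simp
qed

lemma weight_exists:
  assumes "x \<in> convex hull C" "C \<in> vsets T"
  obtains \<beta> where "weight T \<beta>" "(\<Sum>u\<in>vertices T. \<beta> u) = 1" "(\<Sum>u\<in>vertices T. \<beta> u *\<^sub>R u) = x" "{u. \<beta> u \<noteq> 0} \<subseteq> C"
proof -
  obtain \<gamma> where \<gamma>: "\<forall>u\<in>C. 0 \<le> \<gamma> u" "sum \<gamma> C = 1" "(\<Sum>u\<in>C. \<gamma> u *\<^sub>R u) = x"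
    using assms by (auto simp: convex_hull_finite vsets_finite)
  define \<beta> where "\<beta> u = (if u \<in> C then \<gamma> u else 0)" for u
  have s: "{u. \<beta> u \<noteq> 0} \<subseteq> C" by (auto simp: \<beta>_def)
  have "weight T \<beta>" using \<gamma> by (intro weight_vsetsI[OF assms(2) s]) (simp add: \<beta>_def)
  then show ?thesis
    using that[of \<beta>] s \<gamma> weight_sum[OF s vsets_vertices[OF assms(2)]] by (simp add: \<beta>_def)
qed

text \<open>The two supports may differ, but the point lies in the hulls of both and hence in the
  hull of their intersection. Each weight is compared, inside one simplex, with a weight supported
  on that intersection.\<close>

lemma weight_unique1:
  assumes b: "weight T \<beta>" "(\<Sum>u\<in>vertices T. \<beta> u) = 1" and c: "weight T \<gamma>" "(\<Sum>u\<in>vertices T. \<gamma> u) = 1"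
    and eq: "(\<Sum>u\<in>vertices T. \<beta> u *\<^sub>R u) = (\<Sum>u\<in>vertices T. \<gamma> u *\<^sub>R u)"
  shows "\<beta> = \<gamma>"
proof -
  define C where "C = {u. \<beta> u \<noteq> 0}"
  define D where "D = {u. \<gamma> u \<noteq> 0}"
  have CD: "C \<in> vsets T" "D \<in> vsets T" using b c by (auto simp: C_def D_def weight_def)
  have key: "\<beta>' = \<delta>" if "weight T \<beta>'" "(\<Sum>u\<in>vertices T. \<beta>' u) = 1" "weight T \<delta>" "(\<Sum>u\<in>vertices T. \<delta> u) = 1"
      "(\<Sum>u\<in>vertices T. \<beta>' u *\<^sub>R u) = (\<Sum>u\<in>vertices T. \<delta> u *\<^sub>R u)" "{u. \<beta>' u \<noteq> 0} \<subseteq> E" "{u. \<delta> u \<noteq> 0} \<subseteq> E" "E \<in> vsets T" for \<beta>' \<delta> E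
  proof
    fix u
    have fE: "finite E" "\<not> affine_dependent E" using \<open>E \<in> vsets T\<close> by (auto simp: vsets_finite vsets_def)
    have "sum \<beta>' E = sum \<delta> E" "(\<Sum>u\<in>E. \<beta>' u *\<^sub>R u) = (\<Sum>u\<in>E. \<delta> u *\<^sub>R u)"
      using that weight_sum[OF that(6) vsets_vertices[OF that(8)]] weight_sum[OF that(7) vsets_vertices[OF that(8)]] by simp_all
    then have "u \<in> E \<Longrightarrow> \<beta>' u = \<delta> u" by (rule affine_independent_weights_unique[OF fE(2,1)])
    then show "\<beta>' u = \<delta> u" using that(6,7) by (cases "u \<in> E") force+
  qed
  define x where "x = (\<Sum>u\<in>vertices T. \<beta> u *\<^sub>R u)"
  have "x \<in> convex hull C" using weight_point[OF b, of C] CD by (simp add: C_def x_def)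
  moreover have "x \<in> convex hull D" using weight_point[OF c, of D] CD eq by (simp add: D_def x_def)
  ultimately have "x \<in> convex hull (C \<inter> D)" using vsets_Int_hull[OF CD] by blast
  moreover have "C \<inter> D \<in> vsets T" using CD vsets_subset by blast
  ultimately obtain \<delta> where \<delta>: "weight T \<delta>" "(\<Sum>u\<in>vertices T. \<delta> u) = 1" "(\<Sum>u\<in>vertices T. \<delta> u *\<^sub>R u) = x" "{u. \<delta> u \<noteq> 0} \<subseteq> C \<inter> D"
    by (rule weight_exists)
  have "\<beta> = \<delta>" by (rule key[of _ _ C]) (use b \<delta> CD in \<open>auto simp: x_def C_def\<close>)
  moreover have "\<gamma> = \<delta>" by (rule key[of _ _ D]) (use c \<delta> CD eq in \<open>auto simp: x_def D_def\<close>)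
  ultimately show ?thesis by simp
qed

lemma weight_scale: "weight T \<beta> \<Longrightarrow> 0 \<le> c \<Longrightarrow> weight T (\<lambda>u. c * \<beta> u)"
  by (rule weight_vsetsI[of "{u. \<beta> u \<noteq> 0}"]) (auto simp: weight_def)

lemma weight_sum_zero:
  assumes "weight T \<beta>" "(\<Sum>u\<in>vertices T. \<beta> u) = 0" shows "\<beta> u = 0"
proof (cases "u \<in> vertices T")
  case True
  then show ?thesis using assms sum_nonneg_eq_0_iff[OF finite_vertices, of \<beta>] by (auto simp: weight_def)
next
  case False
  then show ?thesis using assms vsets_vertices[of "{u. \<beta> u \<noteq> 0}"] by (auto simp: weight_def)
qed

text \<open>A common positive total can be scaled to 1; total 0 forces both weights to
  vanish.\<close>

lemma weight_unique:
  assumes b: "weight T \<beta>" and c: "weight T \<gamma>" and s: "(\<Sum>u\<in>vertices T. \<beta> u) = (\<Sum>u\<in>vertices T. \<gamma> u)"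
    and eq: "(\<Sum>u\<in>vertices T. \<beta> u *\<^sub>R u) = (\<Sum>u\<in>vertices T. \<gamma> u *\<^sub>R u)"
  shows "\<beta> = \<gamma>"
proof (cases "(\<Sum>u\<in>vertices T. \<beta> u) = 0")
  case True
  then show ?thesis using weight_sum_zero[OF b] weight_sum_zero[OF c] s by (intro ext) simp
next
  case False
  define m where "m = (\<Sum>u\<in>vertices T. \<beta> u)"
  have "m > 0" using False b sum_nonneg[of "vertices T" \<beta>] by (simp add: m_def weight_def order_less_le)
  have "(\<lambda>u. inverse m * \<beta> u) = (\<lambda>u. inverse m * \<gamma> u)"
  proof (rule weight_unique1)
    show "(\<Sum>u\<in>vertices T. (inverse m * \<beta> u) *\<^sub>R u) = (\<Sum>u\<in>vertices T. (inverse m * \<gamma> u) *\<^sub>R u)"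
      using arg_cong[OF eq, of "scaleR (inverse m)"] by (simp add: scaleR_sum_right)
    show "(\<Sum>u\<in>vertices T. inverse m * \<beta> u) = 1" "(\<Sum>u\<in>vertices T. inverse m * \<gamma> u) = 1"
      using \<open>m > 0\<close> s by (simp_all add: m_def flip: sum_distrib_left)
  qed (use \<open>m > 0\<close> b c in \<open>auto intro: weight_scale\<close>)
  then show ?thesis using \<open>m > 0\<close> by (auto simp: fun_eq_iff)
qed

lemma bary:
  assumes "x \<in> \<Union>T"
  shows "weight T (bary T x)" "(\<Sum>u\<in>vertices T. bary T x u) = 1" "(\<Sum>u\<in>vertices T. bary T x u *\<^sub>R u) = x"
proof -
  obtain S where "x \<in> S" "S \<in> T" using assms by blast
  then obtain C where C: "C \<in> vsets T" "x \<in> convex hull C" by (metis simplex_vsets)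
  have "\<exists>\<beta>. weight T \<beta> \<and> (\<Sum>u\<in>vertices T. \<beta> u) = 1 \<and> (\<Sum>u\<in>vertices T. \<beta> u *\<^sub>R u) = x"
    using weight_exists[OF C(2,1)] by metis
  then have "weight T (bary T x) \<and> (\<Sum>u\<in>vertices T. bary T x u) = 1 \<and> (\<Sum>u\<in>vertices T. bary T x u *\<^sub>R u) = x"
    unfolding bary_def by (rule someI_ex)
  then show "weight T (bary T x)" "(\<Sum>u\<in>vertices T. bary T x u) = 1" "(\<Sum>u\<in>vertices T. bary T x u *\<^sub>R u) = x" by auto
qed

lemma bary_eqI:
  assumes "weight T \<beta>" "(\<Sum>u\<in>vertices T. \<beta> u) = 1" "(\<Sum>u\<in>vertices T. \<beta> u *\<^sub>R u) = x"
  shows "bary T x = \<beta>"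
proof -
  have "x \<in> convex hull {u. \<beta> u \<noteq> 0}" using weight_point[OF assms(1,2), of "{u. \<beta> u \<noteq> 0}"] assms by (simp add: weight_def)
  then have "x \<in> \<Union>T" using assms(1) by (auto simp: weight_def vsets_def)
  then show ?thesis using bary assms by (intro weight_unique1) auto
qed

lemma bary_support:
  assumes "x \<in> convex hull C" "C \<in> vsets T" shows "{u. bary T x u \<noteq> 0} \<subseteq> C"
proof -
  obtain \<beta> where "weight T \<beta>" "(\<Sum>u\<in>vertices T. \<beta> u) = 1" "(\<Sum>u\<in>vertices T. \<beta> u *\<^sub>R u) = x" "{u. \<beta> u \<noteq> 0} \<subseteq> C"
    by (rule weight_exists[OF assms])
  then show ?thesis using bary_eqI by metis
qed

lemma bary_support_hull:
  assumes "x \<in> \<Union>T" "{u. bary T x u \<noteq> 0} \<subseteq> C" "C \<in> vsets T" shows "x \<in> convex hull C"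
  using weight_point[OF bary(1,2)[OF assms(1)] assms(2,3)] bary(3)[OF assms(1)] by simp

lemma bary_segment:
  assumes S: "S \<in> T" and x: "x \<in> S" and y: "y \<in> S" and t: "0 \<le> t" "t \<le> 1"
  shows "bary T ((1 - t) *\<^sub>R x + t *\<^sub>R y) = (\<lambda>u. (1 - t) * bary T x u + t * bary T y u)"
proof (rule bary_eqI)
  obtain C where C: "C \<in> vsets T" "S = convex hull C" using S by (rule simplex_vsets)
  have xy: "x \<in> \<Union>T" "y \<in> \<Union>T" using S x y by auto
  have "bary T x u = 0" "bary T y u = 0" if "u \<notin> C" for u
    using bary_support[of x C] bary_support[of y C] C x y that by auto
  then have "{u. (1 - t) * bary T x u + t * bary T y u \<noteq> 0} \<subseteq> C" by force
  then show "weight T (\<lambda>u. (1 - t) * bary T x u + t * bary T y u)"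
    by (rule weight_vsetsI[OF C(1)]) (use bary(1)[OF xy(1)] bary(1)[OF xy(2)] t in \<open>auto simp: weight_def\<close>)
  show "(\<Sum>u\<in>vertices T. (1 - t) * bary T x u + t * bary T y u) = 1"
    using xy by (simp add: sum.distrib bary flip: sum_distrib_left)
  show "(\<Sum>u\<in>vertices T. ((1 - t) * bary T x u + t * bary T y u) *\<^sub>R u) = (1 - t) *\<^sub>R x + t *\<^sub>R y"
    using xy by (simp add: scaleR_left_distrib sum.distrib bary flip: scaleR_scaleR scaleR_sum_right)
qed

lemma bary_affine: assumes "S \<in> T" shows "affine_on S (\<lambda>x. bary T x u)"
  unfolding affine_on_def using bary_segment[OF assms] by auto

lemma pwa_bary: "pwa (\<Union>T) (\<lambda>x. bary T x u)"
  by (rule pwa_simplicial[OF T]) (rule bary_affine)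

end


subsection \<open>Flags of superlevel sets\<close>

text \<open>This is the layer-cake decomposition of \<beta>: the sets with nonzero coefficient are
  its superlevel sets at positive values, and the coefficients are the gaps between consecutive
  values. For the barycentric coordinates of a point, the chain is the flag of the simplex of the
  barycentric subdivision that contains the point in its relative interior.\<close>

definition chainrep :: "('a \<Rightarrow> real) \<Rightarrow> ('a set \<Rightarrow> real) \<Rightarrow> bool"
  where "chainrep \<beta> c \<longleftrightarrow> (\<forall>C. 0 \<le> c C) \<and> finite {C. c C \<noteq> 0} \<and>
    (\<forall>C D. c C \<noteq> 0 \<longrightarrow> c D \<noteq> 0 \<longrightarrow> C \<subseteq> D \<or> D \<subseteq> C) \<and>
    (\<forall>C. c C \<noteq> 0 \<longrightarrow> finite C \<and> C \<noteq> {}) \<and>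
    (\<forall>u. \<beta> u = (\<Sum>C | c C \<noteq> 0. if u \<in> C then c C else 0))"

definition coef :: "('a \<Rightarrow> real) \<Rightarrow> 'a set \<Rightarrow> real"
  where "coef \<beta> = (THE c. chainrep \<beta> c)"

definition centroid :: "'a::real_vector set \<Rightarrow> 'a"
  where "centroid C = (1 / real (card C)) *\<^sub>R \<Sum>C"

lemma chainrep_nonneg: "chainrep \<beta> c \<Longrightarrow> 0 \<le> c C"
  by (simp add: chainrep_def)

lemma chainrep_sum:
  assumes "chainrep \<beta> c" "finite S" "{C. c C \<noteq> 0} \<subseteq> S"
  shows "\<beta> u = (\<Sum>C\<in>S. if u \<in> C then c C else 0)"
proof -
  have "\<beta> u = (\<Sum>C | c C \<noteq> 0. if u \<in> C then c C else 0)" using assms by (simp add: chainrep_def)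
  also have "\<dots> = (\<Sum>C\<in>S. if u \<in> C then c C else 0)"
    by (rule sum.mono_neutral_left) (use assms in auto)
  finally show ?thesis .
qed

lemma chainrepI:
  assumes "\<And>C. 0 \<le> c C" "finite S" "{C. c C \<noteq> 0} \<subseteq> S" "\<And>C D. c C \<noteq> 0 \<Longrightarrow> c D \<noteq> 0 \<Longrightarrow> C \<subseteq> D \<or> D \<subseteq> C"
    "\<And>C. c C \<noteq> 0 \<Longrightarrow> finite C" "\<And>C. c C \<noteq> 0 \<Longrightarrow> C \<noteq> {}" "\<And>u. \<beta> u = (\<Sum>C\<in>S. if u \<in> C then c C else 0)"
  shows "chainrep \<beta> c"
proof -
  have "(\<Sum>C | c C \<noteq> 0. if u \<in> C then c C else 0) = (\<Sum>C\<in>S. if u \<in> C then c C else 0)" for u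
    by (rule sum.mono_neutral_left) (use assms in auto)
  then show ?thesis using assms finite_subset[of "{C. c C \<noteq> 0}" S] by (simp add: chainrep_def)
qed

lemma chainrep_le: assumes "chainrep \<beta> c" "u \<in> C" shows "c C \<le> \<beta> u"
proof (cases "c C = 0")
  case True
  have "0 \<le> (\<Sum>C | c C \<noteq> 0. if u \<in> C then c C else 0)" using assms by (intro sum_nonneg) (simp add: chainrep_def)
  then show ?thesis using assms(1) True by (simp add: chainrep_def)
next
  case False
  have fin: "finite {C. c C \<noteq> 0}" using assms by (simp add: chainrep_def)
  have "(\<Sum>C | c C \<noteq> 0. if u \<in> C then c C else 0) \<ge> (\<Sum>C\<in>{C}. if u \<in> C then c C else 0)"
    by (rule sum_mono2) (use fin False chainrep_nonneg[OF assms(1)] in auto)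
  then show ?thesis using assms by (simp add: chainrep_def)
qed

lemma chainrep_support: assumes "chainrep \<beta> c" "c C \<noteq> 0" shows "C \<subseteq> {u. \<beta> u \<noteq> 0}"
proof
  fix u assume "u \<in> C"
  then show "u \<in> {u. \<beta> u \<noteq> 0}" using chainrep_le[OF assms(1), of u C] chainrep_nonneg[OF assms(1), of C] assms(2) by auto
qed

lemma chainrep_support_Union: assumes "chainrep \<beta> c" "\<beta> u \<noteq> 0" shows "\<exists>C. c C \<noteq> 0 \<and> u \<in> C"
proof (rule ccontr)
  assume "\<nexists>C. c C \<noteq> 0 \<and> u \<in> C"
  then have "(\<Sum>C | c C \<noteq> 0. if u \<in> C then c C else 0) = 0" by (intro sum.neutral) auto
  then show False using assms by (simp add: chainrep_def)
qed

text \<open>A nonempty finite chain has a largest member, which is its union.\<close>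

lemma finite_chain_proper_Union:
  assumes "finite \<C>" "\<And>C D. C \<in> \<C> \<Longrightarrow> D \<in> \<C> \<Longrightarrow> C \<subseteq> D \<or> D \<subseteq> C" "\<And>C. C \<in> \<C> \<Longrightarrow> C \<subset> A" "A \<noteq> {}"
  shows "\<Union>\<C> \<subset> A"
  using assms(1-3)
proof (induction \<C>)
  case empty
  then show ?case using assms(4) by auto
next
  case (insert C \<C>)
  have IH: "\<Union>\<C> \<subset> A" by (rule insert.IH) (use insert.prems in auto)
  have "C \<subset> A" using insert.prems by auto
  have "\<Union>\<C> \<subseteq> C \<or> (\<exists>D\<in>\<C>. C \<subseteq> D)" using insert.prems(1)[of C] by blast
  then show ?case using IH \<open>C \<subset> A\<close> by blast
qed

text \<open>Some point \<open>u\<close> of the support lies in no smaller set of the chain, so its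
  value is \<open>c A\<close>; every other value on the support is at least that. Hence the
  coefficient of the outermost set is forced, and removing this layer leaves a decomposition of the
  remainder.\<close>

lemma chainrep_top:
  assumes c: "chainrep \<beta> c" and A: "A = {u. \<beta> u \<noteq> 0}" "A \<noteq> {}" "finite A"
  shows "c A = Min (\<beta> ` A)" "chainrep (\<lambda>u. \<beta> u - (if u \<in> A then Min (\<beta> ` A) else 0)) (c(A := 0))"
proof -
  define \<C> where "\<C> = {C. c C \<noteq> 0}"
  have fin: "finite \<C>" using c by (simp add: chainrep_def \<C>_def)
  have ch: "C \<subseteq> D \<or> D \<subseteq> C" if "C \<in> \<C>" "D \<in> \<C>" for C D using c that by (simp add: chainrep_def \<C>_def)
  have "\<Union>(\<C> - {A}) \<subset> A"
    by (rule finite_chain_proper_Union)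
      (use fin ch A chainrep_support[OF c] in \<open>auto simp: \<C>_def psubset_eq\<close>)
  then obtain u where u: "u \<in> A" "u \<notin> \<Union>(\<C> - {A})" by blast
  have "\<beta> u = (\<Sum>C\<in>insert A \<C>. if u \<in> C then c C else 0)"
    by (rule chainrep_sum[OF c]) (use fin in \<open>auto simp: \<C>_def\<close>)
  also have "\<dots> = (\<Sum>C\<in>{A}. if u \<in> C then c C else 0)"
    by (rule sum.mono_neutral_right) (use fin u in auto)
  finally have "\<beta> u = c A" using u by simp
  moreover have "c A \<le> \<beta> w" if "w \<in> A" for w using chainrep_le[OF c that] .
  ultimately show m: "c A = Min (\<beta> ` A)"
    using u(1) A(3) by (intro Min_eqI[symmetric]) (auto intro: image_eqI[of _ _ u])
  show "chainrep (\<lambda>u. \<beta> u - (if u \<in> A then Min (\<beta> ` A) else 0)) (c(A := 0))"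
  proof (rule chainrepI[of _ "insert A \<C>"])
    fix w
    have "\<beta> w = (\<Sum>C\<in>insert A \<C>. if w \<in> C then c C else 0)"
      by (rule chainrep_sum[OF c]) (use fin in \<open>auto simp: \<C>_def\<close>)
    also have "\<dots> = (if w \<in> A then c A else 0) + (\<Sum>C\<in>\<C> - {A}. if w \<in> C then c C else 0)"
      using fin by (simp add: sum.insert_remove)
    also have "(\<Sum>C\<in>\<C> - {A}. if w \<in> C then c C else 0) = (\<Sum>C\<in>insert A \<C>. if w \<in> C then (c(A := 0)) C else 0)"
    proof -
      have "(\<Sum>C\<in>\<C> - {A}. if w \<in> C then c C else 0) = (\<Sum>C\<in>\<C> - {A}. if w \<in> C then (c(A := 0)) C else 0)"
        by (intro sum.cong) auto
      then show ?thesis using fin by (simp add: sum.insert_remove)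
    qed
    finally show "\<beta> w - (if w \<in> A then Min (\<beta> ` A) else 0) = (\<Sum>C\<in>insert A \<C>. if w \<in> C then (c(A := 0)) C else 0)"
      using m by simp
  qed (use c fin in \<open>auto simp: \<C>_def chainrep_def split: if_splits\<close>)
qed

text \<open>Subtracting the minimum over the support shrinks the support, because a point where it
  is attained drops out. By \<open>chainrep_top\<close> the removed layer was forced, so existence
  and uniqueness go through the induction together.\<close>

lemma chainrep_ex1:
  assumes "\<And>u. 0 \<le> \<beta> u" "finite {u. \<beta> u \<noteq> 0}" shows "\<exists>!c. chainrep \<beta> c"
  using assms
proof (induction "card {u. \<beta> u \<noteq> 0}" arbitrary: \<beta> rule: less_induct)
  case less
  define A where "A = {u. \<beta> u \<noteq> 0}"
  show ?case
  proof (cases "A = {}")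
    case True
    show ?thesis
    proof (rule ex1I[of _ "\<lambda>C. 0"])
      show "chainrep \<beta> (\<lambda>C. 0)" using True by (auto simp: chainrep_def A_def)
      show "c = (\<lambda>C. 0)" if "chainrep \<beta> c" for c
      proof
        fix C show "c C = 0"
          using chainrep_support[OF that, of C] that True unfolding A_def chainrep_def by blast
      qed
    qed
  next
    case False
    define m where "m = Min (\<beta> ` A)"
    define \<gamma> where "\<gamma> u = \<beta> u - (if u \<in> A then m else 0)" for u
    have finA: "finite A" using less.prems by (simp add: A_def)
    have "m \<in> \<beta> ` A" unfolding m_def by (rule Min_in) (use finA False in auto)
    then obtain w where w: "w \<in> A" "\<beta> w = m" by auto
    have mle: "m \<le> \<beta> u" if "u \<in> A" for u unfolding m_def using that finA by simp
    have "m > 0" using w less.prems(1)[of w] by (simp add: A_def)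
    have g0: "0 \<le> \<gamma> u" for u using mle less.prems(1) by (simp add: \<gamma>_def)
    have sub: "{u. \<gamma> u \<noteq> 0} \<subseteq> A - {w}" using w by (auto simp: \<gamma>_def A_def)
    then have "card {u. \<gamma> u \<noteq> 0} \<le> card (A - {w})" "finite {u. \<gamma> u \<noteq> 0}"
      using finA by (auto intro: card_mono finite_subset)
    moreover have "card (A - {w}) < card A" using card_Diff1_less[OF finA w(1)] .
    ultimately have "\<exists>!c. chainrep \<gamma> c" using g0 unfolding A_def by (intro less.hyps) linarith+
    then obtain c where c: "chainrep \<gamma> c" and uniq: "\<And>d. chainrep \<gamma> d \<Longrightarrow> d = c" by blast
    have csub: "C \<subseteq> A - {w}" if "c C \<noteq> 0" for C using chainrep_support[OF c that] sub by blast
    then have cA: "c A = 0" using w by blast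
    show ?thesis
    proof (rule ex1I[of _ "c(A := m)"])
      show "chainrep \<beta> (c(A := m))"
      proof (rule chainrepI[of _ "insert A {C. c C \<noteq> 0}"])
        have fin: "finite {C. c C \<noteq> 0}" using c by (simp add: chainrep_def)
        then show "finite (insert A {C. c C \<noteq> 0})" by simp
        show "\<beta> u = (\<Sum>C\<in>insert A {C. c C \<noteq> 0}. if u \<in> C then (c(A := m)) C else 0)" for u
        proof -
          have "\<gamma> u = (\<Sum>C | c C \<noteq> 0. if u \<in> C then c C else 0)" using c by (simp add: chainrep_def)
          moreover have "(\<Sum>C | c C \<noteq> 0. if u \<in> C then (c(A := m)) C else 0) = (\<Sum>C | c C \<noteq> 0. if u \<in> C then c C else 0)"
            using cA by (intro sum.cong) auto
          moreover have "\<beta> u = \<gamma> u + (if u \<in> A then m else 0)" by (simp add: \<gamma>_def)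
          ultimately show ?thesis using cA fin by simp
        qed
      qed (use c csub False finA \<open>m > 0\<close> in \<open>auto simp: chainrep_def split: if_splits\<close>)
      show "d = c(A := m)" if d: "chainrep \<beta> d" for d
      proof -
        have "d A = m" "chainrep (\<lambda>u. \<beta> u - (if u \<in> A then m else 0)) (d(A := 0))"
          unfolding m_def using chainrep_top[OF d A_def False finA] by blast+
        then have "d(A := 0) = c" using uniq by (simp add: \<gamma>_def[abs_def])
        then show ?thesis using \<open>d A = m\<close> by (metis fun_upd_triv fun_upd_upd)
      qed
    qed
  qed
qed

lemma chainrep_support_eq:
  assumes "chainrep \<beta> c" shows "finite {u. \<beta> u \<noteq> 0}" "0 \<le> \<beta> u"
proof -
  have "{u. \<beta> u \<noteq> 0} \<subseteq> \<Union>{C. c C \<noteq> 0}" using chainrep_support_Union[OF assms] by blast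
  moreover have "finite (\<Union>{C. c C \<noteq> 0})" using assms by (auto simp: chainrep_def)
  ultimately show "finite {u. \<beta> u \<noteq> 0}" by (rule finite_subset)
  have "0 \<le> (\<Sum>C | c C \<noteq> 0. if u \<in> C then c C else 0)" using assms by (intro sum_nonneg) (simp add: chainrep_def)
  then show "0 \<le> \<beta> u" using assms by (simp add: chainrep_def)
qed

lemma coef_eq: "chainrep \<beta> c \<Longrightarrow> coef \<beta> = c"
  unfolding coef_def by (rule the1_equality[OF chainrep_ex1]) (auto intro: chainrep_support_eq)

lemma chainrep_coef:
  assumes "\<And>u. 0 \<le> \<beta> u" "finite {u. \<beta> u \<noteq> 0}" shows "chainrep \<beta> (coef \<beta>)"
  unfolding coef_def by (rule theI'[OF chainrep_ex1[OF assms]])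

text \<open>Decompositions add up whenever their chains together still form a chain. With uniqueness
  this computes \<open>coef\<close> of a sum, which is how the splitting of \<open>f\<close> near a
  barycentre is obtained.\<close>

lemma chainrep_combine:
  assumes "chainrep \<beta> c" "chainrep \<gamma> d" "0 \<le> s" "0 \<le> t"
    "\<And>C D. c C \<noteq> 0 \<Longrightarrow> d D \<noteq> 0 \<Longrightarrow> C \<subseteq> D \<or> D \<subseteq> C"
  shows "chainrep (\<lambda>u. s * \<beta> u + t * \<gamma> u) (\<lambda>C. s * c C + t * d C)"
proof (rule chainrepI[of _ "{C. c C \<noteq> 0} \<union> {C. d C \<noteq> 0}"])
  fix u
  have fin: "finite ({C. c C \<noteq> 0} \<union> {C. d C \<noteq> 0})" using assms by (simp add: chainrep_def)
  have "s * \<beta> u + t * \<gamma> u = (\<Sum>C\<in>{C. c C \<noteq> 0} \<union> {C. d C \<noteq> 0}. s * (if u \<in> C then c C else 0) + t * (if u \<in> C then d C else 0))"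
    using chainrep_sum[OF assms(1) fin, of u] chainrep_sum[OF assms(2) fin, of u]
    by (simp add: sum_distrib_left sum.distrib)
  also have "\<dots> = (\<Sum>C\<in>{C. c C \<noteq> 0} \<union> {C. d C \<noteq> 0}. if u \<in> C then s * c C + t * d C else 0)"
    by (intro sum.cong) auto
  finally show "s * \<beta> u + t * \<gamma> u = (\<Sum>C\<in>{C. c C \<noteq> 0} \<union> {C. d C \<noteq> 0}. if u \<in> C then s * c C + t * d C else 0)" .
next
  fix C D assume "s * c C + t * d C \<noteq> 0" "s * c D + t * d D \<noteq> 0"
  then have "c C \<noteq> 0 \<or> d C \<noteq> 0" "c D \<noteq> 0 \<or> d D \<noteq> 0" by auto
  moreover have "\<And>C D. c C \<noteq> 0 \<Longrightarrow> c D \<noteq> 0 \<Longrightarrow> C \<subseteq> D \<or> D \<subseteq> C"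
      "\<And>C D. d C \<noteq> 0 \<Longrightarrow> d D \<noteq> 0 \<Longrightarrow> C \<subseteq> D \<or> D \<subseteq> C"
    using assms(1,2) by (auto simp: chainrep_def)
  ultimately show "C \<subseteq> D \<or> D \<subseteq> C" using assms(5)[of C D] assms(5)[of D C] by metis
next
  fix C assume "s * c C + t * d C \<noteq> 0"
  then have "c C \<noteq> 0 \<or> d C \<noteq> 0" by auto
  moreover have "\<And>C. c C \<noteq> 0 \<Longrightarrow> finite C \<and> C \<noteq> {}" "\<And>C. d C \<noteq> 0 \<Longrightarrow> finite C \<and> C \<noteq> {}"
    using assms(1,2) by (auto simp: chainrep_def)
  ultimately show "finite C" "C \<noteq> {}" by auto
qed (use assms in \<open>auto simp: chainrep_def\<close>)

text \<open>Interchange of the sums over points and over layers. For constant \<open>h\<close> it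
  measures the total mass by layers, and for the identity it gives the position of a point in terms
  of the layers.\<close>

lemma chainrep_total:
  fixes h :: "'a \<Rightarrow> 'b::real_normed_vector"
  assumes c: "chainrep \<beta> c" and "finite V" "{u. \<beta> u \<noteq> 0} \<subseteq> V" "finite S" "{C. c C \<noteq> 0} \<subseteq> S"
  shows "(\<Sum>u\<in>V. \<beta> u *\<^sub>R h u) = (\<Sum>C\<in>S. c C *\<^sub>R (\<Sum>u\<in>C. h u))"
proof -
  have "(\<Sum>u\<in>V. \<beta> u *\<^sub>R h u) = (\<Sum>u\<in>V. \<Sum>C\<in>S. (if u \<in> C then c C else 0) *\<^sub>R h u)"
    using chainrep_sum[OF c assms(4,5)] by (simp only: scaleR_left.sum)
  also have "\<dots> = (\<Sum>C\<in>S. \<Sum>u\<in>V. (if u \<in> C then c C else 0) *\<^sub>R h u)" by (rule sum.swap)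
  also have "\<dots> = (\<Sum>C\<in>S. c C *\<^sub>R (\<Sum>u\<in>C. h u))"
  proof (rule sum.cong[OF refl])
    fix C
    show "(\<Sum>u\<in>V. (if u \<in> C then c C else 0) *\<^sub>R h u) = c C *\<^sub>R (\<Sum>u\<in>C. h u)"
    proof (cases "c C = 0")
      case False
      have "C \<subseteq> V" using chainrep_support[OF c False] assms(3) by blast
      have "(\<Sum>u\<in>V. (if u \<in> C then c C else 0) *\<^sub>R h u) = (\<Sum>u\<in>C. (if u \<in> C then c C else 0) *\<^sub>R h u)"
        by (rule sum.mono_neutral_right) (use assms(2) \<open>C \<subseteq> V\<close> in auto)
      then show ?thesis by (simp add: scaleR_sum_right)
    next
      case True
      then show ?thesis by (auto intro: sum.neutral)
    qed
  qed
  finally show ?thesis .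
qed

lemma centroid_sum: "finite C \<Longrightarrow> C \<noteq> {} \<Longrightarrow> \<Sum>C = real (card C) *\<^sub>R centroid C"
  by (simp add: centroid_def)

section \<open>Coordinates on the barycentric subdivision\<close>

context
  fixes T :: "'a::euclidean_space set set"
  assumes T: "simplicial_complex T"
begin

lemma chainrep_bary: "x \<in> \<Union>T \<Longrightarrow> chainrep (bary T x) (coef (bary T x))"
  using bary[OF T, of x] vsets_finite[OF T] by (intro chainrep_coef) (auto simp: weight_def)

lemma coef_vsets: assumes "x \<in> \<Union>T" "coef (bary T x) C \<noteq> 0" shows "C \<in> vsets T" "C \<noteq> {}"
proof -
  have "C \<subseteq> {u. bary T x u \<noteq> 0}" by (rule chainrep_support[OF chainrep_bary[OF assms(1)] assms(2)])
  moreover have "{u. bary T x u \<noteq> 0} \<in> vsets T" using bary(1)[OF T assms(1)] by (simp add: weight_def)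
  ultimately show "C \<in> vsets T" using vsets_subset[OF T] by blast
  show "C \<noteq> {}" using chainrep_bary[OF assms(1)] assms(2) by (simp add: chainrep_def)
qed

lemma bary_support_vertices: "x \<in> \<Union>T \<Longrightarrow> {u. bary T x u \<noteq> 0} \<subseteq> vertices T"
  using bary(1)[OF T, of x] vsets_vertices[OF T] by (simp add: weight_def)

lemma coef_sum:
  assumes x: "x \<in> \<Union>T"
  shows "(\<Sum>C\<in>vsets T. coef (bary T x) C * card C) = 1"
    "(\<Sum>C\<in>vsets T. (coef (bary T x) C * card C) *\<^sub>R centroid C) = x"
proof -
  have sub: "{C. coef (bary T x) C \<noteq> 0} \<subseteq> vsets T" using coef_vsets[OF x] by blast
  note tot = chainrep_total[OF chainrep_bary[OF x] finite_vertices[OF T] bary_support_vertices[OF x] finite_vsets[OF T] sub]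
  from tot[of "\<lambda>u. 1::real"] show "(\<Sum>C\<in>vsets T. coef (bary T x) C * card C) = 1"
    using bary(2)[OF T x] by simp
  have "x = (\<Sum>C\<in>vsets T. coef (bary T x) C *\<^sub>R \<Sum>C)" using tot[of "\<lambda>u. u"] bary(3)[OF T x] by simp
  also have "\<dots> = (\<Sum>C\<in>vsets T. (coef (bary T x) C * card C) *\<^sub>R centroid C)"
  proof (rule sum.cong[OF refl])
    fix C assume "C \<in> vsets T"
    then have "finite C" by (rule vsets_finite[OF T])
    then show "coef (bary T x) C *\<^sub>R \<Sum>C = (coef (bary T x) C * card C) *\<^sub>R centroid C"
      by (cases "C = {}") (auto simp: centroid_def)
  qed
  finally show "(\<Sum>C\<in>vsets T. (coef (bary T x) C * card C) *\<^sub>R centroid C) = x" ..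
qed

text \<open>A flag indexes the simplex of the barycentric subdivision that is spanned by the
  centroids of its members.\<close>

definition flags :: "'a set set set"
  where "flags = {\<C>. \<C> \<subseteq> vsets T - {{}} \<and> (\<forall>C\<in>\<C>. \<forall>D\<in>\<C>. C \<subseteq> D \<or> D \<subseteq> C)}"

lemma finite_flag: "\<C> \<in> flags \<Longrightarrow> finite \<C>"
  unfolding flags_def using finite_vsets[OF T] by (auto intro: finite_subset)

lemma flag_subset: "\<C> \<in> flags \<Longrightarrow> \<D> \<subseteq> \<C> \<Longrightarrow> \<D> \<in> flags"
  unfolding flags_def by blast

lemma flag_support: "x \<in> \<Union>T \<Longrightarrow> {C. coef (bary T x) C \<noteq> 0} \<in> flags"
  using coef_vsets[of x] chainrep_bary[of x] by (auto simp: flags_def chainrep_def)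

lemma in_flag_hull:
  assumes "x \<in> \<Union>T" shows "x \<in> convex hull (centroid ` {C. coef (bary T x) C \<noteq> 0})"
proof -
  let ?S = "{C. coef (bary T x) C \<noteq> 0}"
  have s: "?S \<subseteq> vsets T" using coef_vsets[OF assms] by blast
  have "(\<Sum>C\<in>?S. (coef (bary T x) C * card C) *\<^sub>R centroid C) \<in> convex hull (centroid ` ?S)"
  proof (rule convex_sum)
    show "finite ?S" using s finite_vsets[OF T] finite_subset by blast
    have "(\<Sum>C\<in>vsets T. coef (bary T x) C * card C) = (\<Sum>C\<in>?S. coef (bary T x) C * card C)"
      by (rule sum.mono_neutral_right) (use s finite_vsets[OF T] in auto)
    then show "(\<Sum>C\<in>?S. coef (bary T x) C * card C) = 1" using coef_sum(1)[OF assms] by simp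
  qed (use chainrep_nonneg[OF chainrep_bary[OF assms]] in \<open>auto simp: hull_inc\<close>)
  moreover have "(\<Sum>C\<in>vsets T. (coef (bary T x) C * card C) *\<^sub>R centroid C) = (\<Sum>C\<in>?S. (coef (bary T x) C * card C) *\<^sub>R centroid C)"
    by (rule sum.mono_neutral_right) (use s finite_vsets[OF T] in auto)
  ultimately show ?thesis using coef_sum(2)[OF assms] by simp
qed

text \<open>The mass \<open>a C\<close> at the centroid of \<open>C\<close> is spread evenly over
  the vertices of \<open>C\<close>, as a layer of height \<open>a C / card C\<close>. These layers
  form a chain, so uniqueness of the decomposition identifies the coefficients.\<close>

lemma flag_combination:
  assumes fl: "\<C> \<in> flags" and a: "\<And>C. C \<in> \<C> \<Longrightarrow> 0 \<le> a C" "sum a \<C> = 1"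
  shows "(\<Sum>C\<in>\<C>. a C *\<^sub>R centroid C) \<in> \<Union>T"
    "coef (bary T (\<Sum>C\<in>\<C>. a C *\<^sub>R centroid C)) = (\<lambda>C. if C \<in> \<C> then a C / card C else 0)"
proof -
  define c where "c C = (if C \<in> \<C> then a C / card C else 0)" for C
  define \<beta> where "\<beta> u = (\<Sum>C\<in>\<C>. if u \<in> C then c C else 0)" for u
  have fin: "finite \<C>" by (rule finite_flag[OF fl])
  have C1: "C \<in> vsets T" "finite C" "C \<noteq> {}" if "C \<in> \<C>" for C
    using that fl vsets_finite[OF T] by (auto simp: flags_def)
  have rep: "chainrep \<beta> c"
    by (rule chainrepI[of _ \<C>])
      (use fin C1 a fl in \<open>auto simp: c_def \<beta>_def flags_def split: if_splits\<close>)
  have ne: "\<C> \<noteq> {}" using a(2) by auto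
  \<comment> \<open>The largest member of the flag is a simplex that carries all the weight.\<close>
  have "\<Union>\<C> \<in> \<C>" using fin ne fl
  proof (induction \<C> rule: finite_ne_induct)
    case (insert C \<C>)
    then have "\<Union>\<C> \<in> \<C>" using flag_subset[of "insert C \<C>" \<C>] by blast
    then have "C \<subseteq> \<Union>\<C> \<or> \<Union>\<C> \<subseteq> C" using insert.prems unfolding flags_def by blast
    then show ?case using \<open>\<Union>\<C> \<in> \<C>\<close> by (auto simp: Un_absorb1 Un_absorb2)
  qed simp
  then have top: "\<Union>\<C> \<in> vsets T" by (rule C1)
  have "\<beta> u = 0" if "u \<notin> \<Union>\<C>" for u using that unfolding \<beta>_def by (intro sum.neutral) auto
  then have supp: "{u. \<beta> u \<noteq> 0} \<subseteq> \<Union>\<C>" by blast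
  have w: "weight T \<beta>" by (rule weight_vsetsI[OF T top supp]) (rule chainrep_support_eq[OF rep])
  note tot = chainrep_total[OF rep finite_vertices[OF T] order_trans[OF supp vsets_vertices[OF T top]] fin]
  have csub: "{C. c C \<noteq> 0} \<subseteq> \<C>" by (auto simp: c_def)
  have cC: "c C *\<^sub>R (\<Sum>C) = a C *\<^sub>R centroid C" "c C * card C = a C" if "C \<in> \<C>" for C
    using that C1[OF that] by (auto simp: c_def centroid_def)
  have s1: "(\<Sum>u\<in>vertices T. \<beta> u) = 1" using tot[OF csub, of "\<lambda>u. 1::real"] a(2) cC(2) by simp
  have s2: "(\<Sum>u\<in>vertices T. \<beta> u *\<^sub>R u) = (\<Sum>C\<in>\<C>. a C *\<^sub>R centroid C)"
    using tot[OF csub, of "\<lambda>u. u"] cC(1) by simp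
  have "bary T (\<Sum>C\<in>\<C>. a C *\<^sub>R centroid C) = \<beta>" by (rule bary_eqI[OF T w s1 s2])
  then show "coef (bary T (\<Sum>C\<in>\<C>. a C *\<^sub>R centroid C)) = (\<lambda>C. if C \<in> \<C> then a C / card C else 0)"
    using coef_eq[OF rep] by (simp add: c_def[abs_def])
  have "(\<Sum>C\<in>\<C>. a C *\<^sub>R centroid C) \<in> convex hull (\<Union>\<C>)"
    using weight_point[OF T w s1 supp top] s2 by simp
  then show "(\<Sum>C\<in>\<C>. a C *\<^sub>R centroid C) \<in> \<Union>T" using hull_vsets_in[OF T top] by blast
qed

lemma flag_hullE:
  assumes "\<C> \<in> flags" "x \<in> convex hull (centroid ` \<C>)"
  obtains a where "\<And>C. C \<in> \<C> \<Longrightarrow> 0 \<le> a C" "sum a \<C> = 1" "x = (\<Sum>C\<in>\<C>. a C *\<^sub>R centroid C)"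
proof -
  have "x \<in> {\<Sum>C\<in>\<C>. a C *\<^sub>R centroid C | a. sum a \<C> = 1 \<and> (\<forall>C\<in>\<C>. 0 \<le> a C)}"
  proof -
    let ?H = "{\<Sum>C\<in>\<C>. a C *\<^sub>R centroid C | a. sum a \<C> = 1 \<and> (\<forall>C\<in>\<C>. 0 \<le> a C)}"
    have fin: "finite \<C>" by (rule finite_flag[OF assms(1)])
    have "convex hull (centroid ` \<C>) \<subseteq> ?H"
    proof (rule hull_minimal)
      show "centroid ` \<C> \<subseteq> ?H"
      proof clarify
        fix C assume "C \<in> \<C>"
        have "(\<Sum>D\<in>\<C>. (if D = C then 1 else 0) *\<^sub>R centroid D) = (\<Sum>D\<in>\<C>. if D = C then centroid D else 0)"
          by (intro sum.cong) auto
        then show "\<exists>a. centroid C = (\<Sum>C\<in>\<C>. a C *\<^sub>R centroid C) \<and> sum a \<C> = 1 \<and> (\<forall>C\<in>\<C>. 0 \<le> a C)"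
          by (intro exI[of _ "\<lambda>D. if D = C then 1 else 0"]) (use \<open>C \<in> \<C>\<close> fin in simp)
      qed
      show "convex ?H"
        unfolding convex_alt
      proof clarify
        fix a b :: "'a set \<Rightarrow> real" and t :: real assume ab: "sum a \<C> = 1" "\<forall>C\<in>\<C>. 0 \<le> a C" "sum b \<C> = 1" "\<forall>C\<in>\<C>. 0 \<le> b C" "0 \<le> t" "t \<le> 1"
        show "\<exists>c. (1 - t) *\<^sub>R (\<Sum>C\<in>\<C>. a C *\<^sub>R centroid C) + t *\<^sub>R (\<Sum>C\<in>\<C>. b C *\<^sub>R centroid C) = (\<Sum>C\<in>\<C>. c C *\<^sub>R centroid C) \<and> sum c \<C> = 1 \<and> (\<forall>C\<in>\<C>. 0 \<le> c C)"
          by (rule exI[of _ "\<lambda>C. (1 - t) * a C + t * b C"])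
            (use ab in \<open>simp add: sum.distrib scaleR_left_distrib scaleR_sum_right flip: sum_distrib_left\<close>)
      qed
    qed
    then show ?thesis using assms(2) by blast
  qed
  then show ?thesis using that by blast
qed

lemma flag_hull_subset: "\<C> \<in> flags \<Longrightarrow> convex hull (centroid ` \<C>) \<subseteq> \<Union>T"
proof
  fix x assume fl: "\<C> \<in> flags" and "x \<in> convex hull (centroid ` \<C>)"
  then obtain a where "\<And>C. C \<in> \<C> \<Longrightarrow> 0 \<le> a C" "sum a \<C> = 1" "x = (\<Sum>C\<in>\<C>. a C *\<^sub>R centroid C)"
    using flag_hullE by metis
  then show "x \<in> \<Union>T" using flag_combination(1)[OF fl] by metis
qed

lemma coef_affine:
  assumes fl: "\<C> \<in> flags" shows "affine_on (convex hull (centroid ` \<C>)) (\<lambda>x. coef (bary T x) C)"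
  unfolding affine_on_def
proof clarify
  fix x y and t :: real
  assume x: "x \<in> convex hull (centroid ` \<C>)" and y: "y \<in> convex hull (centroid ` \<C>)" and t: "t \<in> {0..1}"
  obtain a where a: "\<And>C. C \<in> \<C> \<Longrightarrow> 0 \<le> a C" "sum a \<C> = 1" "x = (\<Sum>C\<in>\<C>. a C *\<^sub>R centroid C)"
    using flag_hullE[OF fl x] by metis
  obtain b where b: "\<And>C. C \<in> \<C> \<Longrightarrow> 0 \<le> b C" "sum b \<C> = 1" "y = (\<Sum>C\<in>\<C>. b C *\<^sub>R centroid C)"
    using flag_hullE[OF fl y] by metis
  define c where "c C = (1 - t) * a C + t * b C" for C
  have c: "\<And>C. C \<in> \<C> \<Longrightarrow> 0 \<le> c C" "sum c \<C> = 1" using a b t by (auto simp: c_def sum.distrib simp flip: sum_distrib_left)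
  have z: "(1 - t) *\<^sub>R x + t *\<^sub>R y = (\<Sum>C\<in>\<C>. c C *\<^sub>R centroid C)"
    by (simp add: a(3) b(3) c_def sum.distrib scaleR_left_distrib scaleR_sum_right)
  have "coef (bary T x) = (\<lambda>C. if C \<in> \<C> then a C / card C else 0)"
    "coef (bary T y) = (\<lambda>C. if C \<in> \<C> then b C / card C else 0)"
    "coef (bary T ((1 - t) *\<^sub>R x + t *\<^sub>R y)) = (\<lambda>C. if C \<in> \<C> then c C / card C else 0)"
    using flag_combination(2)[OF fl a(1,2)] flag_combination(2)[OF fl b(1,2)] flag_combination(2)[OF fl c] z a(3) b(3)
    by simp_all
  then show "coef (bary T ((1 - t) *\<^sub>R x + t *\<^sub>R y)) C = (1 - t) *\<^sub>R coef (bary T x) C + t *\<^sub>R coef (bary T y) C"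
    by (simp add: c_def add_divide_distrib)
qed

lemma pwa_coef: "pwa (\<Union>T) (\<lambda>x. coef (bary T x) C)"
proof (rule pwaI[of "(\<lambda>\<C>. convex hull (centroid ` \<C>)) ` flags"])
  have "flags \<subseteq> Pow (vsets T)" by (auto simp: flags_def)
  then show "finite ((\<lambda>\<C>. convex hull (centroid ` \<C>)) ` flags)"
    using finite_vsets[OF T] by (meson finite_Pow_iff finite_imageI finite_subset)
  show "\<Union>((\<lambda>\<C>. convex hull (centroid ` \<C>)) ` flags) = \<Union>T"
    using flag_hull_subset in_flag_hull flag_support by (intro antisym) blast+
qed (auto intro: coef_affine polytope_convex_hull finite_flag)

end


subsection \<open>Radial extension and rescaling of homogeneous functions\<close>

text \<open>Dividing by \<open>a + b\<close> turns the combination into a convex one. Thus affinity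
  of \<open>f\<close> on \<open>P\<close> becomes additivity of its homogeneous extension on the
  cone over \<open>P\<close>.\<close>

lemma cone_combine:
  assumes f: "affine_on P f" and P: "convex P" and z: "z \<in> P" "z' \<in> P" and ab: "0 \<le> a" "0 \<le> b" "0 < a + b"
  shows "(1 / (a + b)) *\<^sub>R (a *\<^sub>R z + b *\<^sub>R z') \<in> P"
    "(a + b) *\<^sub>R f ((1 / (a + b)) *\<^sub>R (a *\<^sub>R z + b *\<^sub>R z')) = a *\<^sub>R f z + b *\<^sub>R f z'"
proof -
  define u where "u = b / (a + b)"
  have u: "0 \<le> u" "u \<le> 1" "1 - u = a / (a + b)" "(a + b) * u = b" "(a + b) * (1 - u) = a"
    using ab by (auto simp: u_def field_simps)
  have eq: "(1 / (a + b)) *\<^sub>R (a *\<^sub>R z + b *\<^sub>R z') = (1 - u) *\<^sub>R z + u *\<^sub>R z'"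
    by (simp add: u(3) scaleR_right_distrib) (simp add: u_def)
  show "(1 / (a + b)) *\<^sub>R (a *\<^sub>R z + b *\<^sub>R z') \<in> P" unfolding eq using P z u(1,2) by (simp add: convex_alt)
  show "(a + b) *\<^sub>R f ((1 / (a + b)) *\<^sub>R (a *\<^sub>R z + b *\<^sub>R z')) = a *\<^sub>R f z + b *\<^sub>R f z'"
    unfolding eq affine_onD[OF f z u(1,2)] using u(4,5) by (simp add: scaleR_right_distrib)
qed

text \<open>The homogeneous extension of \<open>g\<close>, carried over from the cone on
  \<open>X\<close> by \<phi>. The value at 0 has its own clause because \<open>X\<close> may be
  empty, and because no ray through a nonzero \<open>\<phi> z\<close> reaches 0 with
  \<open>t > 0\<close>.\<close>

definition cone_ext :: "'a set \<Rightarrow> ('a \<Rightarrow> 'b::real_vector) \<Rightarrow> ('a \<Rightarrow> 'c::real_vector) \<Rightarrow> 'b \<Rightarrow> 'c"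
  where "cone_ext X \<phi> g y = (THE w. (y = 0 \<and> w = 0) \<or> (\<exists>t>0. \<exists>z\<in>X. y = t *\<^sub>R \<phi> z \<and> w = t *\<^sub>R g z))"

text \<open>\<open>span D\<close> plays the role of the open cone over \<open>X\<close>, and
  \<open>D\<close> that of the cone of bounded height. The case \<open>D = {0}\<close> with
  \<open>X\<close> empty is included; it occurs for cells of top dimension.\<close>

locale radial =
  fixes X :: "'a::euclidean_space set" and \<phi> :: "'a \<Rightarrow> 'b::euclidean_space" and D :: "'b set"
  assumes polytope_D: "polytope D" and zero_D: "0 \<in> rel_interior D"
    and bij_\<phi>: "bij_betw \<phi> X (rel_frontier D)" and pwa_\<phi>: "pwa X \<phi>"
begin

lemma convex_D: "convex D" using polytope_D by (rule polytope_imp_convex)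
lemma closed_D: "closed D" using polytope_D by (rule polytope_imp_closed)
lemma zero_in_D: "0 \<in> D" using zero_D rel_interior_subset by blast

lemma affine_hull_D: "affine hull D = span D"
  using zero_in_D by (simp add: affine_hull_span_0 hull_inc)

lemma \<phi>_frontier: "z \<in> X \<Longrightarrow> \<phi> z \<in> rel_frontier D"
  using bij_\<phi> by (auto simp: bij_betw_def)

lemma \<phi>_D: "z \<in> X \<Longrightarrow> \<phi> z \<in> D"
  using \<phi>_frontier closed_D by (auto simp: rel_frontier_def)

lemma \<phi>_nonzero: "z \<in> X \<Longrightarrow> \<phi> z \<noteq> 0"
  using \<phi>_frontier[of z] zero_D by (auto simp: rel_frontier_def)

text \<open>If \<open>s < t\<close>, then \<open>q\<close> lies strictly between 0 and
  \<open>p\<close>; as 0 is relatively interior, so is every such point.\<close>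

lemma frontier_ray_unique:
  assumes "p \<in> rel_frontier D" "q \<in> rel_frontier D" "0 < s" "0 < t" "s *\<^sub>R p = t *\<^sub>R q"
  shows "s = t"
proof -
  have False if pq: "p \<in> rel_frontier D" "q \<in> rel_frontier D" "0 < s" "s < t" "s *\<^sub>R p = t *\<^sub>R q" for p q s t
  proof -
    have "q = (1 / t) *\<^sub>R (t *\<^sub>R q)" using pq by simp
    then have q: "q = (s / t) *\<^sub>R p" unfolding pq(5)[symmetric] by simp
    have "p \<noteq> 0" using pq zero_D by (auto simp: rel_frontier_def)
    then have "q \<in> open_segment 0 p" unfolding in_segment q using pq by (auto intro!: exI[of _ "s / t"])
    moreover have "open_segment 0 p \<subseteq> rel_interior D"
      using rel_interior_closure_convex_segment[OF convex_D zero_D] pq(1) by (auto simp: rel_frontier_def)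
    ultimately show False using pq(2) by (auto simp: rel_frontier_def)
  qed
  from this[of p q s t] this[of q p t s] assms show ?thesis by (metis linorder_cases)
qed

lemma ray_unique:
  assumes "z \<in> X" "z' \<in> X" "0 < s" "0 < t" "s *\<^sub>R \<phi> z = t *\<^sub>R \<phi> z'" shows "s = t" "z = z'"
proof -
  show st: "s = t" using frontier_ray_unique \<phi>_frontier assms by blast
  then have "\<phi> z = \<phi> z'" using assms by simp
  then show "z = z'" using bij_\<phi> assms(1,2) by (auto simp: bij_betw_def inj_on_def)
qed

lemma ray_exists:
  assumes "y \<in> span D" "y \<noteq> 0" obtains t z where "0 < t" "z \<in> X" "y = t *\<^sub>R \<phi> z"
proof -
  have "0 + y \<in> affine hull D" using assms by (simp add: affine_hull_D)
  from ray_to_rel_frontier[OF polytope_imp_bounded[OF polytope_D] zero_D this assms(2)]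
  obtain d where d: "0 < d" "0 + d *\<^sub>R y \<in> rel_frontier D" by metis
  then have "d *\<^sub>R y \<in> \<phi> ` X" using bij_\<phi> by (simp add: bij_betw_def)
  then obtain z where "d *\<^sub>R y = \<phi> z" "z \<in> X" by blast
  moreover have "y = (1 / d) *\<^sub>R (d *\<^sub>R y)" using d by simp
  ultimately show ?thesis using that[of "1 / d" z] d by simp
qed

lemma in_D_iff: "t *\<^sub>R \<phi> z \<in> D \<longleftrightarrow> t \<le> 1" if "z \<in> X" "0 \<le> t"
proof
  assume "t \<le> 1"
  then show "t *\<^sub>R \<phi> z \<in> D"
    using convexD_alt[OF convex_D zero_in_D \<phi>_D[OF that(1)], of t] that by simp
next
  assume tD: "t *\<^sub>R \<phi> z \<in> D"
  show "t \<le> 1"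
  proof (rule ccontr)
    assume "\<not> t \<le> 1"
    then have "\<phi> z \<in> open_segment 0 (t *\<^sub>R \<phi> z)"
      unfolding in_segment using \<phi>_nonzero[OF that(1)] by (auto intro!: exI[of _ "1 / t"])
    moreover have "open_segment 0 (t *\<^sub>R \<phi> z) \<subseteq> rel_interior D"
      using rel_interior_closure_convex_segment[OF convex_D zero_D] tD closure_subset by blast
    ultimately show False using \<phi>_frontier[OF that(1)] by (auto simp: rel_frontier_def)
  qed
qed

lemma cone_ext_ray: assumes "z \<in> X" "0 \<le> t" shows "cone_ext X \<phi> g (t *\<^sub>R \<phi> z) = t *\<^sub>R g z"
  unfolding cone_ext_def
proof (rule the_equality)
  show "t *\<^sub>R \<phi> z = 0 \<and> t *\<^sub>R g z = 0 \<or> (\<exists>ta>0. \<exists>za\<in>X. t *\<^sub>R \<phi> z = ta *\<^sub>R \<phi> za \<and> t *\<^sub>R g z = ta *\<^sub>R g za)"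
  proof (cases "t = 0")
    case False
    then have "0 < t" using assms by simp
    then show ?thesis using assms(1) by blast
  qed simp
next
  fix w assume w: "t *\<^sub>R \<phi> z = 0 \<and> w = 0 \<or> (\<exists>ta>0. \<exists>za\<in>X. t *\<^sub>R \<phi> z = ta *\<^sub>R \<phi> za \<and> w = ta *\<^sub>R g za)"
  show "w = t *\<^sub>R g z"
  proof (cases "t = 0")
    case True
    then show ?thesis using w \<phi>_nonzero by auto
  next
    case False
    then have "t *\<^sub>R \<phi> z \<noteq> 0" using assms \<phi>_nonzero by simp
    then obtain ta za where "ta > 0" "za \<in> X" "t *\<^sub>R \<phi> z = ta *\<^sub>R \<phi> za" "w = ta *\<^sub>R g za" using w by auto
    then show ?thesis using ray_unique[of z za t ta] assms False by auto
  qed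
qed

lemma cone_ext_zero [simp]: "cone_ext X \<phi> g 0 = 0"
  unfolding cone_ext_def by (rule the_equality) (auto dest: \<phi>_nonzero)

lemma cone_ext_scale:
  assumes "y \<in> span D" "0 \<le> c" shows "cone_ext X \<phi> g (c *\<^sub>R y) = c *\<^sub>R cone_ext X \<phi> g y"
proof (cases "y = 0")
  case False
  then obtain t z where "0 < t" "z \<in> X" "y = t *\<^sub>R \<phi> z" using ray_exists assms by metis
  then show ?thesis using cone_ext_ray[of z "c * t" g] cone_ext_ray[of z t g] assms by simp
qed simp

text \<open>On the cone over a piece where \<phi> and \<open>g\<close> are both affine the extension
  is additive, by \<open>cone_combine\<close>.\<close>

lemma cone_ext_pwa:
  assumes "pwa X g" shows "pwa D (cone_ext X \<phi> g)"
proof -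
  obtain \<P> where P: "finite \<P>" "\<Union>\<P> = X" "\<And>P. P \<in> \<P> \<Longrightarrow> polytope P" "\<And>P. P \<in> \<P> \<Longrightarrow> affine_on P g"
      "\<And>P i. P \<in> \<P> \<Longrightarrow> i \<in> {()} \<Longrightarrow> affine_on P \<phi>"
    by (rule pwa_common[of "{()}" X "\<lambda>_. \<phi>" g]) (use assms pwa_\<phi> in simp_all)
  define Q where "Q P = convex hull (insert 0 (\<phi> ` P))" for P
  have Q: "\<exists>t z. 0 \<le> t \<and> t \<le> 1 \<and> z \<in> P \<and> x = t *\<^sub>R \<phi> z" if "P \<in> \<P>" "P \<noteq> {}" "x \<in> Q P" for P x
  proof -
    have "convex (\<phi> ` P)" by (rule affine_on_convex_image) (use P that polytope_imp_convex in auto)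
    then have "convex hull (\<phi> ` P) = \<phi> ` P" by (simp add: convex_hull_eq)
    then have "\<exists>u\<ge>0. \<exists>v\<ge>0. \<exists>b\<in>\<phi> ` P. u + v = 1 \<and> x = u *\<^sub>R 0 + v *\<^sub>R b"
      using that convex_hull_insert[of "\<phi> ` P" 0] unfolding Q_def by auto
    then obtain u v b where "0 \<le> u" "0 \<le> v" "b \<in> \<phi> ` P" "u + v = 1" "x = u *\<^sub>R 0 + v *\<^sub>R b" by metis
    then show ?thesis by (auto intro!: exI[of _ v])
  qed
  \<comment> \<open>The cones over the pieces of \<open>X\<close> cover all rays; the piece
    \<open>{0}\<close> takes care of an empty \<open>X\<close>.\<close>
  have "D \<subseteq> \<Union>(insert {0} (Q ` \<P>))"
  proof
    fix y assume "y \<in> D"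
    show "y \<in> \<Union>(insert {0} (Q ` \<P>))"
    proof (cases "y = 0")
      case False
      then obtain t z where t: "0 < t" "z \<in> X" "y = t *\<^sub>R \<phi> z" using ray_exists \<open>y \<in> D\<close> by (metis span_base)
      have "t \<le> 1" using in_D_iff[of z t] t \<open>y \<in> D\<close> by simp
      obtain P where p: "P \<in> \<P>" "z \<in> P" using t(2) P(2) by blast
      have "(1 - t) *\<^sub>R 0 + t *\<^sub>R \<phi> z \<in> Q P"
        unfolding Q_def by (rule convexD_alt) (use p t \<open>t \<le> 1\<close> in \<open>auto simp: hull_inc\<close>)
      then show ?thesis using p t by auto
    qed simp
  qed
  moreover have "Q P \<subseteq> D" if "P \<in> \<P>" for P
    unfolding Q_def by (rule hull_minimal) (use that P(2) \<phi>_D zero_in_D convex_D in auto)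
  ultimately have cover: "\<Union>(insert {0} (Q ` \<P>)) = D" using zero_in_D by auto
  show ?thesis
  proof (rule pwaI[OF _ cover])
    show "finite (insert {0} (Q ` \<P>))" using P by simp
    show "polytope R" if "R \<in> insert {0} (Q ` \<P>)" for R
    proof -
      have "polytope (Q P)" if "P \<in> \<P>" for P
      proof -
        have "polytope (\<phi> ` P)" by (rule polytope_affine_on_image) (use P that in auto)
        then obtain V where "finite V" "\<phi> ` P = convex hull V" by (auto simp: polytope_def)
        then have "Q P = convex hull (insert 0 V)" unfolding Q_def by (metis hull_insert)
        then show ?thesis using \<open>finite V\<close> by (simp add: polytope_convex_hull)
      qed
      then show ?thesis using that by (auto simp: polytope_sing)
    qed
    show "affine_on R (cone_ext X \<phi> g)" if R: "R \<in> insert {0} (Q ` \<P>)" for R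
    proof -
      consider "R = {0}" | P where "P \<in> \<P>" "P \<noteq> {}" "R = Q P"
        using R unfolding Q_def by fastforce
      then show ?thesis
      proof cases
        case 1
        then show ?thesis by (simp add: affine_on_def)
      next
        case 2
        have cP: "convex P" using 2 P polytope_imp_convex by blast
        show ?thesis
          unfolding affine_on_def
        proof clarify
          fix x y and u :: real assume "x \<in> R" "y \<in> R" and u: "u \<in> {0..1}"
          then obtain s z t w where z: "0 \<le> s" "s \<le> 1" "z \<in> P" "x = s *\<^sub>R \<phi> z" "0 \<le> t" "t \<le> 1" "w \<in> P" "y = t *\<^sub>R \<phi> w"
            using Q[OF 2(1,2), of x] Q[OF 2(1,2), of y] 2(3) by blast
          have zX: "z \<in> X" "w \<in> X" using z 2 P(2) by auto
          define a b where "a = (1 - u) * s" "b = u * t"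
          have ab: "0 \<le> a" "0 \<le> b" using u z by (auto simp: a_b_def)
          have x: "(1 - u) *\<^sub>R x = a *\<^sub>R \<phi> z" "u *\<^sub>R y = b *\<^sub>R \<phi> w" by (simp_all add: z a_b_def)
          have r: "(1 - u) *\<^sub>R cone_ext X \<phi> g x = a *\<^sub>R g z" "u *\<^sub>R cone_ext X \<phi> g y = b *\<^sub>R g w"
            using cone_ext_ray[OF zX(1) z(1), of g] cone_ext_ray[OF zX(2) z(5), of g] by (simp_all add: z a_b_def)
          show "cone_ext X \<phi> g ((1 - u) *\<^sub>R x + u *\<^sub>R y) = (1 - u) *\<^sub>R cone_ext X \<phi> g x + u *\<^sub>R cone_ext X \<phi> g y"
          proof (cases "a + b = 0")
            case True
            then have "a = 0" "b = 0" using ab by auto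
            then show ?thesis unfolding x r by simp
          next
            case False
            then have ab0: "0 < a + b" using ab by simp
            note ab = ab ab0
            let ?z = "(1 / (a + b)) *\<^sub>R (a *\<^sub>R z + b *\<^sub>R w)"
            have "?z \<in> X" using cone_combine(1)[OF P(4)[OF 2(1)] cP z(3,7) ab] 2 P(2) by blast
            then have "cone_ext X \<phi> g ((a + b) *\<^sub>R \<phi> ?z) = (a + b) *\<^sub>R g ?z" using ab0 by (intro cone_ext_ray) auto
            then show ?thesis
              using cone_combine(2)[OF P(4)[OF 2(1)] cP z(3,7) ab] cone_combine(2)[OF P(5)[OF 2(1)] cP z(3,7) ab]
              unfolding x r by simp
          qed
        qed
      qed
    qed
  qed
qed

end

lemma pwa_rel_frontier:
  assumes "polytope D" "pwa D f" shows "pwa (rel_frontier D) f"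
proof -
  have "pwa (rel_frontier D) (\<lambda>x. x)"
  proof (rule pwaI[of "{F. F facet_of D}"])
    show "finite {F. F facet_of D}" using assms(1) by (rule finite_polytope_facets)
    show "\<Union>{F. F facet_of D} = rel_frontier D"
      using rel_frontier_of_polyhedron[OF polytope_imp_polyhedron[OF assms(1)]] by simp
    show "polytope P" if "P \<in> {F. F facet_of D}" for P
      using that assms(1) by (auto intro: face_of_polytope_polytope facet_of_imp_face_of)
  qed simp
  then show ?thesis
    by (rule pwa_restrict[OF assms(2)]) (use polytope_imp_closed[OF assms(1)] in \<open>auto simp: rel_frontier_def\<close>)
qed

definition homog_on :: "'a::real_vector set \<Rightarrow> ('a \<Rightarrow> 'b::real_vector) \<Rightarrow> bool"
  where "homog_on E F \<longleftrightarrow> (\<forall>x\<in>E. \<forall>c\<ge>0. F (c *\<^sub>R x) = c *\<^sub>R F x)"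

lemma homog_onD: "homog_on E F \<Longrightarrow> x \<in> E \<Longrightarrow> 0 \<le> c \<Longrightarrow> F (c *\<^sub>R x) = c *\<^sub>R F x"
  by (simp add: homog_on_def)

text \<open>Both functions are linear on the cones over a triangulation of the boundary of \<open>D\<close>; moving
  each vertex along its ray by the quotient of the two values carries one function to the other.\<close>

lemma homogeneous_rescaling:
  fixes F G :: "'a::euclidean_space \<Rightarrow> real"
  assumes D: "polytope D" "0 \<in> rel_interior D"
    and F: "homog_on (span D) F" "pwa D F" and G: "homog_on (span D) G" "pwa D G"
    and sign: "\<And>x. x \<in> span D \<Longrightarrow> sgn (F x) = sgn (G x)"
  obtains \<rho> where "\<rho> ` span D \<subseteq> span D" "\<And>x. x \<in> span D \<Longrightarrow> G (\<rho> x) = F x" "homog_on (span D) \<rho>"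
    "inj_on \<rho> (span D)" "pwa D \<rho>"
proof -
  let ?X = "rel_frontier D"
  interpret radial ?X "\<lambda>x. x" D
    by unfold_locales (use D F in \<open>auto simp: bij_betw_def intro: pwa_rel_frontier pwa_ident\<close>)
  have "pwa ?X (\<lambda>x. (F x, G x))" by (rule pwa_rel_frontier[OF D(1) pwa_Pair[OF F(2) G(2)]])
  then obtain T where T: "simplicial_complex T" "\<Union>T = ?X" and aff: "\<And>S. S \<in> T \<Longrightarrow> affine_on S (\<lambda>x. (F x, G x))"
    by (rule pwa_triangulation) blast
  have affG: "affine_on S G" "affine_on S F" if "S \<in> T" for S using aff[OF that] by (auto simp: affine_on_def)
  \<comment> \<open>The factor for vertex \<open>w\<close>. It is positive: where \<open>G\<close>
    does not vanish, equality of signs makes the quotient positive, and where it vanishes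
    \<open>F\<close> does too, so 1 is a harmless choice.\<close>
  define l where "l w = (if G w = 0 then 1 else F w / G w)" for w
  have vD: "w \<in> span D" if "w \<in> vertices T" for w
    using that T(2) closed_D by (auto simp: vertices_def rel_frontier_def intro!: span_base)
  have lpos: "0 < l w" "l w * G w = F w" if "w \<in> vertices T" for w
    using sign[OF vD[OF that]] by (auto simp: l_def sgn_if zero_less_divide_iff split: if_splits)
  let ?V = "vertices T"
  have fV: "finite ?V" by (rule finite_vertices[OF T(1)])
  \<comment> \<open>A homogeneous function that is affine on the simplices of \<open>T\<close> is
    linear on the cones over them, so its value at a weighted sum is read off at the vertices. This
    serves for the original weights as well as for the rescaled ones.\<close>
  have lin: "H (\<Sum>w\<in>?V. \<gamma> w *\<^sub>R w) = (\<Sum>w\<in>?V. \<gamma> w * H w)"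
    if "weight T \<gamma>" "homog_on (span D) H" "\<And>S. S \<in> T \<Longrightarrow> affine_on S H" for \<gamma> and H :: "'a \<Rightarrow> real"
  proof -
    define s where "s = (\<Sum>w\<in>?V. \<gamma> w)"
    have s0: "0 \<le> s" unfolding s_def by (rule sum_nonneg) (use that weight_ge0[OF T(1)] in auto)
    let ?C = "{u. \<gamma> u \<noteq> 0}"
    have C: "?C \<in> vsets T" using that by (simp add: weight_def)
    then have CV: "?C \<subseteq> ?V" by (rule vsets_vertices[OF T(1)])
    have H0: "H 0 = 0" using homog_onD[OF that(2) span_zero, of 0] by simp
    show ?thesis
    proof (cases "s = 0")
      case True
      then have "\<gamma> w = 0" for w using weight_sum_zero[OF T(1) that(1)] by (simp add: s_def)
      then show ?thesis using H0 by simp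
    next
      case False
      have "H (\<Sum>w\<in>?C. (\<gamma> w / s) *\<^sub>R w) = (\<Sum>w\<in>?C. (\<gamma> w / s) *\<^sub>R H w)"
      proof (rule affine_on_convex_sum)
        show "affine_on (convex hull ?C) H" using that(3) hull_vsets_in[OF T(1) C] by blast
        have "sum \<gamma> ?C = s" unfolding s_def using weight_sum(1)[OF T(1) order_refl CV] by simp
        then show "(\<Sum>w\<in>?C. \<gamma> w / s) = 1" using False by (simp flip: sum_divide_distrib)
      qed (use s0 weight_ge0[OF T(1) that(1)] vsets_finite[OF T(1) C] in \<open>auto simp: hull_inc\<close>)
      moreover have "(\<Sum>w\<in>?C. (\<gamma> w / s) *\<^sub>R H w) = (\<Sum>w\<in>?V. (\<gamma> w / s) *\<^sub>R H w)"
        by (rule sum.mono_neutral_left) (use fV CV in auto)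
      moreover have "(\<Sum>w\<in>?C. (\<gamma> w / s) *\<^sub>R w) = (\<Sum>w\<in>?V. (\<gamma> w / s) *\<^sub>R w)"
        by (rule sum.mono_neutral_left) (use fV CV in auto)
      ultimately have e: "H (\<Sum>w\<in>?V. (\<gamma> w / s) *\<^sub>R w) = (\<Sum>w\<in>?V. (\<gamma> w / s) *\<^sub>R H w)" by simp
      have "(\<Sum>w\<in>?V. (\<gamma> w / s) *\<^sub>R w) \<in> span D" using vD by (intro span_sum span_scale) auto
      from homog_onD[OF that(2) this s0] e False show ?thesis
        by (simp add: scaleR_sum_right sum_distrib_left)
    qed
  qed
  define g where "g z = (\<Sum>w\<in>?V. (bary T z w * l w) *\<^sub>R w)" for z
  define \<rho> where "\<rho> = cone_ext ?X (\<lambda>x. x) g"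
  have wl: "weight T (\<lambda>w. t * (bary T z w * l w))" if "z \<in> ?X" "0 \<le> t" for z t
  proof (rule weight_vsetsI[OF T(1)])
    have w: "weight T (bary T z)" using bary(1)[OF T(1)] that T(2) by simp
    then show "{u. bary T z u \<noteq> 0} \<in> vsets T" by (simp add: weight_def)
    then have "{u. bary T z u \<noteq> 0} \<subseteq> ?V" by (rule vsets_vertices[OF T(1)])
    then have "0 \<le> bary T z u * l u" for u using lpos(1)[of u] weight_ge0[OF T(1) w, of u] by (cases "bary T z u = 0") auto
    then show "0 \<le> t * (bary T z u * l u)" for u using that by simp
  qed auto
  have ray: "\<rho> (t *\<^sub>R z) = (\<Sum>w\<in>?V. (t * (bary T z w * l w)) *\<^sub>R w)" if "z \<in> ?X" "0 \<le> t" for z t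
    unfolding \<rho>_def using cone_ext_ray[OF that, of g] by (simp add: g_def scaleR_sum_right)
  have rep: "\<exists>t z. 0 < t \<and> z \<in> ?X \<and> x = t *\<^sub>R z" if "x \<in> span D" "x \<noteq> 0" for x
    using ray_exists[OF that] by metis
  show ?thesis
  proof
    show "homog_on (span D) \<rho>" unfolding homog_on_def \<rho>_def using cone_ext_scale by blast
    have "pwa ?X g" unfolding g_def
    proof (rule pwa_sum[OF pwa_\<phi>])
      fix w
      have "pwa ?X (\<lambda>z. bary T z w)" using pwa_bary[OF T(1)] T(2) by simp
      then have "pwa ?X (\<lambda>z. l w *\<^sub>R bary T z w)" by (rule pwa_scaleR)
      from pwa_scaleR_left[OF this, of w] show "pwa ?X (\<lambda>z. (bary T z w * l w) *\<^sub>R w)" by (simp add: mult.commute)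
    qed
    then show "pwa D \<rho>" unfolding \<rho>_def by (rule cone_ext_pwa)
    have \<rho>0: "\<rho> 0 = 0" by (simp add: \<rho>_def)
    show "\<rho> ` span D \<subseteq> span D"
    proof clarify
      fix x assume "x \<in> span D"
      show "\<rho> x \<in> span D"
      proof (cases "x = 0")
        case False
        then obtain t z where "0 < t" "z \<in> ?X" "x = t *\<^sub>R z" using rep \<open>x \<in> span D\<close> by blast
        then show ?thesis using ray[of z t] vD by (simp add: span_sum span_scale)
      qed (simp add: \<rho>0 span_zero)
    qed
    show "G (\<rho> x) = F x" if x: "x \<in> span D" for x
    proof (cases "x = 0")
      case True
      then show ?thesis using homog_onD[OF F(1) span_zero, of 0] homog_onD[OF G(1) span_zero, of 0] \<rho>0 by simp
    next
      case False
      then obtain t z where tz: "0 < t" "z \<in> ?X" "x = t *\<^sub>R z" using rep x by blast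
      have b: "weight T (bary T z)" "(\<Sum>u\<in>?V. bary T z u *\<^sub>R u) = z" using bary[OF T(1), of z] T(2) tz by auto
      have "G (\<rho> x) = (\<Sum>w\<in>?V. t * (bary T z w * l w) * G w)"
        using ray[of z t] lin[OF wl[of z t] G(1) affG(1)] tz by simp
      also have "\<dots> = (\<Sum>w\<in>?V. t * (bary T z w * F w))"
        using lpos(2) by (intro sum.cong) (auto simp: mult.assoc)
      also have "\<dots> = t * F z" using lin[OF b(1) F(1) affG(2)] b(2) by (simp add: sum_distrib_left)
      also have "\<dots> = F x" using homog_onD[OF F(1), of z t] tz \<phi>_D by (simp add: span_base)
      finally show ?thesis .
    qed
    show "inj_on \<rho> (span D)"
    proof (rule inj_onI)
      have w0: "(\<lambda>w. t * (bary T z w * l w)) = (\<lambda>w. t' * (bary T z' w * l w)) \<Longrightarrow> t *\<^sub>R z = t' *\<^sub>R z'"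
        if "z \<in> ?X" "z' \<in> ?X" for t t' z z'
      proof -
        assume eq: "(\<lambda>w. t * (bary T z w * l w)) = (\<lambda>w. t' * (bary T z' w * l w))"
        have "t * bary T z w = t' * bary T z' w" if "w \<in> ?V" for w
          using fun_cong[OF eq, of w] lpos(1)[OF that] by simp
        then have "(\<Sum>w\<in>?V. (t * bary T z w) *\<^sub>R w) = (\<Sum>w\<in>?V. (t' * bary T z' w) *\<^sub>R w)" by simp
        then show ?thesis using bary(3)[OF T(1), of z] bary(3)[OF T(1), of z'] that T(2)
          by (simp flip: scaleR_scaleR scaleR_sum_right)
      qed
      \<comment> \<open>A point stays in the cone over its simplex, so its image is again a positive
        multiple \<open>s\<close> of a frontier point, where \<open>s\<close> is the total of the
        rescaled weights. Rays meet the frontier once, so equal images have equal totals and hence,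
        by uniqueness of weights, equal rescaled weights.\<close>
      have norm: "\<exists>s q. 0 < s \<and> q \<in> ?X \<and> \<rho> x = s *\<^sub>R q \<and> s = (\<Sum>w\<in>?V. t * (bary T z w * l w))"
        if tz: "0 < t" "z \<in> ?X" "x = t *\<^sub>R z" for t z x
      proof -
        define \<gamma> where "\<gamma> w = t * (bary T z w * l w)" for w
        define s where "s = sum \<gamma> ?V"
        have g: "weight T \<gamma>" unfolding \<gamma>_def by (rule wl) (use tz in auto)
        have "s \<noteq> 0"
        proof
          assume "s = 0"
          then have z: "\<gamma> w = 0" for w using weight_sum_zero[OF T(1) g] by (simp add: s_def)
          have "bary T z w = 0" if "w \<in> ?V" for w using z[of w] tz lpos(1)[OF that] by (simp add: \<gamma>_def)
          then show False using bary(2)[OF T(1), of z] tz T(2) by simp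
        qed
        then have s: "0 < s" using sum_nonneg[of ?V \<gamma>] weight_ge0[OF T(1) g] by (simp add: s_def order_less_le)
        define q where "q = (\<Sum>w\<in>?V. (inverse s * \<gamma> w) *\<^sub>R w)"
        have g': "weight T (\<lambda>w. inverse s * \<gamma> w)" using weight_scale[OF T(1) g] s by simp
        have s1: "(\<Sum>w\<in>?V. inverse s * \<gamma> w) = 1" using s by (simp add: s_def flip: sum_distrib_left)
        have "q \<in> convex hull {u. inverse s * \<gamma> u \<noteq> 0}" unfolding q_def
          by (rule weight_point[OF T(1) g' s1 order_refl]) (use g' in \<open>simp add: weight_def\<close>)
        moreover have "convex hull {u. inverse s * \<gamma> u \<noteq> 0} \<in> T" using g' by (simp add: weight_def vsets_def)
        ultimately have "q \<in> ?X" using T(2) by blast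
        moreover have "\<rho> x = s *\<^sub>R q"
        proof -
          have "s * (inverse s * a) = a" for a using s by simp
          then show ?thesis using ray[of z t] tz by (simp only: q_def \<gamma>_def scaleR_sum_right scaleR_scaleR less_imp_le)
        qed
        ultimately show ?thesis using s s_def \<gamma>_def by (intro exI[of _ s] exI[of _ q]) simp
      qed
      fix x y assume x: "x \<in> span D" and y: "y \<in> span D" and eq: "\<rho> x = \<rho> y"
      have nz: "\<rho> x \<noteq> 0" if "x \<in> span D" "x \<noteq> 0" for x
      proof -
        obtain t z where "0 < t" "z \<in> ?X" "x = t *\<^sub>R z" using rep \<open>x \<in> span D\<close> \<open>x \<noteq> 0\<close> by blast
        then obtain s q where "0 < s" "q \<in> ?X" "\<rho> x = s *\<^sub>R q" using norm by blast
        then show ?thesis using \<phi>_nonzero by auto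
      qed
      show "x = y"
      proof (cases "x = 0 \<or> y = 0")
        case True
        then show ?thesis using nz[OF x] nz[OF y] eq \<rho>0 by metis
      next
        case False
        then obtain t z t' z' where tz: "0 < t" "z \<in> ?X" "x = t *\<^sub>R z" "0 < t'" "z' \<in> ?X" "y = t' *\<^sub>R z'"
          using rep x y by metis
        obtain s q where s: "0 < s" "q \<in> ?X" "\<rho> x = s *\<^sub>R q" "s = (\<Sum>w\<in>?V. t * (bary T z w * l w))"
          using norm[OF tz(1-3)] by blast
        obtain s' q' where s': "0 < s'" "q' \<in> ?X" "\<rho> y = s' *\<^sub>R q'" "s' = (\<Sum>w\<in>?V. t' * (bary T z' w * l w))"
          using norm[OF tz(4-6)] by blast
        have "s = s'" using frontier_ray_unique[OF s(2) s'(2) s(1) s'(1)] eq s(3) s'(3) by simp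
        have "(\<lambda>w. t * (bary T z w * l w)) = (\<lambda>w. t' * (bary T z' w * l w))"
        proof (rule weight_unique[OF T(1)])
          show "(\<Sum>u\<in>?V. (t * (bary T z u * l u)) *\<^sub>R u) = (\<Sum>u\<in>?V. (t' * (bary T z' u * l u)) *\<^sub>R u)"
            using eq ray[of z t] ray[of z' t'] tz by simp
        qed (use wl tz \<open>s = s'\<close> s(4) s'(4) in auto)
        then show ?thesis using w0 tz by blast
      qed
    qed
  qed
qed


subsection \<open>Homogeneous functions monotone in one direction\<close>

lemma zero_rel_interior_ball:
  assumes "0 \<in> rel_interior (D :: 'a::euclidean_space set)"
  obtains r where "0 < r" "\<And>x. x \<in> span D \<Longrightarrow> norm x < r \<Longrightarrow> x \<in> D"
proof -
  have "affine hull D = span D"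
    using assms rel_interior_subset by (intro affine_hull_span_0) (auto intro: hull_inc)
  then obtain e where "e > 0" "ball 0 e \<inter> span D \<subseteq> D"
    using assms mem_rel_interior_ball[of 0 D] by auto
  then show ?thesis using that[of e] by (auto simp: subset_iff)
qed

text \<open>By continuity \<open>F\<close> is negative near a small multiple of \<open>e\<close>.
  Scaling \<open>y + \<tau> *\<^sub>R e\<close> by \<open>a / \<tau>\<close> brings it close to that
  multiple, uniformly for \<open>y\<close> in the bounded set \<open>D\<close>.\<close>

lemma negative_along_direction:
  fixes F :: "'a::euclidean_space \<Rightarrow> real"
  assumes D: "polytope D" "0 \<in> rel_interior D"
    and F: "homog_on (span D) F" "pwa D F" and e: "e \<in> span D" "F e < 0"
  obtains \<tau> where "0 < \<tau>" "\<And>y. y \<in> D \<Longrightarrow> F (y + \<tau> *\<^sub>R e) \<le> 0"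
proof -
  obtain r where r: "0 < r" "\<And>x. x \<in> span D \<Longrightarrow> norm x < r \<Longrightarrow> x \<in> D"
    using zero_rel_interior_ball[OF D(2)] by blast
  have "F 0 = 0" using homog_onD[OF F(1) span_zero, of 0] by simp
  then have "e \<noteq> 0" using e by auto
  \<comment> \<open>This gives \<open>a *\<^sub>R e\<close> half the admissible norm, so that
    perturbations of norm below \<open>r / 2\<close> stay in \<open>D\<close>.\<close>
  define a where "a = r / 2 / norm e"
  have a: "0 < a" using r \<open>e \<noteq> 0\<close> by (simp add: a_def)
  have ne: "norm (a *\<^sub>R e) = r / 2" using r \<open>e \<noteq> 0\<close> by (simp add: a_def)
  have aD: "a *\<^sub>R e \<in> D" by (rule r(2)) (use e ne r in \<open>auto simp: span_scale\<close>)
  have Fa: "F (a *\<^sub>R e) < 0" using homog_onD[OF F(1) e(1), of a] a e(2) by (simp add: mult_pos_neg)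
  have "continuous_on D F" using F(2) by (rule pwa_continuous)
  then obtain \<delta> where \<delta>: "0 < \<delta>" "\<And>z. z \<in> D \<Longrightarrow> dist z (a *\<^sub>R e) < \<delta> \<Longrightarrow> dist (F z) (F (a *\<^sub>R e)) < - F (a *\<^sub>R e)"
    using aD Fa unfolding continuous_on_iff by (metis neg_0_less_iff_less)
  obtain B where B: "0 < B" "\<And>y. y \<in> D \<Longrightarrow> norm y \<le> B"
    using polytope_imp_bounded[OF D(1)] unfolding bounded_pos by blast
  define m where "m = min \<delta> (r / 2) / 2"
  have m: "0 < m" "m < \<delta>" "m < r / 2" using \<delta>(1) r(1) by (auto simp: m_def)
  \<comment> \<open>With this choice \<open>a / \<tau>\<close> equals \<open>m / B\<close>, so the
    perturbation \<open>(a / \<tau>) *\<^sub>R y\<close> has norm at most \<open>m\<close>.\<close>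
  define \<tau> where "\<tau> = a * B / m"
  have \<tau>: "0 < \<tau>" using a B m by (simp add: \<tau>_def)
  show ?thesis
  proof (rule that[OF \<tau>])
    fix y assume y: "y \<in> D"
    define z where "z = a *\<^sub>R e + (a / \<tau>) *\<^sub>R y"
    have "norm ((a / \<tau>) *\<^sub>R y) = (a / \<tau>) * norm y" using a \<tau> by simp
    also have "\<dots> \<le> (a / \<tau>) * B" using B(2)[OF y] a \<tau> by (intro mult_left_mono) auto
    also have "\<dots> = m" using a B m by (simp add: \<tau>_def)
    finally have n: "norm ((a / \<tau>) *\<^sub>R y) \<le> m" .
    have zs: "z \<in> span D" unfolding z_def using e y by (intro span_add span_scale) (auto intro: span_base)
    have "norm z \<le> r / 2 + m" unfolding z_def using norm_triangle_ineq[of "a *\<^sub>R e" "(a / \<tau>) *\<^sub>R y"] n ne by simp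
    then have "z \<in> D" using zs m by (intro r(2)) auto
    moreover have "dist z (a *\<^sub>R e) < \<delta>" using n m by (simp add: z_def dist_norm)
    ultimately have "F z < 0" using \<delta>(2)[of z] by (auto simp: dist_real_def)
    have "y + \<tau> *\<^sub>R e = (\<tau> / a) *\<^sub>R z" using a \<tau> by (simp add: z_def scaleR_right_distrib)
    then have "F (y + \<tau> *\<^sub>R e) = (\<tau> / a) * F z" using homog_onD[OF F(1) zs, of "\<tau> / a"] a \<tau> by simp
    then show "F (y + \<tau> *\<^sub>R e) \<le> 0" using \<open>F z < 0\<close> a \<tau> by (simp add: mult_nonneg_nonpos divide_nonpos_pos)
  qed
qed

text \<open>Intermediate value theorem. Continuity is known only on \<open>D\<close>, so the segment
  is first scaled into \<open>D\<close>, which by homogeneity does not affect signs.\<close>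

lemma zero_on_segment:
  fixes F :: "'a::euclidean_space \<Rightarrow> real"
  assumes D: "polytope D" "0 \<in> rel_interior D"
    and F: "homog_on (span D) F" "pwa D F" and e: "e \<in> span D" and y: "y \<in> span D"
    and pos: "0 < F y" and neg: "F (y + \<sigma> *\<^sub>R e) \<le> 0" "0 \<le> \<sigma>"
  obtains s where "0 < s" "F (y + s *\<^sub>R e) = 0"
proof -
  obtain r where r: "0 < r" "\<And>x. x \<in> span D \<Longrightarrow> norm x < r \<Longrightarrow> x \<in> D"
    using zero_rel_interior_ball[OF D(2)] by blast
  define c where "c = r / (norm y + \<sigma> * norm e + 1)"
  have d0: "0 < norm y + \<sigma> * norm e + 1" using neg by (simp add: add_nonneg_pos)
  then have c: "0 < c" using r by (simp add: c_def)
  have inD: "c *\<^sub>R (y + s *\<^sub>R e) \<in> D" if "0 \<le> s" "s \<le> \<sigma>" for s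
  proof (rule r(2))
    show "c *\<^sub>R (y + s *\<^sub>R e) \<in> span D" using y e by (intro span_scale span_add)
    have "norm (y + s *\<^sub>R e) \<le> norm y + s * norm e" using norm_triangle_ineq[of y "s *\<^sub>R e"] that by simp
    also have "\<dots> \<le> norm y + \<sigma> * norm e" using that by (simp add: mult_right_mono)
    also have "\<dots> < norm y + \<sigma> * norm e + 1" by simp
    finally have "c * norm (y + s *\<^sub>R e) < c * (norm y + \<sigma> * norm e + 1)" using c by (rule mult_strict_left_mono)
    also have "\<dots> = r" using d0 by (simp add: c_def)
    finally show "norm (c *\<^sub>R (y + s *\<^sub>R e)) < r" using c by simp
  qed
  have scale: "F (c *\<^sub>R (y + s *\<^sub>R e)) = c * F (y + s *\<^sub>R e)" for s
    using homog_onD[OF F(1), of "y + s *\<^sub>R e" c] c y e by (simp add: span_add span_scale)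
  have "continuous_on {0..\<sigma>} (\<lambda>s. F (c *\<^sub>R (y + s *\<^sub>R e)))"
    by (rule continuous_on_compose2[OF pwa_continuous[OF F(2)]]) (auto intro!: continuous_intros inD)
  then have "\<exists>s. 0 \<le> s \<and> s \<le> \<sigma> \<and> F (c *\<^sub>R (y + s *\<^sub>R e)) = 0"
    using scale[of 0] scale[of \<sigma>] c pos neg
    by (intro IVT2') (auto simp: mult_nonneg_nonpos)
  then obtain s where "0 \<le> s" "F (y + s *\<^sub>R e) = 0" using scale c by auto
  moreover then have "s \<noteq> 0" using pos by auto
  ultimately show ?thesis using that[of s] by simp
qed

text \<open>Every point is slid in the direction \<open>e\<close> into the region \<open>F \<le> 0\<close>, where \<open>F\<close> is already affine in
  this direction, and the value found there is extrapolated back.\<close>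

lemma monotone_extension:
  fixes F :: "'a::euclidean_space \<Rightarrow> real"
  assumes D: "polytope D" "0 \<in> rel_interior D"
    and F: "homog_on (span D) F" "pwa D F" and e: "e \<in> span D" "F e < 0"
    and star: "\<And>y t. y \<in> span D \<Longrightarrow> F y \<le> 0 \<Longrightarrow> 0 \<le> t \<Longrightarrow> F (y + t *\<^sub>R e) = F y + t * F e"
  obtains G where "homog_on (span D) G" "pwa D G" "\<And>y. y \<in> span D \<Longrightarrow> sgn (F y) = sgn (G y)"
    "\<And>y t. y \<in> span D \<Longrightarrow> G (y + t *\<^sub>R e) = G y + t * F e"
proof -
  obtain r where r: "0 < r" "\<And>x. x \<in> span D \<Longrightarrow> norm x < r \<Longrightarrow> x \<in> D"
    using zero_rel_interior_ball[OF D(2)] by blast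
  obtain \<tau> where \<tau>: "0 < \<tau>" "\<And>y. y \<in> D \<Longrightarrow> F (y + \<tau> *\<^sub>R e) \<le> 0"
    using negative_along_direction[OF D F e] by blast
  \<comment> \<open>Any parameter that reaches the region \<open>F \<le> 0\<close> may be chosen;
    \<open>indep\<close> shows that the extrapolated value does not depend on it.\<close>
  define G where "G y = (let \<sigma> = SOME \<sigma>. F (y + \<sigma> *\<^sub>R e) \<le> 0 in F (y + \<sigma> *\<^sub>R e) - \<sigma> * F e)" for y
  have indep: "F (y + \<sigma> *\<^sub>R e) - \<sigma> * F e = F (y + \<sigma>' *\<^sub>R e) - \<sigma>' * F e"
    if y: "y \<in> span D" "F (y + \<sigma> *\<^sub>R e) \<le> 0" "F (y + \<sigma>' *\<^sub>R e) \<le> 0" for y \<sigma> \<sigma>'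
  proof -
    have aux: "F (y + \<sigma> *\<^sub>R e) - \<sigma> * F e = F (y + \<sigma>' *\<^sub>R e) - \<sigma>' * F e"
      if "\<sigma> \<le> \<sigma>'" "F (y + \<sigma> *\<^sub>R e) \<le> 0" for \<sigma> \<sigma>'
    proof -
      have "F ((y + \<sigma> *\<^sub>R e) + (\<sigma>' - \<sigma>) *\<^sub>R e) = F (y + \<sigma> *\<^sub>R e) + (\<sigma>' - \<sigma>) * F e"
        by (rule star) (use y e that in \<open>auto intro: span_add span_scale\<close>)
      moreover have "(y + \<sigma> *\<^sub>R e) + (\<sigma>' - \<sigma>) *\<^sub>R e = y + \<sigma>' *\<^sub>R e" by (simp add: algebra_simps)
      ultimately show ?thesis by (simp add: algebra_simps)
    qed
    show ?thesis
    proof (cases "\<sigma> \<le> \<sigma>'")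
      case True
      then show ?thesis by (rule aux) (rule y(2))
    next
      case False
      then have "\<sigma>' \<le> \<sigma>" by simp
      then show ?thesis by (rule aux[symmetric]) (rule y(3))
    qed
  qed
  have Gval: "G y = F (y + \<sigma> *\<^sub>R e) - \<sigma> * F e" if "y \<in> span D" "F (y + \<sigma> *\<^sub>R e) \<le> 0" for y \<sigma>
    unfolding G_def Let_def by (rule indep) (use that someI[of "\<lambda>\<sigma>. F (y + \<sigma> *\<^sub>R e) \<le> 0" \<sigma>] in auto)
  have ex: "\<exists>\<sigma>\<ge>0. F (y + \<sigma> *\<^sub>R e) \<le> 0" if y: "y \<in> span D" for y
  proof -
    define c where "c = r / (norm y + 1)"
    have c: "0 < c" using r by (simp add: c_def add_nonneg_pos)
    have "norm (c *\<^sub>R y) = c * norm y" using c by simp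
    also have "\<dots> < c * (norm y + 1)" using c by (intro mult_strict_left_mono) auto
    also have "\<dots> = r" by (simp add: c_def add_nonneg_eq_0_iff)
    finally have "norm (c *\<^sub>R y) < r" .
    then have "c *\<^sub>R y \<in> D" using y by (intro r(2) span_scale)
    then have "F (c *\<^sub>R y + \<tau> *\<^sub>R e) \<le> 0" by (rule \<tau>)
    moreover have "c *\<^sub>R y + \<tau> *\<^sub>R e = c *\<^sub>R (y + (\<tau> / c) *\<^sub>R e)" using c by (simp add: scaleR_right_distrib)
    moreover have "F (c *\<^sub>R (y + (\<tau> / c) *\<^sub>R e)) = c * F (y + (\<tau> / c) *\<^sub>R e)"
      using homog_onD[OF F(1), of "y + (\<tau> / c) *\<^sub>R e" c] c y e by (simp add: span_add span_scale)
    ultimately have "F (y + (\<tau> / c) *\<^sub>R e) \<le> 0" using c by (simp add: mult_le_0_iff)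
    then show ?thesis using c \<tau> by (intro exI[of _ "\<tau> / c"]) simp
  qed
  have shift: "G (y + t *\<^sub>R e) = G y + t * F e" if y: "y \<in> span D" for y t
  proof -
    have yt: "y + t *\<^sub>R e \<in> span D" using y e by (intro span_add span_scale)
    then obtain \<sigma> where s: "F (y + t *\<^sub>R e + \<sigma> *\<^sub>R e) \<le> 0" using ex by blast
    have eq: "y + t *\<^sub>R e + \<sigma> *\<^sub>R e = y + (t + \<sigma>) *\<^sub>R e" by (simp add: scaleR_left_distrib)
    have "G y = F (y + (t + \<sigma>) *\<^sub>R e) - (t + \<sigma>) * F e" using s by (intro Gval[OF y]) (simp add: eq)
    then show ?thesis using Gval[OF yt s] by (simp add: eq algebra_simps)
  qed
  show ?thesis
  proof (rule that[OF _ _ _ shift])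
    show "homog_on (span D) G"
      unfolding homog_on_def
    proof clarify
      fix y and c :: real assume y: "y \<in> span D" and "0 \<le> c"
      obtain \<sigma> where s: "F (y + \<sigma> *\<^sub>R e) \<le> 0" using ex[OF y] by blast
      have sc: "F (c *\<^sub>R y + (c * \<sigma>) *\<^sub>R e) = c * F (y + \<sigma> *\<^sub>R e)"
        using homog_onD[OF F(1), of "y + \<sigma> *\<^sub>R e" c] \<open>0 \<le> c\<close> y e by (simp add: span_add span_scale scaleR_right_distrib)
      have "G (c *\<^sub>R y) = F (c *\<^sub>R y + (c * \<sigma>) *\<^sub>R e) - (c * \<sigma>) * F e"
        by (rule Gval) (use y sc s \<open>0 \<le> c\<close> in \<open>auto simp: span_scale mult_nonneg_nonpos\<close>)
      then have "G (c *\<^sub>R y) = c * (F (y + \<sigma> *\<^sub>R e) - \<sigma> * F e)" by (simp only: sc right_diff_distrib mult.assoc)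
      then show "G (c *\<^sub>R y) = c *\<^sub>R G y" using Gval[OF y s] by simp
    qed
    show "sgn (F y) = sgn (G y)" if y: "y \<in> span D" for y
    proof (cases "F y \<le> 0")
      case True
      then show ?thesis using Gval[OF y, of 0] by simp
    next
      case False
      \<comment> \<open>Where \<open>F\<close> is positive, the line in direction \<open>e\<close>
        meets a zero of \<open>F\<close> at some positive parameter \<open>s\<close>; extrapolating
        back with the slope \<open>F e < 0\<close> gives the positive value
        \<open>- (s * F e)\<close>.\<close>
      obtain \<sigma> where "0 \<le> \<sigma>" "F (y + \<sigma> *\<^sub>R e) \<le> 0" using ex[OF y] by blast
      then obtain s where s: "0 < s" "F (y + s *\<^sub>R e) = 0"
        using zero_on_segment[OF D F e(1) y, of \<sigma>] False by (metis not_le)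
      then have "G y = - (s * F e)" using Gval[OF y, of s] by simp
      then show ?thesis using s e(2) False by (simp add: mult_pos_neg)
    qed
    obtain B where B: "0 < B" "\<And>y. y \<in> D \<Longrightarrow> norm y \<le> B"
      using polytope_imp_bounded[OF D(1)] unfolding bounded_pos by blast
    \<comment> \<open>The single shift \<tau> serves all of \<open>D\<close>, so there
      \<open>G\<close> is an affine expression in one value of \<open>F\<close>. The factor
      \<open>c\<close> brings the argument of that value back into \<open>D\<close>, where
      \<open>F\<close> is known to be PL.\<close>
    define c where "c = r / (B + \<tau> * norm e + 1)"
    have d0: "0 < B + \<tau> * norm e + 1" using B \<tau> by (simp add: add_pos_nonneg)
    then have c: "0 < c" using r by (simp add: c_def)
    have inD: "c *\<^sub>R (y + \<tau> *\<^sub>R e) \<in> D" if "y \<in> D" for y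
    proof (rule r(2))
      show "c *\<^sub>R (y + \<tau> *\<^sub>R e) \<in> span D" using that e by (intro span_scale span_add) (auto intro: span_base)
      have "norm (y + \<tau> *\<^sub>R e) \<le> B + \<tau> * norm e" using norm_triangle_ineq[of y "\<tau> *\<^sub>R e"] \<tau>(1) B(2)[OF that] by simp
      then have "norm (y + \<tau> *\<^sub>R e) < B + \<tau> * norm e + 1" by simp
      then have "c * norm (y + \<tau> *\<^sub>R e) < c * (B + \<tau> * norm e + 1)" using c by (rule mult_strict_left_mono)
      also have "\<dots> = r" using d0 by (simp add: c_def)
      finally show "norm (c *\<^sub>R (y + \<tau> *\<^sub>R e)) < r" using c by simp
    qed
    have "pwa D (\<lambda>y. c *\<^sub>R (y + \<tau> *\<^sub>R e))"
      using pwa_ident[OF F(2)] by (intro pwa_scaleR pwa_add pwa_const)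
    then have "pwa D (\<lambda>y. F (c *\<^sub>R (y + \<tau> *\<^sub>R e)))"
      by (rule pwa_compose[OF _ F(2)]) (use inD in auto)
    then have "pwa D (\<lambda>y. (1 / c) *\<^sub>R F (c *\<^sub>R (y + \<tau> *\<^sub>R e)) - \<tau> * F e)"
      by (intro pwa_diff pwa_scaleR pwa_const[OF F(2)])
    then show "pwa D G"
    proof (rule pwa_cong)
      fix y assume y: "y \<in> D"
      have "F (c *\<^sub>R (y + \<tau> *\<^sub>R e)) = c * F (y + \<tau> *\<^sub>R e)"
        using homog_onD[OF F(1), of "y + \<tau> *\<^sub>R e" c] c y e by (simp add: span_add span_scale span_base)
      then show "(1 / c) *\<^sub>R F (c *\<^sub>R (y + \<tau> *\<^sub>R e)) - \<tau> * F e = G y"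
        using Gval[of y \<tau>] \<tau>(2)[OF y] y c by (simp add: span_base)
    qed
  qed
qed

section \<open>Charts from injective PL maps into a linear subspace\<close>

lemma orthonormal_coordinates_homeomorphic:
  fixes b :: "nat \<Rightarrow> 'b::euclidean_space"
  assumes E: "span (b ` {..<d}) = E" and on: "\<And>i j. i < d \<Longrightarrow> j < d \<Longrightarrow> b i \<bullet> b j = (if i = j then 1 else 0)"
  shows "homeomorphic_map (top_of_set E) (Euclidean_space d) (\<lambda>y i. if i < d then y \<bullet> b i else 0)"
proof -
  define g where "g x = (\<Sum>i<d. x i *\<^sub>R b i)" for x :: "nat \<Rightarrow> real"
  have coord: "g x \<bullet> b j = x j" if "j < d" for x j
  proof -
    have "g x \<bullet> b j = (\<Sum>i<d. if i = j then x i else 0)"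
      unfolding g_def inner_sum_left using that by (intro sum.cong) (auto simp: on)
    then show ?thesis using that by simp
  qed
  have gE: "g x \<in> E" for x unfolding g_def E[symmetric] by (intro span_sum span_scale span_base) auto
  have rep: "g (\<lambda>i. if i < d then y \<bullet> b i else 0) = y" if "y \<in> E" for y
  proof -
    have "y \<in> span (b ` {..<d})" using that E by simp
    then show ?thesis
    proof (induction rule: span_induct_alt)
      case base
      then show ?case by (simp add: g_def)
    next
      case (step c x y)
      then obtain j where j: "j < d" "x = b j" by auto
      have "g (\<lambda>i. if i < d then (c *\<^sub>R x + y) \<bullet> b i else 0) = c *\<^sub>R (\<Sum>i<d. (b j \<bullet> b i) *\<^sub>R b i) + g (\<lambda>i. if i < d then y \<bullet> b i else 0)"
        by (simp add: g_def j inner_add_left scaleR_left_distrib sum.distrib scaleR_sum_right)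
      also have "(\<Sum>i<d. (b j \<bullet> b i) *\<^sub>R b i) = (\<Sum>i<d. if i = j then b i else 0)"
        using j on by (intro sum.cong) auto
      also have "\<dots> = b j" using j by simp
      finally show ?case using step j by simp
    qed
  qed
  have "homeomorphic_maps (top_of_set E) (Euclidean_space d) (\<lambda>y i. if i < d then y \<bullet> b i else 0) g"
    unfolding homeomorphic_maps_def
  proof (intro conjI ballI)
    show "continuous_map (top_of_set E) (Euclidean_space d) (\<lambda>y i. if i < d then y \<bullet> b i else 0)"
      unfolding continuous_map_componentwise_Euclidean_space by (auto intro!: continuous_intros)
    have "continuous_on (topspace (Euclidean_space d)) g"
      unfolding g_def by (intro continuous_intros continuous_on_subset[OF continuous_on_product_coordinates]) auto
    then show "continuous_map (Euclidean_space d) (top_of_set E) g"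
      using gE by (simp add: continuous_map_in_subtopology continuous_map_Euclidean_space_iff)
    show "g (\<lambda>i. if i < d then y \<bullet> b i else 0) = y" if "y \<in> topspace (top_of_set E)" for y
      using that rep by simp
    show "(\<lambda>i. if i < d then g x \<bullet> b i else 0) = x" if "x \<in> topspace (Euclidean_space d)" for x
      using that coord by (auto simp: topspace_Euclidean_space)
  qed
  then show ?thesis by (rule homeomorphic_maps_imp_map)
qed

text \<open>On the compact set \<open>N\<close> the injective map \<psi> is a homeomorphism onto its
  image. The set \<open>Y\<close> provides openness in \<open>E\<close> and not merely in that
  image: \<open>U\<close> is the part of \<open>W\<close> that is mapped into
  \<open>Y\<close>.\<close>

lemma pl_chart_exists:
  fixes \<psi> :: "'a::euclidean_space \<Rightarrow> 'b::euclidean_space" and b :: "nat \<Rightarrow> 'b"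
  assumes N: "pwa N \<psi>" "inj_on \<psi> N" "N \<subseteq> M" "\<psi> p = 0" "\<psi> ` N \<subseteq> E"
    and W: "openin (top_of_set M) W" "p \<in> W" "W \<subseteq> N"
    and Y: "openin (top_of_set E) Y" "0 \<in> Y" "Y \<subseteq> \<psi> ` N"
    and E: "span (b ` {..<d}) = E" and on: "\<And>i j. i < d \<Longrightarrow> j < d \<Longrightarrow> b i \<bullet> b j = (if i = j then 1 else 0)"
  obtains U where "U \<subseteq> W" "pl_chart d M p U (\<lambda>x i. if i < d then \<psi> x \<bullet> b i else 0)"
proof -
  have cont: "continuous_on N \<psi>" by (rule pwa_continuous[OF N(1)])
  obtain h where h: "homeomorphism N (\<psi> ` N) \<psi> h"
    using homeomorphism_compact[OF pwa_compact[OF N(1)] cont refl N(2)] by blast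
  define U where "U = W \<inter> {x \<in> N. \<psi> x \<in> Y}"
  have oY: "openin (top_of_set (\<psi> ` N)) Y" using Y(1,3) N(5) by (rule openin_subset_trans)
  have oW: "openin (top_of_set N) W" using W(1,3) N(3) by (rule openin_subset_trans)
  have "openin (top_of_set N) {x \<in> N. \<psi> x \<in> Y}"
  proof -
    have "openin (top_of_set N) (N \<inter> \<psi> -` Y)" by (rule continuous_openin_preimage[OF cont _ oY]) auto
    moreover have "N \<inter> \<psi> -` Y = {x \<in> N. \<psi> x \<in> Y}" by auto
    ultimately show ?thesis by simp
  qed
  then have oUN: "openin (top_of_set N) U" unfolding U_def by (intro openin_Int oW)
  then have "openin (top_of_set W) U" by (rule openin_subset_trans) (use W in \<open>auto simp: U_def\<close>)
  then have oU: "openin (top_of_set M) U" using W(1) by (rule openin_trans)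
  have UN: "U \<subseteq> N" by (auto simp: U_def)
  have pU: "p \<in> U" using W N Y by (auto simp: U_def)
  have "openin (top_of_set (\<psi> ` N)) (\<psi> ` U)" by (rule homeomorphism_imp_open_map[OF h oUN])
  then have "openin (top_of_set Y) (\<psi> ` U)" by (rule openin_subset_trans) (use Y in \<open>auto simp: U_def\<close>)
  then have oUE: "openin (top_of_set E) (\<psi> ` U)" using Y(1) by (rule openin_trans)
  let ?\<kappa> = "\<lambda>y i. if i < d then y \<bullet> b i else 0"
  let ?\<phi> = "\<lambda>x i. if i < d then \<psi> x \<bullet> b i else 0"
  have \<kappa>: "homeomorphic_map (top_of_set E) (Euclidean_space d) ?\<kappa>"
    by (rule orthonormal_coordinates_homeomorphic[OF E on])
  have im: "?\<phi> ` U = ?\<kappa> ` \<psi> ` U" by (simp add: image_image)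
  have UE: "\<psi> ` U \<subseteq> E" using UN N(5) by auto
  have op: "openin (Euclidean_space d) (?\<phi> ` U)"
    unfolding im using homeomorphic_map_openness[OF \<kappa>, of "\<psi> ` U"] UE oUE by simp
  have sub: "homeomorphic_map (subtopology (top_of_set E) (\<psi> ` U)) (subtopology (Euclidean_space d) (?\<phi> ` U)) ?\<kappa>"
  proof (rule homeomorphic_map_subtopologies[OF \<kappa>])
    have "?\<kappa> ` topspace (top_of_set E) = topspace (Euclidean_space d)" by (rule homeomorphic_imp_surjective_map[OF \<kappa>])
    then have "?\<phi> ` U \<subseteq> topspace (Euclidean_space d)" unfolding im using UE by auto
    moreover have "topspace (top_of_set E) \<inter> \<psi> ` U = \<psi> ` U" using UE by auto
    ultimately show "?\<kappa> ` (topspace (top_of_set E) \<inter> \<psi> ` U) = topspace (Euclidean_space d) \<inter> ?\<phi> ` U"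
      by (simp add: im Int_absorb1)
  qed
  have s: "subtopology (top_of_set E) (\<psi> ` U) = top_of_set (\<psi> ` U)"
    using UE by (simp add: subtopology_subtopology Int_absorb1)
  have "homeomorphism U (\<psi> ` U) \<psi> h" by (rule homeomorphism_of_subsets[OF h UN]) (use UN in auto)
  then have "homeomorphic_maps (top_of_set U) (top_of_set (\<psi> ` U)) \<psi> h"
    unfolding homeomorphic_maps_def homeomorphism_def by auto
  then have "homeomorphic_map (top_of_set U) (top_of_set (\<psi> ` U)) \<psi>" by (rule homeomorphic_maps_imp_map)
  from homeomorphic_map_compose[OF this sub[unfolded s]]
  have hom: "homeomorphic_map (top_of_set U) (subtopology (Euclidean_space d) (?\<phi> ` U)) ?\<phi>"
    by (simp add: o_def)
  obtain T where T: "simplicial_complex T" "\<Union>T = N" "\<And>S. S \<in> T \<Longrightarrow> affine_on S \<psi>"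
    by (rule pwa_triangulation[OF N(1)]) blast
  have aff: "affine_on S (\<lambda>x. ?\<phi> x i)" if "S \<in> T" "i < d" for S i
  proof -
    have "affine_on S (\<lambda>x. \<psi> x \<bullet> b i)"
      using T(3)[OF that(1)] by (intro affine_on_linear[where L="\<lambda>y. y \<bullet> b i"])
        (auto intro!: bounded_linear.linear bounded_linear_inner_left)
    then show ?thesis using that(2) by simp
  qed
  show ?thesis
  proof
    show "U \<subseteq> W" by (auto simp: U_def)
    show "pl_chart d M p U ?\<phi>"
      unfolding pl_chart_def using oU pU op hom T aff UN N(3,4) by auto
  qed
qed


subsection \<open>Perturbing a discrete Morse function\<close>

text \<open>Forman's matching on vertex sets: \<open>m C D\<close> says that \<open>D\<close> is an
  exceptional coface of \<open>C\<close>, equivalently \<open>C\<close> an exceptional face of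
  \<open>D\<close>. The two uniqueness conditions are those of a discrete Morse function.\<close>

locale matching =
  fixes V :: "'a set set" and \<gamma> :: "'a set \<Rightarrow> real" and m :: "'a set \<Rightarrow> 'a set \<Rightarrow> bool"
  assumes finV: "finite V" and fin: "C \<in> V \<Longrightarrow> finite C"
    and closed: "C \<in> V \<Longrightarrow> D \<subseteq> C \<Longrightarrow> D \<noteq> {} \<Longrightarrow> D \<in> V"
    and m_iff: "m C D \<longleftrightarrow> C \<in> V \<and> D \<in> V \<and> C \<noteq> {} \<and> (\<exists>x. x \<notin> C \<and> D = insert x C) \<and> \<gamma> D \<le> \<gamma> C"
    and up_unique: "m C D \<Longrightarrow> m C D' \<Longrightarrow> D = D'"
    and down_unique: "m C D \<Longrightarrow> m C' D \<Longrightarrow> C = C'"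
begin

lemma not_m_less: "insert x C \<in> V \<Longrightarrow> C \<noteq> {} \<Longrightarrow> x \<notin> C \<Longrightarrow> \<not> m C (insert x C) \<Longrightarrow> \<gamma> C < \<gamma> (insert x C)"
  using m_iff[of C "insert x C"] closed[of "insert x C" C] by fastforce

text \<open>Between \<open>A\<close> and \<open>C\<close> lies a second intermediate set
  \<open>insert y A\<close>. By uniqueness of partners neither of its two inclusions is matched, so
  \<gamma> increases strictly from \<open>A\<close> to \<open>C\<close> through it, whereas through
  \<open>B\<close> it does not increase.\<close>

lemma m_exclusive: assumes "m A B" "m B C" shows False
proof -
  obtain x y where xy: "x \<notin> A" "B = insert x A" "y \<notin> B" "C = insert y B" using assms m_iff by metis
  have A: "A \<noteq> {}" "C \<in> V" using assms m_iff by blast+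
  have eq: "C = insert x (insert y A)" "x \<notin> insert y A" using xy by auto
  have B': "insert y A \<in> V" using closed[OF A(2)] eq by blast
  have "insert y A \<noteq> B" using xy by auto
  then have "\<not> m A (insert y A)" "\<not> m (insert y A) C" using up_unique[OF assms(1)] down_unique[OF assms(2)] by metis+
  then have "\<gamma> A < \<gamma> (insert y A)" "\<gamma> (insert y A) < \<gamma> C"
    using not_m_less[of y A] not_m_less[of x "insert y A"] xy A B' eq by auto
  moreover have "\<gamma> C \<le> \<gamma> B" "\<gamma> B \<le> \<gamma> A" using assms m_iff by auto
  ultimately show False by simp
qed

text \<open>Both members of a matched pair get the value of the larger one. Unlike \<open>\<gamma>\<close> itself, this is strictly
  monotone along all inclusions outside the matching, of any codimension.\<close>

definition level :: "'a set \<Rightarrow> real"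
  where "level C = (if \<exists>D. m C D then \<gamma> (SOME D. m C D) else \<gamma> C)"

lemma level_matched: assumes "m C D" shows "level C = \<gamma> D"
proof -
  have "m C (SOME D. m C D)" using assms by (rule someI)
  then have "(SOME D. m C D) = D" using assms up_unique by blast
  then show ?thesis using assms by (auto simp: level_def)
qed

lemma level_unmatched: "\<not> (\<exists>D. m C D) \<Longrightarrow> level C = \<gamma> C"
  by (simp add: level_def)

lemma level_le: "level C \<le> \<gamma> C"
proof (cases "\<exists>D. m C D")
  case True
  then obtain D where "m C D" by blast
  then show ?thesis using level_matched[of C D] m_iff[of C D] by simp
qed (simp add: level_unmatched)

lemma level_matched_eq: "m C D \<Longrightarrow> level C = level D"
  using level_matched level_unmatched m_exclusive by metis

text \<open>The delicate case is that \<open>insert x A\<close> is itself matched with a larger set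
  \<open>D\<close>, so that its level drops to \<open>\<gamma> D\<close>. The other intermediate set
  \<open>insert y A\<close> is then not matched with \<open>D\<close>, so its value is below
  \<open>\<gamma> D\<close>, and \<open>A\<close> is compared with \<open>D\<close> through
  it.\<close>

lemma level_less_facet:
  assumes A: "A \<noteq> {}" "x \<notin> A" "insert x A \<in> V" and nm: "\<not> m A (insert x A)"
  shows "level A < level (insert x A)"
proof -
  have less: "\<gamma> A < \<gamma> (insert x A)" using not_m_less A nm by blast
  show ?thesis
  proof (cases "\<exists>D. m (insert x A) D")
    case False
    then show ?thesis using less level_le[of A] level_unmatched by fastforce
  next
    case True
    then obtain D where D: "m (insert x A) D" by blast
    then obtain y where y: "y \<notin> insert x A" "D = insert y (insert x A)" "D \<in> V" using m_iff by metis
    have eq: "D = insert x (insert y A)" "x \<notin> insert y A" using y A by auto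
    have CV: "insert y A \<in> V" using closed[OF y(3)] eq by blast
    have "insert y A \<noteq> insert x A" using y A by auto
    then have "\<not> m (insert y A) D" using down_unique[OF D] by metis
    then have l: "\<gamma> (insert y A) < \<gamma> D" using not_m_less[of x "insert y A"] eq y(3) by auto
    have "level A < \<gamma> D"
    proof (cases "m A (insert y A)")
      case True
      then show ?thesis using level_matched l by simp
    next
      case False
      then have "\<gamma> A < \<gamma> (insert y A)" using not_m_less[of y A] CV A y by auto
      then show ?thesis using level_le[of A] l by simp
    qed
    then show ?thesis using level_matched[OF D] by simp
  qed
qed

text \<open>Vertices are added one at a time. No step lowers the level, only a matched step keeps
  it, and by \<open>m_exclusive\<close> two consecutive steps are never both matched. So the only
  inclusions without strict increase are the matched pairs themselves.\<close>

lemma level_less: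
  assumes "A \<noteq> {}" "A \<subset> B" "B \<in> V" "\<not> m A B" shows "level A < level B"
  using assms
proof (induction "card (B - A)" arbitrary: A rule: less_induct)
  case less
  obtain x where x: "x \<in> B" "x \<notin> A" using less.prems by auto
  have finB: "finite B" using fin less.prems by blast
  have CV: "insert x A \<in> V" using closed[OF less.prems(3)] x less.prems(2) by blast
  have step: "level A \<le> level (insert x A)" "\<not> m A (insert x A) \<Longrightarrow> level A < level (insert x A)"
    using level_less_facet[OF less.prems(1) x(2) CV] level_matched_eq[of A "insert x A"] by fastforce+
  show ?case
  proof (cases "insert x A = B")
    case True
    then show ?thesis using step(2) less.prems by auto
  next
    case False
    then have sub: "insert x A \<subset> B" using x less.prems by auto
    have "card (B - insert x A) < card (B - A)"
      by (rule psubset_card_mono) (use finB x in auto)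
    then have IH: "\<not> m (insert x A) B \<Longrightarrow> level (insert x A) < level B"
      using less.hyps[of "insert x A"] sub less.prems(3) by auto
    show ?thesis
    proof (cases "m (insert x A) B")
      case True
      then have "\<not> m A (insert x A)" using m_exclusive by blast
      then show ?thesis using step(2) level_matched_eq[OF True] by simp
    next
      case False
      then show ?thesis using IH step(1) by simp
    qed
  qed
qed

text \<open>Levels are scaled so that different ones are at least 2 apart. Corrections below 1/2
  then separate equal levels and lift the smaller set of a matched pair above the larger. The gap of
  1 that remains is the one \<open>negative_star\<close> asks for.\<close>

lemma perturbation:
  assumes \<eta>: "0 < \<eta>"
  obtains h :: "'a set \<Rightarrow> real" where "inj_on h V"
    "\<And>A B. A \<noteq> {} \<Longrightarrow> A \<subset> B \<Longrightarrow> B \<in> V \<Longrightarrow> \<not> m A B \<Longrightarrow> 1 \<le> h B - h A"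
    "\<And>A B. m A B \<Longrightarrow> 0 < h A - h B \<and> h A - h B < \<eta>"
proof -
  define \<Delta> where "\<Delta> = (\<lambda>(A,B). level B - level A) ` {(A,B) \<in> V \<times> V. level A < level B}"
  have "finite {(A,B) \<in> V \<times> V. level A < level B}" by (rule finite_subset[of _ "V \<times> V"]) (use finV in auto)
  then have "finite (insert 1 \<Delta>)" by (simp add: \<Delta>_def)
  \<comment> \<open>The least positive difference of levels; the extra 1 keeps the set nonempty if
    all levels agree.\<close>
  define \<delta> where "\<delta> = Min (insert 1 \<Delta>)"
  have "\<delta> \<in> insert 1 \<Delta>" unfolding \<delta>_def by (rule Min_in) (use \<open>finite (insert 1 \<Delta>)\<close> in auto)
  then have \<delta>0: "0 < \<delta>" by (auto simp: \<Delta>_def)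
  have gap: "\<delta> \<le> level B - level A" if "A \<in> V" "B \<in> V" "level A < level B" for A B
    unfolding \<delta>_def by (rule Min_le) (use \<open>finite (insert 1 \<Delta>)\<close> that in \<open>auto simp: \<Delta>_def intro!: image_eqI[of _ _ "(A, B)"]\<close>)
  obtain f where f: "inj_on f V" "f ` V = {..<card V}" using finV
    by (metis bij_betw_def ex_bij_betw_finite_nat atLeast0LessThan)
  \<comment> \<open>Distinct tie-breakers strictly between 0 and 1.\<close>
  define e where "e C = (real (f C) + 1) / (real (card V) + 2)" for C
  have e01: "0 < e C" "e C < 1" if "C \<in> V" for C
  proof -
    have "f C < card V" using f(2) that by auto
    then show "0 < e C" "e C < 1" by (auto simp: e_def field_simps)
  qed
  have einj: "C = D" if "C \<in> V" "D \<in> V" "e C = e D" for C D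
    using that f(1) by (auto simp: e_def inj_on_def)
  \<comment> \<open>A shift by 1 outweighs any difference of tie-breakers, so within a matched pair
    the smaller set comes out higher.\<close>
  define lo where "lo C = (if \<exists>D. m C D then 1 else (0::real))" for C
  \<comment> \<open>The sums \<open>e C + lo C\<close> lie strictly between 0 and 2, so these bounds
    keep every correction below 1/2 and every matched difference below \<eta>.\<close>
  define \<epsilon> where "\<epsilon> = min (\<eta> / 4) (1 / 4)"
  have \<epsilon>: "0 < \<epsilon>" "\<epsilon> \<le> \<eta> / 4" "\<epsilon> \<le> 1 / 4" using \<eta> by (auto simp: \<epsilon>_def)
  define h where "h C = (2 / \<delta>) * level C + \<epsilon> * (e C + lo C)" for C
  have el: "0 < e C + lo C" "e C + lo C < 2" if "C \<in> V" for C using e01[OF that] by (auto simp: lo_def)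
  have elb: "0 < \<epsilon> * (e C + lo C)" "\<epsilon> * (e C + lo C) < 1 / 2" if "C \<in> V" for C
  proof -
    show "0 < \<epsilon> * (e C + lo C)" using el[OF that] \<epsilon> by simp
    have "\<epsilon> * (e C + lo C) < \<epsilon> * 2" using el[OF that] \<epsilon> by (intro mult_strict_left_mono) auto
    then show "\<epsilon> * (e C + lo C) < 1 / 2" using \<epsilon> by linarith
  qed
  have big: "1 \<le> h B - h A" if "A \<in> V" "B \<in> V" "level A < level B" for A B
  proof -
    have "(2 / \<delta>) * \<delta> \<le> (2 / \<delta>) * (level B - level A)" using gap[OF that] \<delta>0 by (intro mult_left_mono) auto
    then have "2 \<le> (2 / \<delta>) * level B - (2 / \<delta>) * level A" using \<delta>0 by (simp add: right_diff_distrib)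
    then show ?thesis using elb[OF that(1)] elb[OF that(2)] unfolding h_def by linarith
  qed
  show ?thesis
  proof
    show "inj_on h V"
    proof (rule inj_onI)
      fix A B assume AB: "A \<in> V" "B \<in> V" "h A = h B"
      have "level A = level B" using big[OF AB(1,2)] big[OF AB(2,1)] AB(3) by (metis diff_self linorder_neqE_linordered_idom not_one_le_zero)
      then have "e A + lo A = e B + lo B" using AB(3) \<epsilon> by (simp add: h_def)
      then have "e A = e B" using e01[OF AB(1)] e01[OF AB(2)] unfolding lo_def by (auto split: if_splits)
      then show "A = B" using einj AB by blast
    qed
    show "1 \<le> h B - h A" if "A \<noteq> {}" "A \<subset> B" "B \<in> V" "\<not> m A B" for A B
      by (rule big) (use that level_less closed[of B A] in auto)
    show "0 < h A - h B \<and> h A - h B < \<eta>" if "m A B" for A B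
    proof -
      have V: "A \<in> V" "B \<in> V" using that m_iff by auto
      have "lo A = 1" "lo B = 0" using that m_exclusive by (auto simp: lo_def)
      then have d: "h A - h B = \<epsilon> * (e A - e B + 1)" using level_matched_eq[OF that] by (simp add: h_def algebra_simps)
      have b: "0 < e A - e B + 1" "e A - e B + 1 < 2" using e01[OF V(1)] e01[OF V(2)] by auto
      have "\<epsilon> * (e A - e B + 1) < \<epsilon> * 2" using b \<epsilon> by (intro mult_strict_left_mono) auto
      moreover have "0 < \<epsilon> * (e A - e B + 1)" using b \<epsilon> by (intro mult_pos_pos)
      ultimately show ?thesis using \<epsilon>(2) \<eta> unfolding d by linarith
    qed
  qed
qed

end

section \<open>From a discrete Morse function to a matching on vertex sets\<close>

lemma facet_of_vsets:
  assumes K: "simplicial_complex K" "C \<in> vsets K" "D \<in> vsets K"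
  shows "convex hull C facet_of convex hull D \<longleftrightarrow> C \<noteq> {} \<and> (\<exists>x. x \<notin> C \<and> D = insert x C)"
proof -
  have ind: "\<not> affine_dependent C" "\<not> affine_dependent D" using K by (auto simp: vsets_def)
  have "convex hull C facet_of convex hull D \<longleftrightarrow> convex hull C \<noteq> {} \<and> (\<exists>u. u \<in> D \<and> convex hull C = convex hull (D - {u}))"
    by (rule facet_of_convex_hull_affine_independent[OF ind(2)])
  also have "\<dots> \<longleftrightarrow> C \<noteq> {} \<and> (\<exists>u. u \<in> D \<and> C = D - {u})"
  proof -
    have "convex hull C = convex hull (D - {u}) \<longleftrightarrow> C = D - {u}" for u
      using convex_hull_inj_affine_independent[OF ind(1), of "D - {u}"] affine_independent_subset[OF ind(2), of "D - {u}"] by auto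
    then show ?thesis by simp
  qed
  also have "\<dots> \<longleftrightarrow> C \<noteq> {} \<and> (\<exists>x. x \<notin> C \<and> D = insert x C)" by auto
  finally show ?thesis .
qed

lemma morse_matching:
  assumes K: "simplicial_complex K" and g: "discrete_morse K g"
  shows "matching (vsets K - {{}}) (\<lambda>C. g (convex hull C))
    (\<lambda>C D. C \<in> vsets K - {{}} \<and> D \<in> vsets K - {{}} \<and> exceptional_coface K g (convex hull C) (convex hull D))"
proof
  have cell: "convex hull C \<in> cells K \<longleftrightarrow> True" if "C \<in> vsets K - {{}}" for C
    using that by (auto simp: cells_def vsets_def)
  note inj = convex_hull_inj_affine_independent
  show "finite (vsets K - {{}})" using finite_vsets[OF K] by simp
  show "finite C" if "C \<in> vsets K - {{}}" for C using that vsets_finite[OF K] by blast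
  show "D \<in> vsets K - {{}}" if "C \<in> vsets K - {{}}" "D \<subseteq> C" "D \<noteq> {}" for C D
    using that vsets_subset[OF K] by blast
  show "(C \<in> vsets K - {{}} \<and> D \<in> vsets K - {{}} \<and> exceptional_coface K g (convex hull C) (convex hull D)) =
       (C \<in> vsets K - {{}} \<and> D \<in> vsets K - {{}} \<and> C \<noteq> {} \<and> (\<exists>x. x \<notin> C \<and> D = insert x C) \<and> g (convex hull D) \<le> g (convex hull C))" for C D
    using facet_of_vsets[OF K, of C D] cell[of D] by (auto simp: exceptional_coface_def not_less)
  show "D = D'" if "C \<in> vsets K - {{}} \<and> D \<in> vsets K - {{}} \<and> exceptional_coface K g (convex hull C) (convex hull D)"
    "C \<in> vsets K - {{}} \<and> D' \<in> vsets K - {{}} \<and> exceptional_coface K g (convex hull C) (convex hull D')" for C D D'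
  proof -
    have "\<exists>\<^sub>\<le>\<^sub>1T. exceptional_coface K g (convex hull C) T" using g cell[of C] that(1) by (simp add: discrete_morse_def)
    then have "convex hull D = convex hull D'" using that by (auto dest: Uniq_D)
    then show ?thesis using inj[of D D'] that by (auto simp: vsets_def)
  qed
  show "C = C'" if "C \<in> vsets K - {{}} \<and> D \<in> vsets K - {{}} \<and> exceptional_coface K g (convex hull C) (convex hull D)"
    "C' \<in> vsets K - {{}} \<and> D \<in> vsets K - {{}} \<and> exceptional_coface K g (convex hull C') (convex hull D)" for C D C'
  proof -
    have "\<exists>\<^sub>\<le>\<^sub>1F. exceptional_face K g (convex hull D) F" using g cell[of D] that(1) by (simp add: discrete_morse_def)
    moreover have "exceptional_face K g (convex hull D) (convex hull C)" "exceptional_face K g (convex hull D) (convex hull C')"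
      using that cell[of C] cell[of C'] by (auto simp: exceptional_face_def exceptional_coface_def)
    ultimately have "convex hull C = convex hull C'" by (auto dest: Uniq_D)
    then show ?thesis using inj[of C C'] that by (auto simp: vsets_def)
  qed
qed


subsection \<open>Functions on the cone over a polyhedral sphere\<close>

lemma cone_combine_ex:
  assumes "affine_on P f" "convex P" "z \<in> P" "z' \<in> P" "0 \<le> a" "0 \<le> b"
  shows "\<exists>w\<in>P. a *\<^sub>R z + b *\<^sub>R z' = (a + b) *\<^sub>R w \<and> (a + b) *\<^sub>R f w = a *\<^sub>R f z + b *\<^sub>R f z'"
proof (cases "a + b = 0")
  case True
  then have "a = 0" "b = 0" using assms(5,6) by auto
  then show ?thesis using assms(3) by auto
next
  case False
  then have "0 < a + b" using assms(5,6) by simp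
  then show ?thesis
    using cone_combine[OF assms(1-6)] by (intro bexI[of _ "(1 / (a + b)) *\<^sub>R (a *\<^sub>R z + b *\<^sub>R z')"]) simp_all
qed

text \<open>On barycentric coordinates this is the function that is linear on the barycentric
  subdivision with value \<open>w C\<close> at the centroid of \<open>C\<close>; on unnormalised
  weights it is the homogeneous extension of that function.\<close>

definition flag_sum :: "('a set \<Rightarrow> real) \<Rightarrow> ('a \<Rightarrow> real) \<Rightarrow> real"
  where "flag_sum w \<beta> = (\<Sum>C | coef \<beta> C \<noteq> 0. coef \<beta> C * card C * w C)"

lemma flag_sum_eq:
  assumes "finite S" "{C. coef \<beta> C \<noteq> 0} \<subseteq> S"
  shows "flag_sum w \<beta> = (\<Sum>C\<in>S. coef \<beta> C * card C * w C)"
  unfolding flag_sum_def by (rule sum.mono_neutral_left) (use assms in auto)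

lemma coef_scale:
  assumes "chainrep \<beta> c" "0 \<le> t" shows "coef (\<lambda>u. t * \<beta> u) = (\<lambda>C. t * c C)"
proof -
  have "chainrep (\<lambda>u. t * \<beta> u + 0 * \<beta> u) (\<lambda>C. t * c C + 0 * c C)"
    by (rule chainrep_combine[OF assms(1) assms(1) assms(2)]) (use assms(1) in \<open>auto simp: chainrep_def\<close>)
  then show ?thesis by (intro coef_eq) simp
qed

lemma flag_sum_scale:
  assumes "chainrep \<beta> c" "0 \<le> t" shows "flag_sum w (\<lambda>u. t * \<beta> u) = t * flag_sum w \<beta>"
proof -
  have c: "coef \<beta> = c" by (rule coef_eq[OF assms(1)])
  have "finite {C. c C \<noteq> 0}" using assms(1) by (simp add: chainrep_def)
  then have "flag_sum w (\<lambda>u. t * \<beta> u) = (\<Sum>C | c C \<noteq> 0. t * c C * card C * w C)"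
    using coef_scale[OF assms] by (subst flag_sum_eq[of "{C. c C \<noteq> 0}"]) auto
  also have "\<dots> = t * flag_sum w \<beta>" by (simp add: flag_sum_def c sum_distrib_left mult.assoc)
  finally show ?thesis .
qed

text \<open>The boundary of a cell and its link are treated alike; on both, the barycentric
  coordinates are those of the whole complex \<open>K\<close>.\<close>

locale radial_complex = radial X \<phi> D
  for X :: "'a::euclidean_space set" and \<phi> :: "'a \<Rightarrow> 'b::euclidean_space" and D +
  fixes K :: "'a set set"
  assumes K: "simplicial_complex K" and XK: "X \<subseteq> \<Union>K"
begin

definition cone_sum :: "('a set \<Rightarrow> real) \<Rightarrow> 'b \<Rightarrow> real"
  where "cone_sum w = cone_ext X \<phi> (\<lambda>z. flag_sum w (bary K z))"

lemma flag_sum_bary: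
  assumes "z \<in> \<Union>K" shows "flag_sum w (bary K z) = (\<Sum>C\<in>vsets K. coef (bary K z) C * card C * w C)"
  by (rule flag_sum_eq) (use coef_vsets[OF K assms] finite_vsets[OF K] in auto)

lemma cone_sum_ray: "z \<in> X \<Longrightarrow> 0 \<le> t \<Longrightarrow> cone_sum w (t *\<^sub>R \<phi> z) = t * flag_sum w (bary K z)"
  unfolding cone_sum_def using cone_ext_ray[of z t "\<lambda>z. flag_sum w (bary K z)"] by simp

lemma pwa_coef_X: "pwa X (\<lambda>z. coef (bary K z) C)"
  by (rule pwa_restrict[OF pwa_coef[OF K] pwa_\<phi> XK])

lemma cone_sum_pwa: "pwa D (cone_sum w)"
  unfolding cone_sum_def
proof (rule cone_ext_pwa)
  have "pwa X (\<lambda>z. \<Sum>C\<in>vsets K. (card C * w C) *\<^sub>R coef (bary K z) C)"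
    by (intro pwa_sum[OF pwa_\<phi>] pwa_scaleR pwa_coef_X)
  then show "pwa X (\<lambda>z. flag_sum w (bary K z))"
  proof (rule pwa_cong)
    fix x assume "x \<in> X"
    then have "x \<in> \<Union>K" using XK by blast
    then show "(\<Sum>C\<in>vsets K. (card C * w C) *\<^sub>R coef (bary K x) C) = flag_sum w (bary K x)"
      by (simp add: flag_sum_bary mult_ac)
  qed
qed

lemma cone_sum_homog: "homog_on (span D) (cone_sum w)"
  unfolding cone_sum_def homog_on_def using cone_ext_scale by blast

lemma cone_sum_uminus:
  assumes y: "y \<in> span D" shows "cone_sum (\<lambda>C. - w C) y = - cone_sum w y"
proof (cases "y = 0")
  case False
  then obtain t z where "0 < t" "z \<in> X" "y = t *\<^sub>R \<phi> z" using ray_exists y by metis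
  then show ?thesis using cone_sum_ray[of z t] by (simp add: flag_sum_def sum_negf)
qed (simp add: cone_sum_def)

lemma cone_sum_pos:
  assumes w: "\<And>z C. z \<in> X \<Longrightarrow> coef (bary K z) C \<noteq> 0 \<Longrightarrow> 0 < w C" and y: "y \<in> span D" "y \<noteq> 0"
  shows "0 < cone_sum w y"
proof -
  obtain t z where tz: "0 < t" "z \<in> X" "y = t *\<^sub>R \<phi> z" using ray_exists y by metis
  have zK: "z \<in> \<Union>K" using tz XK by auto
  note rep = chainrep_bary[OF K zK]
  have "{C. coef (bary K z) C \<noteq> 0} \<noteq> {}"
  proof
    assume "{C. coef (bary K z) C \<noteq> 0} = {}"
    then have "coef (bary K z) C = 0" for C by blast
    then show False using coef_sum(1)[OF K zK] by simp
  qed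
  moreover have "0 < coef (bary K z) C * card C * w C" if "coef (bary K z) C \<noteq> 0" for C
  proof -
    have "0 < coef (bary K z) C" using chainrep_nonneg[OF rep, of C] that by simp
    moreover have "0 < card C" using coef_vsets[OF K zK that] vsets_finite[OF K] by (simp add: card_gt_0_iff)
    ultimately show ?thesis using w[OF tz(2) that] by simp
  qed
  ultimately have "0 < flag_sum w (bary K z)"
    unfolding flag_sum_def using rep by (intro sum_pos) (auto simp: chainrep_def)
  then show ?thesis using cone_sum_ray[of z t w] tz by simp
qed

lemma coef_centroid:
  assumes "B \<in> vsets K" "B \<noteq> {}"
  shows "centroid B \<in> \<Union>K" "coef (bary K (centroid B)) = (\<lambda>C. if C = B then 1 / card B else 0)"
proof -
  have fl: "{B} \<in> flags K" using assms by (auto simp: flags_def[OF K])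
  show "centroid B \<in> \<Union>K" using flag_combination(1)[OF K fl, of "\<lambda>_. 1"] by simp
  show "coef (bary K (centroid B)) = (\<lambda>C. if C = B then 1 / card B else 0)"
    using flag_combination(2)[OF K fl, of "\<lambda>_. 1"] by (simp add: fun_eq_iff)
qed

lemma flag_sum_centroid:
  assumes "B \<in> vsets K" "B \<noteq> {}" shows "flag_sum w (bary K (centroid B)) = w B"
proof -
  have "card B \<noteq> 0" using assms vsets_finite[OF K] by simp
  have "flag_sum w (bary K (centroid B)) = (\<Sum>C\<in>{B}. coef (bary K (centroid B)) C * card C * w C)"
    by (rule flag_sum_eq) (use coef_centroid(2)[OF assms] in \<open>auto split: if_splits\<close>)
  then show ?thesis using \<open>card B \<noteq> 0\<close> coef_centroid(2)[OF assms] by simp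
qed

text \<open>If the one negative value is small enough, then a polytope on which \<open>\<phi>\<close> and the function are
  both affine can meet the nonpositive region only if it contains the vertex with the negative value.\<close>

lemma negative_star:
  assumes B: "B \<in> vsets K" "B \<noteq> {}" "centroid B \<in> X"
  obtains \<eta> where "0 < \<eta>" "\<And>w y t. \<lbrakk>- \<eta> < w B; \<And>z C. z \<in> X \<Longrightarrow> coef (bary K z) C \<noteq> 0 \<Longrightarrow> C \<noteq> B \<Longrightarrow> 1 \<le> w C;
     w B < 0; y \<in> span D; cone_sum w y \<le> 0; 0 \<le> t\<rbrakk>
     \<Longrightarrow> cone_sum w (y + t *\<^sub>R \<phi> (centroid B)) = cone_sum w y + t * w B"
proof -
  obtain \<P> where P: "finite \<P>" "\<Union>\<P> = X" "\<And>P. P \<in> \<P> \<Longrightarrow> polytope P" "\<And>P. P \<in> \<P> \<Longrightarrow> affine_on P \<phi>"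
      "\<And>P C. P \<in> \<P> \<Longrightarrow> C \<in> vsets K \<Longrightarrow> affine_on P (\<lambda>z. coef (bary K z) C)"
    by (rule pwa_common[of "vsets K" X "\<lambda>C z. coef (bary K z) C", OF finite_vsets[OF K] pwa_coef_X pwa_\<phi>]) blast
  \<comment> \<open>The coordinate of the centroid of \<open>B\<close> in the barycentric
    subdivision. It equals 1 only at that centroid, so on a compact piece that misses the centroid
    it is bounded away from 1.\<close>
  define q where "q z = coef (bary K z) B * card B" for z
  have "\<exists>\<eta>>0. \<forall>z\<in>P. q z \<le> 1 - \<eta>" if Pin: "P \<in> \<P>" and nB: "centroid B \<notin> P" for P
  proof (cases "P = {}")
    case False
    have "continuous_on P q" unfolding q_def
      by (intro continuous_intros affine_on_continuous[OF P(3)[OF Pin] P(5)[OF Pin B(1)]])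
    then obtain z where z: "z \<in> P" "\<And>z'. z' \<in> P \<Longrightarrow> q z' \<le> q z"
      using continuous_attains_sup[OF polytope_imp_compact[OF P(3)[OF Pin]] False] by blast
    have zK: "z \<in> \<Union>K" using z(1) Pin P(2) XK by auto
    have "(\<Sum>C\<in>vsets K. coef (bary K z) C * card C) = q z + (\<Sum>C\<in>vsets K - {B}. coef (bary K z) C * card C)"
      using finite_vsets[OF K] B(1) by (simp add: q_def sum.remove)
    then have qs: "1 = q z + (\<Sum>C\<in>vsets K - {B}. coef (bary K z) C * card C)" using coef_sum(1)[OF K zK] by simp
    have n: "0 \<le> coef (bary K z) C * card C" for C using chainrep_nonneg[OF chainrep_bary[OF K zK]] by simp
    have "q z \<noteq> 1"
    proof
      assume "q z = 1"
      then have "(\<Sum>C\<in>vsets K - {B}. coef (bary K z) C * card C) = 0" using qs by simp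
      then have "\<forall>C\<in>vsets K - {B}. coef (bary K z) C * card C = 0"
        using n finite_vsets[OF K] by (subst (asm) sum_nonneg_eq_0_iff) auto
      then have "(\<Sum>C\<in>vsets K. (coef (bary K z) C * card C) *\<^sub>R centroid C) = (\<Sum>C\<in>{B}. (coef (bary K z) C * card C) *\<^sub>R centroid C)"
        using finite_vsets[OF K] B(1) by (intro sum.mono_neutral_right) auto
      then have "z = centroid B" using coef_sum(2)[OF K zK] \<open>q z = 1\<close> by (simp add: q_def)
      then show False using z nB by simp
    qed
    moreover have "0 \<le> (\<Sum>C\<in>vsets K - {B}. coef (bary K z) C * card C)" by (intro sum_nonneg n)
    then have "q z \<le> 1" using qs by linarith
    ultimately have "0 < 1 - q z" by simp
    then show ?thesis using z(2) by (intro exI[of _ "1 - q z"]) simp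
  qed (auto intro: exI[of _ 1])
  then have "\<forall>P\<in>{P\<in>\<P>. centroid B \<notin> P}. \<exists>\<eta>>0. \<forall>z\<in>P. q z \<le> 1 - \<eta>" by blast
  then obtain \<eta>P where \<eta>P: "\<And>P. P \<in> \<P> \<Longrightarrow> centroid B \<notin> P \<Longrightarrow> 0 < \<eta>P P \<and> (\<forall>z\<in>P. q z \<le> 1 - \<eta>P P)" by (metis (mono_tags, lifting) mem_Collect_eq)
  define \<eta> where "\<eta> = Min (insert 1 (\<eta>P ` {P\<in>\<P>. centroid B \<notin> P}))"
  have fin: "finite (insert 1 (\<eta>P ` {P\<in>\<P>. centroid B \<notin> P}))" using P(1) by simp
  have "\<eta> \<in> insert 1 (\<eta>P ` {P\<in>\<P>. centroid B \<notin> P})" unfolding \<eta>_def by (rule Min_in[OF fin]) simp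
  then have \<eta>0: "0 < \<eta>" using \<eta>P by auto
  have \<eta>q: "q z \<le> 1 - \<eta>" if "P \<in> \<P>" "centroid B \<notin> P" "z \<in> P" for P z
  proof -
    have "\<eta> \<le> \<eta>P P" unfolding \<eta>_def by (rule Min_le[OF fin]) (use that in auto)
    then show ?thesis using \<eta>P[OF that(1,2)] that(3) by fastforce
  qed
  show ?thesis
  proof (rule that[OF \<eta>0])
    fix w y t
    assume wB: "- \<eta> < w B" "w B < 0" and w1: "\<And>z C. z \<in> X \<Longrightarrow> coef (bary K z) C \<noteq> 0 \<Longrightarrow> C \<noteq> B \<Longrightarrow> 1 \<le> w C"
      and y: "y \<in> span D" "cone_sum w y \<le> 0" and t: "0 \<le> (t::real)"
    let ?g = "\<lambda>z. flag_sum w (bary K z)"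
    have gB: "?g (centroid B) = w B" by (rule flag_sum_centroid[OF B(1,2)])
    show "cone_sum w (y + t *\<^sub>R \<phi> (centroid B)) = cone_sum w y + t * w B"
    proof (cases "y = 0")
      case True
      then show ?thesis using cone_sum_ray[OF B(3) t, of w] gB by (simp add: cone_sum_def)
    next
      case False
      then obtain s z where sz: "0 < s" "z \<in> X" "y = s *\<^sub>R \<phi> z" using ray_exists y(1) by metis
      have zK: "z \<in> \<Union>K" using sz XK by auto
      have g0: "?g z \<le> 0" using cone_sum_ray[OF sz(2), of s w] y(2) sz by (simp add: mult_le_0_iff)
      obtain P where Pz: "P \<in> \<P>" "z \<in> P" using sz(2) P(2) by blast
      \<comment> \<open>Outside the pieces through the centroid, the other coordinates carry mass at
        least \<eta> with values at least 1, while the negative contribution is at least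
        \<open>w B\<close>, which exceeds \<open>- \<eta>\<close>; the sum would be
        positive.\<close>
      have BP: "centroid B \<in> P"
      proof (rule ccontr)
        assume "centroid B \<notin> P"
        then have q: "q z \<le> 1 - \<eta>" using \<eta>q Pz by blast
        have n: "0 \<le> coef (bary K z) C * card C" for C using chainrep_nonneg[OF chainrep_bary[OF K zK]] by simp
        have s1: "(\<Sum>C\<in>vsets K. coef (bary K z) C * card C) = q z + (\<Sum>C\<in>vsets K - {B}. coef (bary K z) C * card C)"
          using finite_vsets[OF K] B(1) by (simp add: q_def sum.remove)
        have "?g z = q z * w B + (\<Sum>C\<in>vsets K - {B}. coef (bary K z) C * card C * w C)"
          using flag_sum_bary[OF zK, of w] finite_vsets[OF K] B(1) by (simp add: q_def sum.remove)
        moreover have "(\<Sum>C\<in>vsets K - {B}. coef (bary K z) C * card C) \<le> (\<Sum>C\<in>vsets K - {B}. coef (bary K z) C * card C * w C)"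
        proof (rule sum_mono)
          fix C assume "C \<in> vsets K - {B}"
          then show "coef (bary K z) C * card C \<le> coef (bary K z) C * card C * w C"
            using w1[OF sz(2), of C] n[of C] mult_left_mono[of 1 "w C" "coef (bary K z) C * card C"]
            by (cases "coef (bary K z) C = 0") auto
        qed
        moreover have "w B \<le> q z * w B"
        proof -
          have "q z \<le> 1" using q \<eta>0 by simp
          then show ?thesis using mult_right_mono_neg[of "q z" 1 "w B"] wB by simp
        qed
        ultimately have "w B + (1 - q z) \<le> ?g z" using s1 coef_sum(1)[OF K zK] by linarith
        then show False using g0 q wB by linarith
      qed
      have cP: "convex P" using P(3)[OF Pz(1)] by (rule polytope_imp_convex)
      have "affine_on P (\<lambda>z. \<Sum>C\<in>vsets K. (card C * w C) *\<^sub>R coef (bary K z) C)"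
        by (intro affine_on_sum affine_on_scaleR P(5)[OF Pz(1)])
      then have "affine_on P ?g"
      proof (rule affine_on_cong[OF _ _ cP])
        fix x assume "x \<in> P"
        then have "x \<in> \<Union>K" using Pz P(2) XK by auto
        then show "(\<Sum>C\<in>vsets K. (card C * w C) *\<^sub>R coef (bary K x) C) = ?g x" by (simp add: flag_sum_bary mult_ac)
      qed
      then have aff: "affine_on P (\<lambda>z. (\<phi> z, ?g z))" using P(4)[OF Pz(1)] by (rule affine_on_Pair[rotated])
      \<comment> \<open>Both \<open>z\<close> and the centroid lie in the convex piece
        \<open>P\<close>, so the cone over \<open>P\<close> contains the whole ray from
        \<open>y\<close> in the direction of the centroid, and the sum is linear on that
        cone.\<close>
      obtain z' where z': "z' \<in> P" "(s + t) *\<^sub>R (\<phi> z', ?g z') = s *\<^sub>R (\<phi> z, ?g z) + t *\<^sub>R (\<phi> (centroid B), ?g (centroid B))"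
        using cone_combine_ex[OF aff cP Pz(2) BP, of s t] sz(1) t by auto
      have z'X: "z' \<in> X" using z'(1) Pz P(2) by auto
      have "cone_sum w (y + t *\<^sub>R \<phi> (centroid B)) = cone_sum w ((s + t) *\<^sub>R \<phi> z')"
        using z'(2) sz(3) by simp
      also have "\<dots> = (s + t) * ?g z'" using z'X sz(1) t by (intro cone_sum_ray) auto
      also have "\<dots> = s * ?g z + t * w B" using z'(2) gB by simp
      also have "\<dots> = cone_sum w y + t * w B" using cone_sum_ray[OF sz(2), of s w] sz by simp
      finally show ?thesis .
    qed
  qed
qed

text \<open>The bound \<eta> comes before \<open>w\<close>, as it depends only on the PL structure
  of \<open>X\<close> and on \<open>B\<close>. By \<open>negative_star\<close> the sum is affine
  along the direction of the centroid in its nonpositive region; \<open>monotone_extension\<close>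
  yields \<open>G\<close> with the same signs that is affine along this direction everywhere;
  \<open>homogeneous_rescaling\<close> relates the two.\<close>

lemma monotone_coordinates:
  assumes B: "B \<in> vsets K" "B \<noteq> {}" "centroid B \<in> X"
  obtains \<eta> where "0 < \<eta>" "\<And>w. \<lbrakk>- \<eta> < w B; w B < 0; \<forall>z\<in>X. \<forall>C. coef (bary K z) C \<noteq> 0 \<longrightarrow> C \<noteq> B \<longrightarrow> 1 \<le> w C\<rbrakk>
     \<Longrightarrow> \<exists>G \<rho>. \<rho> ` span D \<subseteq> span D \<and> (\<forall>y\<in>span D. G (\<rho> y) = cone_sum w y) \<and> \<rho> 0 = 0 \<and> inj_on \<rho> (span D) \<and> pwa D \<rho> \<and>
         (\<forall>y\<in>span D. \<forall>t. G (y + t *\<^sub>R \<phi> (centroid B)) = G y + t * w B)"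
proof -
  obtain \<eta> where \<eta>: "0 < \<eta>" "\<And>w y t. \<lbrakk>- \<eta> < w B; \<And>z C. z \<in> X \<Longrightarrow> coef (bary K z) C \<noteq> 0 \<Longrightarrow> C \<noteq> B \<Longrightarrow> 1 \<le> w C;
     w B < 0; y \<in> span D; cone_sum w y \<le> 0; 0 \<le> t\<rbrakk>
     \<Longrightarrow> cone_sum w (y + t *\<^sub>R \<phi> (centroid B)) = cone_sum w y + t * w B"
    using negative_star[OF B] by blast
  show ?thesis
  proof (rule that[OF \<eta>(1)])
    fix w assume w: "- \<eta> < w B" "w B < 0" "\<forall>z\<in>X. \<forall>C. coef (bary K z) C \<noteq> 0 \<longrightarrow> C \<noteq> B \<longrightarrow> 1 \<le> w C"
    let ?e = "\<phi> (centroid B)"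
    have e: "?e \<in> span D" using \<phi>_D[OF B(3)] by (rule span_base)
    have Fe: "cone_sum w ?e = w B" using cone_sum_ray[OF B(3), of 1 w] flag_sum_centroid[OF B(1,2)] by simp
    obtain G where G: "homog_on (span D) G" "pwa D G" "\<And>y. y \<in> span D \<Longrightarrow> sgn (cone_sum w y) = sgn (G y)"
        "\<And>y t. y \<in> span D \<Longrightarrow> G (y + t *\<^sub>R ?e) = G y + t * cone_sum w ?e"
    proof (rule monotone_extension[OF polytope_D zero_D cone_sum_homog cone_sum_pwa e])
      show "cone_sum w ?e < 0" using Fe w by simp
      show "cone_sum w (y + t *\<^sub>R ?e) = cone_sum w y + t * cone_sum w ?e"
        if "y \<in> span D" "cone_sum w y \<le> 0" "0 \<le> t" for y t
        unfolding Fe by (rule \<eta>(2)) (use w that in auto)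
    qed blast
    obtain \<rho> where \<rho>: "\<rho> ` span D \<subseteq> span D" "\<And>x. x \<in> span D \<Longrightarrow> G (\<rho> x) = cone_sum w x" "homog_on (span D) \<rho>"
        "inj_on \<rho> (span D)" "pwa D \<rho>"
      using homogeneous_rescaling[OF polytope_D zero_D cone_sum_homog cone_sum_pwa G(1,2,3)] by metis
    have "\<rho> 0 = 0" using homog_onD[OF \<rho>(3) span_zero, of 0] by simp
    then show "\<exists>G \<rho>. \<rho> ` span D \<subseteq> span D \<and> (\<forall>y\<in>span D. G (\<rho> y) = cone_sum w y) \<and> \<rho> 0 = 0 \<and> inj_on \<rho> (span D) \<and> pwa D \<rho> \<and>
         (\<forall>y\<in>span D. \<forall>t. G (y + t *\<^sub>R ?e) = G y + t * w B)"
      using \<rho> G(4) Fe by (intro exI[of _ G] exI[of _ \<rho>]) auto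
  qed
qed

text \<open>The sum and the l1-norm with respect to the vectors \<open>b i\<close> are both positive
  away from 0, so they have the same signs and \<open>homogeneous_rescaling\<close> applies.\<close>

lemma l1_coordinates:
  assumes w: "\<And>z C. z \<in> X \<Longrightarrow> coef (bary K z) C \<noteq> 0 \<Longrightarrow> 0 < w C"
    and b: "span (b ` {..<n}) = span D"
  obtains \<rho> where "\<rho> ` span D \<subseteq> span D" "\<And>y. y \<in> span D \<Longrightarrow> cone_sum w y = (\<Sum>i<n::nat. \<bar>\<rho> y \<bullet> b i\<bar>)" "\<rho> 0 = 0"
    "inj_on \<rho> (span D)" "pwa D \<rho>"
proof -
  define G where "G y = (\<Sum>i<n. \<bar>y \<bullet> b i\<bar>)" for y
  have hom: "homog_on (span D) G" by (auto simp: homog_on_def G_def abs_mult sum_distrib_left)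
  have pw: "pwa D G" unfolding G_def
    by (intro pwa_sum[OF cone_sum_pwa] pwa_abs pwa_linear[where f="\<lambda>y. y" and L="\<lambda>y. y \<bullet> b i" for i]
      pwa_ident[OF cone_sum_pwa] bounded_linear.linear bounded_linear_inner_left)
  have Gpos: "0 < G y" if "y \<in> span D" "y \<noteq> 0" for y
  proof -
    have "\<exists>i<n. y \<bullet> b i \<noteq> 0"
    proof (rule ccontr)
      assume "\<not> (\<exists>i<n. y \<bullet> b i \<noteq> 0)"
      then have "\<And>x. x \<in> b ` {..<n} \<Longrightarrow> orthogonal y x" by (auto simp: orthogonal_def)
      moreover have "y \<in> span (b ` {..<n})" using that(1) b by simp
      ultimately have "orthogonal y y" by (rule orthogonal_to_span[rotated])
      then show False using that(2) by (simp add: orthogonal_def)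
    qed
    then obtain i where "i < n" "y \<bullet> b i \<noteq> 0" by blast
    then have "0 < (\<Sum>i<n. \<bar>y \<bullet> b i\<bar>)" by (intro sum_pos2[of _ i]) auto
    then show ?thesis by (simp add: G_def)
  qed
  have sg: "sgn (cone_sum w y) = sgn (G y)" if "y \<in> span D" for y
  proof (cases "y = 0")
    case True
    then show ?thesis by (simp add: cone_sum_def G_def)
  next
    case False
    then show ?thesis using Gpos[OF that] cone_sum_pos[OF w that] by simp
  qed
  obtain \<rho> where \<rho>: "\<rho> ` span D \<subseteq> span D" "\<And>x. x \<in> span D \<Longrightarrow> G (\<rho> x) = cone_sum w x" "homog_on (span D) \<rho>"
        "inj_on \<rho> (span D)" "pwa D \<rho>"
    using homogeneous_rescaling[OF polytope_D zero_D cone_sum_homog cone_sum_pwa hom pw sg] by metis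
  have "\<rho> 0 = 0" using homog_onD[OF \<rho>(3) span_zero, of 0] by simp
  then show ?thesis using \<rho> by (intro that[of \<rho>]) (auto simp: G_def)
qed

end


subsection \<open>The star of a simplex as a product of two cones\<close>

text \<open>For a positive total \<open>a\<close> the point \<open>z\<close> is obtained by
  division; for \<open>a = 0\<close> it is immaterial, and \<open>x0\<close> serves as a
  default.\<close>

lemma weight_normalize:
  assumes K: "simplicial_complex K" and w: "weight K \<beta>" and ne: "x0 \<in> \<Union>K"
  defines "a \<equiv> \<Sum>u\<in>vertices K. \<beta> u"
  obtains z where "z \<in> \<Union>K" "\<beta> = (\<lambda>u. a * bary K z u)" "a *\<^sub>R z = (\<Sum>u\<in>vertices K. \<beta> u *\<^sub>R u)" "0 \<le> a"
    "a \<noteq> 0 \<Longrightarrow> z \<in> convex hull {u. \<beta> u \<noteq> 0}"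
proof (cases "a = 0")
  case True
  then have "\<beta> = (\<lambda>u. 0)" using weight_sum_zero[OF K w] by (auto simp: a_def)
  then show ?thesis using True ne by (intro that[of x0]) auto
next
  case False
  have a: "0 < a" using False sum_nonneg[of "vertices K" \<beta>] weight_ge0[OF K w] by (simp add: a_def order_less_le)
  define z where "z = (\<Sum>u\<in>vertices K. (inverse a * \<beta> u) *\<^sub>R u)"
  have w': "weight K (\<lambda>u. inverse a * \<beta> u)" using weight_scale[OF K w] a by simp
  have s1: "(\<Sum>u\<in>vertices K. inverse a * \<beta> u) = 1" using a by (simp add: a_def flip: sum_distrib_left)
  have C: "{u. inverse a * \<beta> u \<noteq> 0} = {u. \<beta> u \<noteq> 0}" using a by auto
  have zC: "z \<in> convex hull {u. \<beta> u \<noteq> 0}" unfolding z_def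
    by (rule weight_point[OF K w' s1]) (use C w in \<open>auto simp: weight_def\<close>)
  moreover have "convex hull {u. \<beta> u \<noteq> 0} \<in> K" using w by (simp add: weight_def vsets_def)
  ultimately have "z \<in> \<Union>K" by blast
  moreover have "bary K z = (\<lambda>u. inverse a * \<beta> u)" by (rule bary_eqI[OF K w' s1]) (simp add: z_def)
  moreover have "a *\<^sub>R z = (\<Sum>u\<in>vertices K. \<beta> u *\<^sub>R u)"
  proof -
    have "a * (inverse a * c) = c" for c using a by simp
    then show ?thesis by (simp only: z_def scaleR_sum_right scaleR_scaleR)
  qed
  ultimately show ?thesis using a zC by (intro that[of z]) (auto simp: fun_eq_iff)
qed

text \<open>The map \<phi> presents the link of the cell as the sphere bounding \<open>D\<close>. In
  \<open>dims\<close>, the cell contributes dimension \<open>card A - 1\<close> and the cone over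
  its link \<open>dim D\<close>, together \<open>d\<close>.\<close>

locale star_chart =
  fixes K :: "'a::euclidean_space set set" and A :: "'a set" and \<phi> :: "'a \<Rightarrow> 'a" and D :: "'a set" and d :: nat
  assumes K: "simplicial_complex K" and A: "A \<in> vsets K" "A \<noteq> {}"
    and radial_link: "radial (\<Union>(link_of (convex hull A) K)) \<phi> D"
    and dims: "dim D + card A = d + 1"
begin

abbreviation "S \<equiv> convex hull A"
abbreviation "cA \<equiv> centroid A"
abbreviation "X1 \<equiv> rel_frontier S"
abbreviation "X2 \<equiv> \<Union>(link_of S K)"
abbreviation "V \<equiv> vertices K"
text \<open>The cone over the boundary of the cell is the cell itself, moved so that its centroid
  becomes the apex 0.\<close>

abbreviation "\<phi>1 \<equiv> \<lambda>z. z - cA"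
abbreviation "D1 \<equiv> (\<lambda>z. z - cA) ` S"

lemma finA: "finite A" by (rule vsets_finite[OF K A(1)])
lemma indA: "\<not> affine_dependent A" using A by (simp add: vsets_def)
lemma SK: "S \<in> K" by (rule hull_vsets_in[OF K A(1)])
lemma cardA: "0 < card A" using finA A(2) by (simp add: card_gt_0_iff)
lemma AV: "A \<subseteq> V" by (rule vsets_vertices[OF K A(1)])
lemma finV: "finite V" by (rule finite_vertices[OF K])

lemma cA_sum: "(\<Sum>u\<in>A. u - cA) = 0"
proof -
  have "(\<Sum>u\<in>A. u - cA) = \<Sum>A - card A *\<^sub>R cA" by (simp add: sum_subtractf sum_constant_scaleR)
  then show ?thesis using centroid_sum[OF finA A(2)] by simp
qed

lemma cA_rel_interior: "cA \<in> rel_interior S"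
proof -
  have "cA = (\<Sum>u\<in>A. (1 / card A) *\<^sub>R u)" by (simp add: centroid_def scaleR_sum_right)
  then show ?thesis unfolding rel_interior_convex_hull_explicit[OF indA]
    using cardA by (auto intro!: exI[of _ "\<lambda>_. 1 / card A"])
qed

lemma cA_S: "cA \<in> S" using cA_rel_interior rel_interior_subset by blast
lemma S_sub: "S \<subseteq> \<Union>K" using SK by blast

lemma D1_eq: "D1 = (+) (- cA) ` S" by (auto simp: image_iff)

lemma X1_iff: "z \<in> X1 \<longleftrightarrow> (\<exists>C. C \<subset> A \<and> z \<in> convex hull C)"
proof -
  have "X1 = \<Union>{F. F face_of S \<and> F \<noteq> S}"
    by (rule rel_frontier_of_polyhedron_alt) (simp add: finA polyhedron_convex_hull)
  moreover have "(F face_of S \<and> F \<noteq> S) \<longleftrightarrow> (\<exists>C. C \<subset> A \<and> F = convex hull C)" for F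
  proof
    assume "F face_of S \<and> F \<noteq> S"
    then show "\<exists>C. C \<subset> A \<and> F = convex hull C" using face_of_convex_hull_affine_independent[OF indA, of F] by blast
  next
    assume "\<exists>C. C \<subset> A \<and> F = convex hull C"
    then obtain C where C: "C \<subset> A" "F = convex hull C" by blast
    have "\<not> affine_dependent C" using indA C affine_dependent_subset by blast
    then have "F \<noteq> S" using convex_hull_inj_affine_independent[of C A] C indA by blast
    then show "F face_of S \<and> F \<noteq> S" using face_of_convex_hull_affine_independent[OF indA, of F] C by blast
  qed
  ultimately have "X1 = \<Union>{F. \<exists>C. C \<subset> A \<and> F = convex hull C}" by simp
  then show ?thesis by blast
qed

lemma X1_K: "X1 \<subseteq> \<Union>K"
proof
  fix z assume "z \<in> X1"
  then obtain C where "C \<subset> A" "z \<in> convex hull C" using X1_iff by blast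
  then show "z \<in> \<Union>K" using hull_vsets_in[OF K vsets_subset[OF K A(1), of C]] by blast
qed

lemma X2_iff: "z \<in> X2 \<longleftrightarrow> (\<exists>B. A \<inter> B = {} \<and> A \<union> B \<in> vsets K \<and> z \<in> convex hull B)"
proof
  assume "z \<in> X2"
  then obtain T R where T: "T \<in> K" "S \<inter> T = {}" "R \<in> K" "S \<subseteq> R" "T \<subseteq> R" "z \<in> T" by (auto simp: link_of_def)
  obtain B where B: "B \<in> vsets K" "T = convex hull B" using simplex_vsets[OF K T(1)] by metis
  obtain C where C: "C \<in> vsets K" "R = convex hull C" using simplex_vsets[OF K T(3)] by metis
  have "A \<subseteq> C" "B \<subseteq> C" using vsets_hull_subset[OF K A(1) C(1)] vsets_hull_subset[OF K B(1) C(1)] T B C by auto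
  then have "A \<union> B \<in> vsets K" by (intro vsets_subset[OF K C(1)]) auto
  moreover have "A \<inter> B = {}" using T(2) B(2) hull_subset[of A convex] hull_subset[of B convex] by blast
  ultimately show "\<exists>B. A \<inter> B = {} \<and> A \<union> B \<in> vsets K \<and> z \<in> convex hull B" using T B by blast
next
  assume "\<exists>B. A \<inter> B = {} \<and> A \<union> B \<in> vsets K \<and> z \<in> convex hull B"
  then obtain B where B: "A \<inter> B = {}" "A \<union> B \<in> vsets K" "z \<in> convex hull B" by blast
  have BK: "B \<in> vsets K" using vsets_subset[OF K B(2)] by blast
  have "S \<inter> convex hull B = {}" using vsets_Int_hull[OF K A(1) BK] B(1) by simp
  moreover have "S \<subseteq> convex hull (A \<union> B)" "convex hull B \<subseteq> convex hull (A \<union> B)" by (simp_all add: hull_mono)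
  ultimately have "convex hull B \<in> link_of S K"
    unfolding link_of_def using hull_vsets_in[OF K BK] hull_vsets_in[OF K B(2)] by blast
  then show "z \<in> X2" using B(3) by blast
qed

lemma X2_K: "X2 \<subseteq> \<Union>K" by (auto simp: link_of_def)

sublocale R2: radial_complex X2 \<phi> D K
  using radial_link K X2_K by (simp add: radial_complex_def radial_complex_axioms_def)

sublocale R1: radial_complex X1 \<phi>1 D1 K
proof -
  have pS: "polytope S" by (simp add: finA polytope_convex_hull)
  have "pwa S (\<lambda>z. z - cA)" by (intro pwa_diff pwa_const[where f="\<lambda>x. x"] pwa_affine pS) auto
  then have "pwa X1 \<phi>1" by (rule pwa_rel_frontier[OF pS])
  moreover have "0 \<in> rel_interior D1"
    unfolding D1_eq rel_interior_translation using cA_rel_interior by auto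
  moreover have "polytope D1" unfolding D1_eq polytope_translation_eq by (rule pS)
  moreover have "bij_betw \<phi>1 X1 (rel_frontier D1)"
  proof -
    have "rel_frontier D1 = (+) (- cA) ` X1"
      unfolding D1_eq rel_frontier_def rel_interior_translation closure_translation by (rule image_set_diff[symmetric]) (simp add: inj_on_def)
    also have "\<dots> = \<phi>1 ` X1" by (auto simp: image_iff)
    finally show ?thesis by (simp add: bij_betw_def inj_on_def)
  qed
  ultimately show "radial_complex X1 \<phi>1 D1 K"
    using K X1_K by (simp add: radial_complex_def radial_complex_axioms_def radial_def)
qed

lemma dim_D1: "dim (span D1) + 1 = card A"
proof -
  have "aff_dim D1 = int (dim D1)" by (rule aff_dim_zero) (use R1.zero_in_D hull_inc in metis)
  moreover have "aff_dim D1 = aff_dim A" unfolding D1_eq aff_dim_translation_eq aff_dim_convex_hull ..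
  moreover have "aff_dim A = int (card A) - 1" using aff_dim_affine_independent[OF indA] by simp
  ultimately show ?thesis by simp
qed

lemma coef_X1: assumes "z \<in> X1" "coef (bary K z) C \<noteq> 0" shows "C \<subset> A" "C \<noteq> {}" "C \<in> vsets K"
proof -
  obtain C' where C': "C' \<subset> A" "z \<in> convex hull C'" using assms X1_iff by blast
  have zK: "z \<in> \<Union>K" using assms X1_K by blast
  have "{u. bary K z u \<noteq> 0} \<subseteq> C'" by (rule bary_support[OF K C'(2)]) (use vsets_subset[OF K A(1)] C' in blast)
  moreover have "C \<subseteq> {u. bary K z u \<noteq> 0}" by (rule chainrep_support[OF chainrep_bary[OF K zK] assms(2)])
  ultimately show "C \<subset> A" using C' by blast
  show "C \<noteq> {}" "C \<in> vsets K" using coef_vsets[OF K zK assms(2)] by auto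
qed

lemma coef_X2: assumes "z \<in> X2" "coef (bary K z) C \<noteq> 0" shows "A \<inter> C = {}" "A \<union> C \<in> vsets K" "C \<noteq> {}"
proof -
  obtain B where B: "A \<inter> B = {}" "A \<union> B \<in> vsets K" "z \<in> convex hull B" using assms X2_iff by blast
  have zK: "z \<in> \<Union>K" using assms X2_K by blast
  have "{u. bary K z u \<noteq> 0} \<subseteq> B" by (rule bary_support[OF K B(3)]) (use vsets_subset[OF K B(2)] in blast)
  moreover have "C \<subseteq> {u. bary K z u \<noteq> 0}" by (rule chainrep_support[OF chainrep_bary[OF K zK] assms(2)])
  ultimately have CB: "C \<subseteq> B" by blast
  then show "A \<inter> C = {}" using B by blast
  show "A \<union> C \<in> vsets K" by (rule vsets_subset[OF K B(2)]) (use CB in blast)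
  show "C \<noteq> {}" using coef_vsets[OF K zK assms(2)] by auto
qed

section \<open>Join coordinates on the star of a cell\<close>

definition star :: "'a set"
  where "star = \<Union>{convex hull C | C. C \<in> vsets K \<and> A \<subseteq> C}"

definition rep :: "'a \<Rightarrow> real \<Rightarrow> 'a \<Rightarrow> 'a \<Rightarrow> bool"
  where "rep x b s z \<longleftrightarrow> s \<in> S \<and> 0 \<le> b \<and> b \<le> 1 \<and> (b = 0 \<or> z \<in> X2) \<and> x = (1 - b) *\<^sub>R s + b *\<^sub>R z"

text \<open>In join coordinates \<open>\<Theta>1\<close> and \<open>\<Theta>2\<close> are
  \<open>(1 - b) *\<^sub>R (s - cA)\<close> and \<open>b *\<^sub>R \<phi> z\<close>, by
  \<open>rep_\<Theta>\<close>. Expressed through barycentric coordinates they involve no choice of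
  \<open>s\<close> and \<open>z\<close>. The division by \<open>b\<close> in
  \<open>\<Theta>2\<close> is harmless at \<open>b = 0\<close> because of the factor
  \<open>b\<close> in front.\<close>

definition \<Theta>1 :: "'a \<Rightarrow> 'a" where "\<Theta>1 x = (\<Sum>u\<in>A. bary K x u *\<^sub>R (u - cA))"
definition \<Theta>2 :: "'a \<Rightarrow> 'a"
  where "\<Theta>2 x = (let b = (\<Sum>u\<in>V - A. bary K x u) in b *\<^sub>R \<phi> ((1 / b) *\<^sub>R (\<Sum>u\<in>V - A. bary K x u *\<^sub>R u)))"
definition \<Theta> :: "'a \<Rightarrow> 'a \<times> 'a" where "\<Theta> x = (\<Theta>1 x, \<Theta>2 x)"

lemma star_K: "star \<subseteq> \<Union>K" unfolding star_def using hull_vsets_in[OF K] by blast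

lemma bary_S: assumes "s \<in> S"
  shows "u \<notin> A \<Longrightarrow> bary K s u = 0" "(\<Sum>u\<in>A. bary K s u) = 1" "(\<Sum>u\<in>A. bary K s u *\<^sub>R u) = s"
proof -
  have sub: "{u. bary K s u \<noteq> 0} \<subseteq> A" by (rule bary_support[OF K assms A(1)])
  then show "u \<notin> A \<Longrightarrow> bary K s u = 0" by blast
  have sK: "s \<in> \<Union>K" using assms S_sub by blast
  show "(\<Sum>u\<in>A. bary K s u) = 1" "(\<Sum>u\<in>A. bary K s u *\<^sub>R u) = s"
    using weight_sum[OF K sub AV] bary(2,3)[OF K sK] by simp_all
qed

lemma rep_bary: assumes "rep x b s z"
  shows "x \<in> star" "u \<in> A \<Longrightarrow> bary K x u = (1 - b) * bary K s u"
    "(\<Sum>u\<in>V - A. bary K x u) = b" "(\<Sum>u\<in>V - A. bary K x u *\<^sub>R u) = b *\<^sub>R z"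
proof -
  have r: "s \<in> S" "0 \<le> b" "b \<le> 1" "b = 0 \<or> z \<in> X2" "x = (1 - b) *\<^sub>R s + b *\<^sub>R z" using assms by (auto simp: rep_def)
  have "x \<in> star \<and> (\<forall>u\<in>A. bary K x u = (1 - b) * bary K s u) \<and> (\<Sum>u\<in>V - A. bary K x u) = b \<and> (\<Sum>u\<in>V - A. bary K x u *\<^sub>R u) = b *\<^sub>R z"
  proof (cases "b = 0")
    case True
    have "x \<in> star" unfolding star_def using r True A by auto
    then show ?thesis using r True bary_S(1)[OF r(1)] by simp
  next
    case False
    then have "z \<in> X2" using r by blast
    then obtain B where B: "A \<inter> B = {}" "A \<union> B \<in> vsets K" "z \<in> convex hull B" using X2_iff by blast
    have BK: "B \<in> vsets K" using vsets_subset[OF K B(2)] by blast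
    have in_R: "s \<in> convex hull (A \<union> B)" "z \<in> convex hull (A \<union> B)"
      using r(1) B(3) hull_mono[of A "A \<union> B" convex] hull_mono[of B "A \<union> B" convex] by auto
    have eq: "bary K x = (\<lambda>u. (1 - b) * bary K s u + b * bary K z u)"
      unfolding r(5) by (rule bary_segment[OF K hull_vsets_in[OF K B(2)] in_R r(2,3)])
    have zB: "{u. bary K z u \<noteq> 0} \<subseteq> B" by (rule bary_support[OF K B(3) BK])
    have zA: "bary K z u = 0" if "u \<in> A" for u using zB B(1) that by blast
    have "x \<in> convex hull (A \<union> B)" unfolding r(5)
      by (rule convexD_alt[OF convex_convex_hull in_R r(2,3)])
    then have 1: "x \<in> star" unfolding star_def using B(2) by blast
    have zV: "{u. bary K z u \<noteq> 0} \<subseteq> V - A" using zB B(1) vsets_vertices[OF K BK] by blast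
    have "(\<Sum>u\<in>V - A. bary K z u) = 1" "(\<Sum>u\<in>V - A. bary K z u *\<^sub>R u) = z"
      using weight_sum[OF K zV Diff_subset] bary(2,3)[OF K, of z] B(3) hull_vsets_in[OF K BK] by auto
    moreover have "bary K x u = b * bary K z u" if "u \<in> V - A" for u using eq bary_S(1)[OF r(1)] that by simp
    ultimately have "(\<Sum>u\<in>V - A. bary K x u) = b" "(\<Sum>u\<in>V - A. bary K x u *\<^sub>R u) = b *\<^sub>R z"
      by (simp_all flip: sum_distrib_left scaleR_sum_right scaleR_scaleR)
    then show ?thesis using 1 eq zA by simp
  qed
  then show "x \<in> star" "u \<in> A \<Longrightarrow> bary K x u = (1 - b) * bary K s u"
    "(\<Sum>u\<in>V - A. bary K x u) = b" "(\<Sum>u\<in>V - A. bary K x u *\<^sub>R u) = b *\<^sub>R z" by auto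
qed

lemma rep_\<Theta>: assumes "rep x b s z" shows "\<Theta>1 x = (1 - b) *\<^sub>R (s - cA)" "\<Theta>2 x = b *\<^sub>R \<phi> z"
proof -
  have s: "s \<in> S" using assms by (simp add: rep_def)
  have "\<Theta>1 x = (\<Sum>u\<in>A. (1 - b) *\<^sub>R (bary K s u *\<^sub>R u - bary K s u *\<^sub>R cA))"
    unfolding \<Theta>1_def by (rule sum.cong) (simp_all add: rep_bary(2)[OF assms] scaleR_diff_right)
  also have "\<dots> = (1 - b) *\<^sub>R (s - cA)"
    using bary_S(2,3)[OF s] by (simp add: sum_subtractf flip: scaleR_sum_right scaleR_left.sum)
  finally show "\<Theta>1 x = (1 - b) *\<^sub>R (s - cA)" .
  show "\<Theta>2 x = b *\<^sub>R \<phi> z" unfolding \<Theta>2_def Let_def rep_bary(3,4)[OF assms] by (cases "b = 0") simp_all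
qed

text \<open>The barycentric coordinates are split into those on \<open>A\<close> and the rest, and
  each part is normalised to a point.\<close>

lemma rep_exists: assumes "x \<in> star" obtains b s z where "rep x b s z"
proof -
  obtain C where C: "C \<in> vsets K" "A \<subseteq> C" "x \<in> convex hull C" using assms by (auto simp: star_def)
  have xK: "x \<in> \<Union>K" using assms star_K by blast
  define \<beta> where "\<beta> = bary K x"
  have w: "weight K \<beta>" "(\<Sum>u\<in>V. \<beta> u) = 1" "(\<Sum>u\<in>V. \<beta> u *\<^sub>R u) = x" using bary[OF K xK] by (simp_all add: \<beta>_def)
  have supp: "{u. \<beta> u \<noteq> 0} \<subseteq> C" unfolding \<beta>_def by (rule bary_support[OF K C(3,1)])
  define \<beta>1 where "\<beta>1 u = (if u \<in> A then \<beta> u else 0)" for u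
  define \<beta>2 where "\<beta>2 u = (if u \<in> A then 0 else \<beta> u)" for u
  have w1: "weight K \<beta>1" by (rule weight_vsetsI[OF K A(1)]) (use weight_ge0[OF K w(1)] in \<open>auto simp: \<beta>1_def\<close>)
  have supp2: "{u. \<beta>2 u \<noteq> 0} \<subseteq> C - A"
  proof
    fix u assume "u \<in> {u. \<beta>2 u \<noteq> 0}"
    then have "u \<notin> A" "\<beta> u \<noteq> 0" by (auto simp: \<beta>2_def split: if_splits)
    then show "u \<in> C - A" using supp by blast
  qed
  have CA: "C - A \<in> vsets K" using vsets_subset[OF K C(1)] by blast
  have w2: "weight K \<beta>2" by (rule weight_vsetsI[OF K CA supp2]) (use weight_ge0[OF K w(1)] in \<open>auto simp: \<beta>2_def\<close>)
  obtain s where s: "s \<in> \<Union>K" "(\<Sum>u\<in>V. \<beta>1 u) *\<^sub>R s = (\<Sum>u\<in>V. \<beta>1 u *\<^sub>R u)"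
      "(\<Sum>u\<in>V. \<beta>1 u) \<noteq> 0 \<Longrightarrow> s \<in> convex hull {u. \<beta>1 u \<noteq> 0}" "0 \<le> (\<Sum>u\<in>V. \<beta>1 u)"
    by (rule weight_normalize[OF K w1 xK]) blast
  obtain z where z: "z \<in> \<Union>K" "(\<Sum>u\<in>V. \<beta>2 u) *\<^sub>R z = (\<Sum>u\<in>V. \<beta>2 u *\<^sub>R u)"
      "(\<Sum>u\<in>V. \<beta>2 u) \<noteq> 0 \<Longrightarrow> z \<in> convex hull {u. \<beta>2 u \<noteq> 0}" "0 \<le> (\<Sum>u\<in>V. \<beta>2 u)"
    by (rule weight_normalize[OF K w2 xK]) blast
  define b where "b = (\<Sum>u\<in>V. \<beta>2 u)"
  have "\<beta>1 u + \<beta>2 u = \<beta> u" for u by (simp add: \<beta>1_def \<beta>2_def)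
  then have "(\<Sum>u\<in>V. \<beta>1 u + \<beta>2 u) = 1" "(\<Sum>u\<in>V. (\<beta>1 u + \<beta>2 u) *\<^sub>R u) = x"
    using w(2,3) by simp_all
  then have a: "(\<Sum>u\<in>V. \<beta>1 u) = 1 - b" and "x = (\<Sum>u\<in>V. \<beta>1 u *\<^sub>R u) + (\<Sum>u\<in>V. \<beta>2 u *\<^sub>R u)"
    by (simp_all add: b_def sum.distrib scaleR_left_distrib)
  then have x: "x = (1 - b) *\<^sub>R s + b *\<^sub>R z" using s(2) z(2) by (simp add: b_def)
  \<comment> \<open>For \<open>b = 1\<close> nothing is left for the cell and \<open>s\<close> is
    only a default from the normalisation; any point of the cell does.\<close>
  define s' where "s' = (if b = 1 then cA else s)"
  have "s' \<in> S"
  proof (cases "b = 1")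
    case True
    then show ?thesis using cA_S by (simp add: s'_def)
  next
    case False
    then have "s \<in> convex hull {u. \<beta>1 u \<noteq> 0}" using s(3) a by simp
    moreover have "{u. \<beta>1 u \<noteq> 0} \<subseteq> A" by (auto simp: \<beta>1_def)
    ultimately show ?thesis using hull_mono[of "{u. \<beta>1 u \<noteq> 0}" A convex] False by (auto simp: s'_def)
  qed
  moreover have "b = 0 \<or> z \<in> X2"
  proof (cases "b = 0")
    case False
    then have "z \<in> convex hull (C - A)" using z(3) supp2 hull_mono[of "{u. \<beta>2 u \<noteq> 0}" "C - A" convex] by (auto simp: b_def)
    moreover have "A \<union> (C - A) \<in> vsets K" using C(1,2) by (simp add: Un_absorb1)
    ultimately show ?thesis using X2_iff by blast
  qed simp
  moreover have "x = (1 - b) *\<^sub>R s' + b *\<^sub>R z" using x by (auto simp: s'_def)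
  moreover have "0 \<le> b" "b \<le> 1" using z(4) s(4) a by (auto simp: b_def)
  ultimately show ?thesis using that[of b s' z] by (auto simp: rep_def)
qed

text \<open>If \<open>b\<close> is nonzero, \<open>b\<close> and \<open>z\<close> come back from the
  ray through \<open>\<phi> z\<close>. At \<open>b = 0\<close> or \<open>b = 1\<close> one of the
  points is undetermined, but only \<open>b *\<^sub>R z\<close> and
  \<open>(1 - b) *\<^sub>R s\<close> matter.\<close>

lemma \<Theta>_inj: "inj_on \<Theta> star"
proof (rule inj_onI)
  fix x y assume "x \<in> star" "y \<in> star" and eq: "\<Theta> x = \<Theta> y"
  obtain b s z where x: "rep x b s z" using rep_exists \<open>x \<in> star\<close> by metis
  obtain b' s' z' where y: "rep y b' s' z'" using rep_exists \<open>y \<in> star\<close> by metis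
  have e1: "(1 - b) *\<^sub>R (s - cA) = (1 - b') *\<^sub>R (s' - cA)" and e2: "b *\<^sub>R \<phi> z = b' *\<^sub>R \<phi> z'"
    using eq rep_\<Theta>[OF x] rep_\<Theta>[OF y] by (auto simp: \<Theta>_def)
  have bz: "b = b' \<and> b *\<^sub>R z = b' *\<^sub>R z'"
  proof (cases "b = 0 \<or> b' = 0")
    case True
    have "b *\<^sub>R \<phi> z = 0 \<Longrightarrow> b = 0" "b' *\<^sub>R \<phi> z' = 0 \<Longrightarrow> b' = 0"
      using R2.\<phi>_nonzero x y by (auto simp: rep_def)
    then have "b = 0" "b' = 0" using True e2 by auto
    then show ?thesis by simp
  next
    case False
    then have "z \<in> X2" "z' \<in> X2" "0 < b" "0 < b'" using x y by (auto simp: rep_def)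
    then show ?thesis using R2.ray_unique[of z z' b b'] e2 by simp
  qed
  have s: "(1 - b) *\<^sub>R s = (1 - b') *\<^sub>R s'" using e1 bz by (simp add: scaleR_diff_right)
  have "x = (1 - b) *\<^sub>R s + b *\<^sub>R z" "y = (1 - b') *\<^sub>R s' + b' *\<^sub>R z'" using x y by (auto simp: rep_def)
  then show "x = y" by (simp only: s conjunct2[OF bz])
qed

lemma \<Theta>_range: assumes "x \<in> star" shows "\<Theta> x \<in> D1 \<times> D"
proof -
  obtain b s z where x: "rep x b s z" using rep_exists assms by metis
  have "(1 - b) *\<^sub>R (s - cA) \<in> D1"
    using convexD_alt[OF R1.convex_D R1.zero_in_D, of "s - cA" "1 - b"] x by (auto simp: rep_def)
  moreover have "b *\<^sub>R \<phi> z \<in> D"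
    using x R2.in_D_iff[of z b] R2.zero_in_D by (cases "b = 0") (auto simp: rep_def)
  ultimately show ?thesis using rep_\<Theta>[OF x] by (simp add: \<Theta>_def)
qed

text \<open>The image is in general not all of \<open>D1 \<times> D\<close>, since the shares
  \<open>b\<close> and \<open>1 - b\<close> compete. Halving both factors leaves room: then
  \<open>b \<le> 1 / 2\<close>, and \<open>y1\<close> divided by \<open>1 - b\<close> still lies in
  \<open>D1\<close>.\<close>

lemma \<Theta>_onto: assumes "2 *\<^sub>R y1 \<in> D1" "2 *\<^sub>R y2 \<in> D" shows "(y1, y2) \<in> \<Theta> ` star"
proof -
  obtain b z where b: "0 \<le> b" "b \<le> 1 / 2" "b = 0 \<or> z \<in> X2" "y2 = b *\<^sub>R \<phi> z"
  proof (cases "y2 = 0")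
    case True
    then show ?thesis using that[of 0] by simp
  next
    case False
    have "y2 = (1/2) *\<^sub>R (2 *\<^sub>R y2)" by simp
    then have "y2 \<in> span D" using assms(2) by (metis span_base span_scale)
    then obtain t z where t: "0 < t" "z \<in> X2" "y2 = t *\<^sub>R \<phi> z" using R2.ray_exists False by metis
    then have "2 * t \<le> 1" using R2.in_D_iff[of z "2 * t"] assms(2) by simp
    then show ?thesis using that[of t z] t by simp
  qed
  define c where "c = 1 / (2 * (1 - b))"
  have c: "0 \<le> c" "c \<le> 1" "(1 - b) * c = 1 / 2" using b by (auto simp: c_def field_simps)
  have "c *\<^sub>R (2 *\<^sub>R y1) \<in> D1" using convexD_alt[OF R1.convex_D R1.zero_in_D assms(1) c(1,2)] by simp
  then obtain s where s: "s \<in> S" "s - cA = c *\<^sub>R (2 *\<^sub>R y1)" by auto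
  have "(1 - b) *\<^sub>R (s - cA) = ((1 - b) * c * 2) *\<^sub>R y1" using s(2) by simp
  then have y1: "(1 - b) *\<^sub>R (s - cA) = y1" using c(3) by simp
  have r: "rep ((1 - b) *\<^sub>R s + b *\<^sub>R z) b s z" using s(1) b(1-3) by (auto simp: rep_def)
  have "(y1, y2) = \<Theta> ((1 - b) *\<^sub>R s + b *\<^sub>R z)" using rep_\<Theta>[OF r] y1 b(4) by (simp add: \<Theta>_def)
  then show ?thesis using rep_bary(1)[OF r] by (rule image_eqI)
qed

text \<open>The pieces are the joins of the cell with pieces of the link on which \<phi> is affine,
  together with the cell alone in case the link is empty. In a join, the parts in the cell and in
  the link are combined separately, each by \<open>cone_combine_ex\<close>, which gives
  affinity.\<close>

lemma \<Theta>_pwa: "pwa star \<Theta>"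
proof -
  obtain \<P> where P: "finite \<P>" "\<Union>\<P> = X2" "\<And>P. P \<in> \<P> \<Longrightarrow> polytope P" "\<And>P. P \<in> \<P> \<Longrightarrow> affine_on P \<phi>"
    using R2.pwa_\<phi> by (rule pwaE) blast
  define J where "J P = convex hull (S \<union> P)" for P
  have pS: "polytope S" by (simp add: finA polytope_convex_hull)
  have Sne: "S \<noteq> {}" using cA_S by blast
  have J: "x \<in> J P \<longleftrightarrow> (\<exists>b s z. s \<in> S \<and> 0 \<le> b \<and> b \<le> 1 \<and> z \<in> P \<and> x = (1 - b) *\<^sub>R s + b *\<^sub>R z)" if "P \<in> \<P>" "P \<noteq> {}" for P x
  proof -
    have "J P = {u *\<^sub>R s + v *\<^sub>R t | u v s t. u \<ge> 0 \<and> v \<ge> 0 \<and> u + v = 1 \<and> s \<in> S \<and> t \<in> P}"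
      unfolding J_def by (rule convex_hull_union_two) (use Sne that polytope_imp_convex[OF P(3)] in auto)
    then have "x \<in> J P \<longleftrightarrow> (\<exists>u v s t. u \<ge> 0 \<and> v \<ge> 0 \<and> u + v = 1 \<and> s \<in> S \<and> t \<in> P \<and> x = u *\<^sub>R s + v *\<^sub>R t)" by blast
    also have "\<dots> \<longleftrightarrow> (\<exists>b s z. s \<in> S \<and> 0 \<le> b \<and> b \<le> 1 \<and> z \<in> P \<and> x = (1 - b) *\<^sub>R s + b *\<^sub>R z)"
    proof
      assume "\<exists>u v s t. u \<ge> 0 \<and> v \<ge> 0 \<and> u + v = 1 \<and> s \<in> S \<and> t \<in> P \<and> x = u *\<^sub>R s + v *\<^sub>R t"
      then obtain u v s t where "u \<ge> 0" "v \<ge> 0" "u + v = 1" "s \<in> S" "t \<in> P" "x = u *\<^sub>R s + v *\<^sub>R t" by blast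
      moreover then have "u = 1 - v" by simp
      ultimately show "\<exists>b s z. s \<in> S \<and> 0 \<le> b \<and> b \<le> 1 \<and> z \<in> P \<and> x = (1 - b) *\<^sub>R s + b *\<^sub>R z" by (intro exI[of _ v] exI[of _ s] exI[of _ t]) auto
    next
      assume "\<exists>b s z. s \<in> S \<and> 0 \<le> b \<and> b \<le> 1 \<and> z \<in> P \<and> x = (1 - b) *\<^sub>R s + b *\<^sub>R z"
      then obtain b s z where "s \<in> S" "0 \<le> b" "b \<le> 1" "z \<in> P" "x = (1 - b) *\<^sub>R s + b *\<^sub>R z" by blast
      then show "\<exists>u v s t. u \<ge> 0 \<and> v \<ge> 0 \<and> u + v = 1 \<and> s \<in> S \<and> t \<in> P \<and> x = u *\<^sub>R s + v *\<^sub>R t"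
        by (intro exI[of _ "1 - b"] exI[of _ b] exI[of _ s] exI[of _ z]) auto
    qed
    finally show ?thesis .
  qed
  define \<P>' where "\<P>' = {P \<in> \<P>. P \<noteq> {}}"
  show ?thesis
  proof (rule pwaI[of "insert S (J ` \<P>')"])
    show "finite (insert S (J ` \<P>'))" using P(1) by (simp add: \<P>'_def)
    show "\<Union>(insert S (J ` \<P>')) = star"
    proof
      have "J P \<subseteq> star" if P': "P \<in> \<P>'" for P
      proof
        fix x assume "x \<in> J P"
        then obtain b s z where "s \<in> S" "0 \<le> b" "b \<le> 1" "z \<in> P" "x = (1 - b) *\<^sub>R s + b *\<^sub>R z"
          using J[of P x] P' by (auto simp: \<P>'_def)
        moreover have "P \<subseteq> X2" using P' P(2) by (auto simp: \<P>'_def)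
        ultimately have "rep x b s z" by (auto simp: rep_def)
        then show "x \<in> star" by (rule rep_bary(1))
      qed
      moreover have "S \<subseteq> star" unfolding star_def using A(1) by blast
      ultimately show "\<Union>(insert S (J ` \<P>')) \<subseteq> star" by blast
      show "star \<subseteq> \<Union>(insert S (J ` \<P>'))"
      proof
        fix x assume "x \<in> star"
        then obtain b s z where r: "rep x b s z" using rep_exists by metis
        show "x \<in> \<Union>(insert S (J ` \<P>'))"
        proof (cases "b = 0")
          case True
          then show ?thesis using r by (auto simp: rep_def)
        next
          case False
          then have "z \<in> X2" using r by (auto simp: rep_def)
          then obtain Q where Q: "Q \<in> \<P>" "z \<in> Q" using P(2) by blast
          then have "x \<in> J Q" using J[of Q x] r by (auto simp: rep_def)
          moreover have "Q \<in> \<P>'" using Q by (auto simp: \<P>'_def)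
          ultimately show ?thesis by blast
        qed
      qed
    qed
    show "polytope R" if "R \<in> insert S (J ` \<P>')" for R
    proof -
      have "polytope (J P)" if "P \<in> \<P>'" for P
      proof -
        have "polytope P" using P(3) that by (simp add: \<P>'_def)
        then obtain W where W: "finite W" "P = convex hull W" by (auto simp: polytope_def)
        have "J P = convex hull (A \<union> W)" unfolding J_def W(2)
          using hull_Un_left[of convex A W] hull_Un_right[of convex S W] by simp
        then show ?thesis using W(1) finA by (simp add: polytope_convex_hull)
      qed
      then show ?thesis using that pS by blast
    qed
    have affP: "affine_on (J P) \<Theta>" if P': "P \<in> \<P>'" for P
      unfolding affine_on_def
    proof clarify
      fix x y and u :: real assume "x \<in> J P" "y \<in> J P" and u: "u \<in> {0..1}"
      have Pin: "P \<in> \<P>" "P \<noteq> {}" "P \<subseteq> X2" using P' P(2) by (auto simp: \<P>'_def)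
      obtain b s z where x: "s \<in> S" "0 \<le> b" "b \<le> 1" "z \<in> P" "x = (1 - b) *\<^sub>R s + b *\<^sub>R z"
        using J[OF Pin(1,2)] \<open>x \<in> J P\<close> by blast
      obtain b' s' z' where y: "s' \<in> S" "0 \<le> b'" "b' \<le> 1" "z' \<in> P" "y = (1 - b') *\<^sub>R s' + b' *\<^sub>R z'"
        using J[OF Pin(1,2)] \<open>y \<in> J P\<close> by blast
      have rx: "rep x b s z" and ry: "rep y b' s' z'" using x y Pin by (auto simp: rep_def)
      let ?a = "(1 - u) * (1 - b)" and ?a' = "u * (1 - b')" and ?b = "(1 - u) * b" and ?b' = "u * b'"
      have nn: "0 \<le> ?a" "0 \<le> ?a'" "0 \<le> ?b" "0 \<le> ?b'" using u x y by auto
      obtain p where p: "p \<in> S" "?a *\<^sub>R s + ?a' *\<^sub>R s' = (?a + ?a') *\<^sub>R p"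
        using cone_combine_ex[OF affine_on_id convex_convex_hull x(1) y(1) nn(1,2)] by metis
      obtain q where q: "q \<in> P" "?b *\<^sub>R z + ?b' *\<^sub>R z' = (?b + ?b') *\<^sub>R q" "(?b + ?b') *\<^sub>R \<phi> q = ?b *\<^sub>R \<phi> z + ?b' *\<^sub>R \<phi> z'"
        using cone_combine_ex[OF P(4)[OF Pin(1)] polytope_imp_convex[OF P(3)[OF Pin(1)]] x(4) y(4) nn(3,4)] by metis
      have sum1: "?a + ?a' = 1 - (?b + ?b')" by (simp add: algebra_simps)
      have "(1 - u) *\<^sub>R x + u *\<^sub>R y = (?a *\<^sub>R s + ?a' *\<^sub>R s') + (?b *\<^sub>R z + ?b' *\<^sub>R z')"
        unfolding x(5) y(5) by (simp add: scaleR_right_distrib)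
      also have "\<dots> = (1 - (?b + ?b')) *\<^sub>R p + (?b + ?b') *\<^sub>R q" using p q sum1 by simp
      finally have "rep ((1 - u) *\<^sub>R x + u *\<^sub>R y) (?b + ?b') p q"
        using p q(1) Pin(3) nn sum1 unfolding rep_def by auto
      note t = rep_\<Theta>[OF this]
      have "\<Theta>1 ((1 - u) *\<^sub>R x + u *\<^sub>R y) = (?a + ?a') *\<^sub>R p - (?a + ?a') *\<^sub>R cA"
        unfolding t(1) sum1 by (simp add: scaleR_diff_right)
      also have "\<dots> = ?a *\<^sub>R (s - cA) + ?a' *\<^sub>R (s' - cA)" unfolding p(2)[symmetric] by (simp add: algebra_simps)
      also have "\<dots> = (1 - u) *\<^sub>R \<Theta>1 x + u *\<^sub>R \<Theta>1 y" using rep_\<Theta>(1)[OF rx] rep_\<Theta>(1)[OF ry] by simp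
      finally have "\<Theta>1 ((1 - u) *\<^sub>R x + u *\<^sub>R y) = (1 - u) *\<^sub>R \<Theta>1 x + u *\<^sub>R \<Theta>1 y" .
      moreover have "\<Theta>2 ((1 - u) *\<^sub>R x + u *\<^sub>R y) = (1 - u) *\<^sub>R \<Theta>2 x + u *\<^sub>R \<Theta>2 y"
        unfolding t(2) q(3) using rep_\<Theta>(2)[OF rx] rep_\<Theta>(2)[OF ry] by simp
      ultimately show "\<Theta> ((1 - u) *\<^sub>R x + u *\<^sub>R y) = (1 - u) *\<^sub>R \<Theta> x + u *\<^sub>R \<Theta> y" by (simp add: \<Theta>_def)
    qed
    have "affine_on S (\<lambda>x. (x - cA, 0::'a))"
      by (intro affine_on_Pair affine_on_diff affine_on_id affine_on_const)
    then have affS: "affine_on S \<Theta>"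
    proof (rule affine_on_cong)
      fix x assume "x \<in> S"
      then have "rep x 0 x undefined" by (simp add: rep_def)
      from rep_\<Theta>[OF this] show "(x - cA, 0) = \<Theta> x" by (simp add: \<Theta>_def)
    qed simp
    show "affine_on R \<Theta>" if "R \<in> insert S (J ` \<P>')" for R using that affS affP by blast
  qed
qed

lemma \<Theta>_cA: "\<Theta> cA = 0"
proof -
  have "rep cA 0 cA undefined" using cA_S by (simp add: rep_def)
  from rep_\<Theta>[OF this] show ?thesis by (simp add: \<Theta>_def zero_prod_def)
qed

end

section \<open>Adapted orthonormal bases\<close>

lemma orthonormal_enumeration:
  fixes E :: "'a::euclidean_space set"
  assumes "subspace E" "dim E = n"
  obtains b where "span (b ` {..<n}) = E" "\<And>i j. i < n \<Longrightarrow> j < n \<Longrightarrow> b i \<bullet> b j = (if i = j then 1 else 0)"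
proof -
  obtain B where B: "B \<subseteq> E" "pairwise orthogonal B" "\<And>x. x \<in> B \<Longrightarrow> norm x = 1" "independent B" "card B = dim E" "span B = E"
    using orthonormal_basis_subspace[OF assms(1)] by metis
  have "finite B" using B(4) by (rule independent_imp_finite)
  then obtain b where b: "bij_betw b {0..<card B} B" using ex_bij_betw_nat_finite by blast
  then have im: "b ` {..<n} = B" and inj: "inj_on b {..<n}" using B(5) assms(2) by (auto simp: bij_betw_def lessThan_atLeast0)
  show ?thesis
  proof (rule that)
    show "span (b ` {..<n}) = E" using im B(6) by simp
    fix i j assume ij: "i < n" "j < n"
    then have bB: "b i \<in> B" "b j \<in> B" using im by auto
    show "b i \<bullet> b j = (if i = j then 1 else 0)"
    proof (cases "i = j")
      case True
      then show ?thesis using B(3)[OF bB(1)] by (simp add: dot_square_norm)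
    next
      case False
      then have "b i \<noteq> b j" using inj ij by (auto simp: inj_on_def)
      then have "orthogonal (b i) (b j)" using B(2) bB by (auto simp: pairwise_def)
      then show ?thesis using False by (simp add: orthogonal_def)
    qed
  qed
qed

text \<open>An orthonormal basis of the complement of \<open>u\<close>, followed by
  \<open>u\<close>: strong regularity refers to the last coordinate. That the complement has
  dimension \<open>n - 1\<close> falls out of counting the resulting basis.\<close>

lemma orthonormal_enumeration_last:
  fixes E :: "'a::euclidean_space set"
  assumes E: "subspace E" "dim E = n" and u: "u \<in> E" "norm u = 1"
  obtains b where "span (b ` {..<n}) = E" "\<And>i j. i < n \<Longrightarrow> j < n \<Longrightarrow> b i \<bullet> b j = (if i = j then 1 else 0)"
    "0 < n" "b (n - 1) = u"
proof -
  define E' where "E' = {y \<in> E. u \<bullet> y = 0}"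
  have uu: "u \<bullet> u = 1" using u(2) by (simp add: dot_square_norm)
  have sE': "subspace E'" using E(1) by (auto simp: E'_def subspace_def inner_add_right)
  define m where "m = dim E'"
  obtain b where b: "span (b ` {..<m}) = E'" "\<And>i j. i < m \<Longrightarrow> j < m \<Longrightarrow> b i \<bullet> b j = (if i = j then 1 else 0)"
    using orthonormal_enumeration[OF sE', of m] m_def by metis
  define b' where "b' i = (if i = m then u else b i)" for i
  have bE': "b i \<in> E'" if "i < m" for i using that b(1) span_base[of "b i" "b ` {..<m}"] by auto
  have on: "b' i \<bullet> b' j = (if i = j then 1 else 0)" if "i < Suc m" "j < Suc m" for i j
    using that b(2) bE' uu by (auto simp: b'_def E'_def less_Suc_eq inner_commute)
  have im: "b' ` {..<Suc m} = insert u (b ` {..<m})" by (auto simp: b'_def lessThan_Suc)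
  have sp: "span (b' ` {..<Suc m}) = E"
  proof
    show "span (b' ` {..<Suc m}) \<subseteq> E" unfolding im by (rule span_minimal) (use bE' u E in \<open>auto simp: E'_def\<close>)
    show "E \<subseteq> span (b' ` {..<Suc m})"
    proof
      fix y assume y: "y \<in> E"
      have "y - (u \<bullet> y) *\<^sub>R u \<in> E'" using y u E uu by (auto simp: E'_def inner_diff_right subspace_diff subspace_scale)
      then have "y - (u \<bullet> y) *\<^sub>R u \<in> span (insert u (b ` {..<m}))" using b(1) span_mono[of "b ` {..<m}" "insert u (b ` {..<m})"] by auto
      moreover have "(u \<bullet> y) *\<^sub>R u \<in> span (insert u (b ` {..<m}))" by (intro span_scale span_base) simp
      ultimately have "(y - (u \<bullet> y) *\<^sub>R u) + (u \<bullet> y) *\<^sub>R u \<in> span (insert u (b ` {..<m}))" by (rule span_add)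
      then show "y \<in> span (b' ` {..<Suc m})" unfolding im by simp
    qed
  qed
  have inj: "inj_on b' {..<Suc m}"
  proof (rule inj_onI)
    fix i j assume "i \<in> {..<Suc m}" "j \<in> {..<Suc m}" "b' i = b' j"
    then show "i = j" using on[of i j] on[of j j] by (auto split: if_splits)
  qed
  have "independent (b' ` {..<Suc m})"
  proof (rule pairwise_orthogonal_independent)
    show "pairwise orthogonal (b' ` {..<Suc m})" unfolding pairwise_def orthogonal_def
    proof clarify
      fix i j assume "i < Suc m" "j < Suc m" "b' i \<noteq> b' j"
      then show "b' i \<bullet> b' j = 0" using on[of i j] by (cases "i = j") auto
    qed
    show "0 \<notin> b' ` {..<Suc m}"
    proof
      assume "0 \<in> b' ` {..<Suc m}"
      then obtain i where "i < Suc m" "b' i = 0" by auto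
      then show False using on[of i i] by simp
    qed
  qed
  then have "dim E = card (b' ` {..<Suc m})" using sp by (metis dim_span dim_eq_card_independent)
  then have "n = Suc m" using inj E(2) by (simp add: card_image)
  then show ?thesis using that[of b'] sp on by (simp add: b'_def)
qed

lemma openin_positive:
  assumes "finite A" "\<And>u. u \<in> A \<Longrightarrow> continuous_on M (F u :: _ \<Rightarrow> real)"
  shows "openin (top_of_set M) {x \<in> M. \<forall>u\<in>A. 0 < F u x}"
proof (cases "A = {}")
  case False
  have "openin (top_of_set M) (\<Inter>u\<in>A. M \<inter> F u -` {0<..})"
    by (rule openin_INT2[OF assms(1) False]) (intro continuous_openin_preimage_gen assms(2), auto)
  moreover have "(\<Inter>u\<in>A. M \<inter> F u -` {0<..}) = {x \<in> M. \<forall>u\<in>A. 0 < F u x}" using False by auto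
  ultimately show ?thesis by simp
qed simp

section \<open>Charts at the barycentre and the splitting of the function\<close>

context star_chart
begin

abbreviation "M \<equiv> \<Union>K"
abbreviation "E \<equiv> span D1 \<times> span D"

lemma subspace_E: "subspace E" by (simp add: subspace_Times)

lemma dim_E: "dim E = d"
proof -
  have "dim E = dim (span D1) + dim (span D)" by (rule dim_Times) auto
  then show ?thesis using dim_D1 dims by (simp add: dim_span)
qed

lemma cA_M: "cA \<in> M" using cA_S S_sub by blast

lemma bary_cA: "bary K cA u = (if u \<in> A then 1 / card A else 0)"
proof -
  have s: "{u. (if u \<in> A then 1 / card A else 0) \<noteq> (0::real)} \<subseteq> A" by auto
  have "bary K cA = (\<lambda>u. if u \<in> A then 1 / card A else 0)"
  proof (rule bary_eqI[OF K])
    show "weight K (\<lambda>u. if u \<in> A then 1 / card A else 0)" by (rule weight_vsetsI[OF K A(1) s]) auto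
    show "(\<Sum>u\<in>V. if u \<in> A then 1 / card A else 0) = (1::real)" using weight_sum(1)[OF K s AV] cardA by simp
    show "(\<Sum>u\<in>V. (if u \<in> A then 1 / card A else 0) *\<^sub>R u) = cA"
      using weight_sum(2)[OF K s AV] by (simp add: centroid_def scaleR_sum_right)
  qed
  then show ?thesis by simp
qed

lemma continuous_bary: "continuous_on M (\<lambda>x. bary K x u)"
  by (rule pwa_continuous[OF pwa_bary[OF K]])

lemma in_star: assumes "x \<in> M" "\<And>u. u \<in> A \<Longrightarrow> 0 < bary K x u" shows "x \<in> star"
proof -
  have C: "{u. bary K x u \<noteq> 0} \<in> vsets K" using bary(1)[OF K assms(1)] by (simp add: weight_def)
  have "x \<in> convex hull {u. bary K x u \<noteq> 0}" by (rule bary_support_hull[OF K assms(1) order_refl C])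
  moreover have "A \<subseteq> {u. bary K x u \<noteq> 0}" using assms(2) by force
  ultimately show ?thesis unfolding star_def using C by blast
qed

text \<open>A small ball around 0 in \<open>E\<close> lies in the image of the star under
  \<open>\<Theta>\<close>. Invariance of domain makes the image of this ball under \<rho> open in
  \<open>E\<close>, so surjectivity of \<rho> never has to be shown.\<close>

lemma chart_at_centroid:
  fixes \<rho> :: "'a \<times> 'a \<Rightarrow> 'a \<times> 'a"
  assumes \<rho>: "inj_on \<rho> E" "\<rho> ` E \<subseteq> E" "pwa (D1 \<times> D) \<rho>" "\<rho> 0 = 0"
    and b: "span (b ` {..<d}) = E" "\<And>i j. i < d \<Longrightarrow> j < d \<Longrightarrow> b i \<bullet> b j = (if i = j then 1 else 0)"
    and N: "openin (top_of_set M) N" "cA \<in> N"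
  obtains U where "U \<subseteq> N" "pl_chart d M cA U (\<lambda>x i. if i < d then \<rho> (\<Theta> x) \<bullet> b i else 0)"
proof -
  obtain r1 where r1: "0 < r1" "\<And>x. x \<in> span D1 \<Longrightarrow> norm x < r1 \<Longrightarrow> x \<in> D1"
    using zero_rel_interior_ball[OF R1.zero_D] by blast
  obtain r2 where r2: "0 < r2" "\<And>x. x \<in> span D \<Longrightarrow> norm x < r2 \<Longrightarrow> x \<in> D"
    using zero_rel_interior_ball[OF R2.zero_D] by blast
  \<comment> \<open>Points of norm below \<open>r\<close> may be doubled in each factor without
    leaving \<open>D1\<close> and \<open>D\<close>, as \<open>\<Theta>_onto\<close>
    requires.\<close>
  define r where "r = min r1 r2 / 2"
  have r: "0 < r" "2 * r \<le> r1" "2 * r \<le> r2" using r1 r2 by (auto simp: r_def)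
  define Y0 where "Y0 = E \<inter> ball 0 r"
  have Y0: "2 *\<^sub>R y1 \<in> D1 \<and> 2 *\<^sub>R y2 \<in> D" if "(y1, y2) \<in> Y0" for y1 y2
  proof -
    have "norm y1 < r" "norm y2 < r" "y1 \<in> span D1" "y2 \<in> span D"
      using that norm_fst_le[of y1 y2] norm_snd_le[of y2 y1] by (auto simp: Y0_def)
    then show ?thesis using r by (auto intro!: r1(2) r2(2) span_scale)
  qed
  have Y0\<Theta>: "Y0 \<subseteq> \<Theta> ` star" using Y0 \<Theta>_onto by (metis subrelI)
  have Y0D: "Y0 \<subseteq> D1 \<times> D" using Y0\<Theta> \<Theta>_range by blast
  have oY: "openin (top_of_set E) (\<rho> ` Y0)"
  proof (rule invariance_of_domain_subspaces[OF _ subspace_E subspace_E order_refl])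
    show "openin (top_of_set E) Y0" unfolding Y0_def by (intro openin_open_Int) simp
    show "continuous_on Y0 \<rho>" by (rule continuous_on_subset[OF pwa_continuous[OF \<rho>(3)] Y0D])
    show "\<rho> \<in> Y0 \<rightarrow> E" using \<rho>(2) by (auto simp: Y0_def)
    show "inj_on \<rho> Y0" by (rule inj_on_subset[OF \<rho>(1)]) (auto simp: Y0_def)
  qed
  define W where "W = N \<inter> {x \<in> M. \<forall>u\<in>A. 0 < bary K x u}"
  have oW: "openin (top_of_set M) W" unfolding W_def
    by (intro openin_Int N(1) openin_positive finA continuous_bary)
  have DE: "D1 \<times> D \<subseteq> E" by (intro Sigma_mono span_superset)
  have \<Theta>E: "\<Theta> x \<in> E" if "x \<in> star" for x by (rule subsetD[OF DE \<Theta>_range[OF that]])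
  obtain U where U: "U \<subseteq> W" "pl_chart d M cA U (\<lambda>x i. if i < d then \<rho> (\<Theta> x) \<bullet> b i else 0)"
  proof (rule pl_chart_exists[of star "\<lambda>x. \<rho> (\<Theta> x)" M cA E W "\<rho> ` Y0" b d])
    show "pwa star (\<lambda>x. \<rho> (\<Theta> x))"
      by (rule pwa_compose[OF \<Theta>_pwa \<rho>(3)]) (rule image_subsetI, rule \<Theta>_range)
    show "inj_on (\<lambda>x. \<rho> (\<Theta> x)) star"
    proof (rule inj_onI)
      fix x y assume "x \<in> star" "y \<in> star" "\<rho> (\<Theta> x) = \<rho> (\<Theta> y)"
      then have "\<Theta> x = \<Theta> y" using inj_onD[OF \<rho>(1), of "\<Theta> x" "\<Theta> y"] \<Theta>E by blast
      then show "x = y" using inj_onD[OF \<Theta>_inj] \<open>x \<in> star\<close> \<open>y \<in> star\<close> by blast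
    qed
    show "(\<lambda>x. \<rho> (\<Theta> x)) ` star \<subseteq> E" using \<rho>(2) \<Theta>E by blast
    show "cA \<in> W" using N cA_M bary_cA cardA by (simp add: W_def)
    show "W \<subseteq> star" using in_star by (auto simp: W_def)
    show "0 \<in> \<rho> ` Y0" using \<rho>(4) r by (intro image_eqI[of _ _ 0]) (auto simp: Y0_def zero_prod_def span_zero)
    show "\<rho> ` Y0 \<subseteq> (\<lambda>x. \<rho> (\<Theta> x)) ` star" using Y0\<Theta> by auto
  qed (use \<rho>(4) \<Theta>_cA star_K oW oY b in auto)
  then show ?thesis using that[of U] by (auto simp: W_def)
qed

text \<open>Comparison with the sum of the outer coordinates gives at once the bound
  \<open>t \<le> m\<close> on the total height of the layers above \<open>A\<close> in
  \<open>core_decomposition\<close>.\<close>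

definition core :: "'a set"
  where "core = {x \<in> M. \<forall>u\<in>A. 0 < bary K x u - (\<Sum>w\<in>V - A. bary K x w)}"

lemma core_open: "openin (top_of_set M) core"
  unfolding core_def by (intro openin_positive finA continuous_intros continuous_bary)

lemma cA_core: "cA \<in> core"
proof -
  have "(\<Sum>w\<in>V - A. bary K cA w) = 0" by (rule sum.neutral) (simp add: bary_cA)
  then show ?thesis using cA_M cardA by (simp add: core_def bary_cA)
qed

text \<open>A layer of height \<open>c\<close> on a set \<open>B\<close> in the link becomes a layer
  of height \<open>c\<close> on \<open>A \<union> B\<close>. It then carries mass
  \<open>c * card (A \<union> B)\<close> instead of \<open>c * card B\<close>, and the quotient
  corrects for this.\<close>

definition upper :: "('a set \<Rightarrow> real) \<Rightarrow> 'a set \<Rightarrow> real"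
  where "upper h B = card (A \<union> B) / card B * (h (A \<union> B) - h A)"

text \<open>In the barycentric coordinates \<open>\<beta>\<close> of a point near the barycentre of \<open>A\<close>, the values on \<open>A\<close> all
  exceed the others, so the flag of superlevel sets of \<open>\<beta>\<close> contains \<open>A\<close>; the sets below \<open>A\<close> depend only
  on the restriction to \<open>A\<close>, and those above only on the restriction to the complement.\<close>

lemma core_decomposition:
  assumes x: "x \<in> core"
  shows "flag_sum h (bary K x) = h A + R1.cone_sum (\<lambda>C. h C - h A) (\<Theta>1 x) + R2.cone_sum (upper h) (\<Theta>2 x)"
proof -
  define \<beta> where "\<beta> = bary K x"
  have xM: "x \<in> M" using x by (simp add: core_def)
  have w: "weight K \<beta>" "(\<Sum>u\<in>V. \<beta> u) = 1" "(\<Sum>u\<in>V. \<beta> u *\<^sub>R u) = x" using bary[OF K xM] by (simp_all add: \<beta>_def)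
  have b0: "0 \<le> \<beta> u" for u using weight_ge0[OF K w(1)] .
  have low: "(\<Sum>w\<in>V - A. \<beta> w) < \<beta> u" if "u \<in> A" for u using x that by (auto simp: core_def \<beta>_def)
  define m where "m = Min (\<beta> ` A)"
  have "m \<in> \<beta> ` A" unfolding m_def by (rule Min_in) (use finA A in auto)
  then obtain w0 where w0: "w0 \<in> A" "\<beta> w0 = m" by auto
  have mle: "m \<le> \<beta> u" if "u \<in> A" for u unfolding m_def using that finA by simp
  define C where "C = {u. \<beta> u \<noteq> 0}"
  have C: "C \<in> vsets K" using w(1) by (simp add: C_def weight_def)
  have lowpos: "0 \<le> (\<Sum>w\<in>V - A. \<beta> w)" using b0 by (intro sum_nonneg)
  have AC: "A \<subseteq> C"
  proof
    fix u assume "u \<in> A"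
    then show "u \<in> C" using low[of u] lowpos by (auto simp: C_def)
  qed
  \<comment> \<open>The weights are the sum of three parts: the excess \<open>\<beta>1\<close> over
    the minimum on \<open>A\<close>, the constant \<open>m\<close> on \<open>A\<close>, and the
    outer part \<open>\<beta>2\<close>.\<close>
  define \<beta>1 where "\<beta>1 u = (if u \<in> A then \<beta> u - m else 0)" for u
  define \<beta>2 where "\<beta>2 u = (if u \<in> A then 0 else \<beta> u)" for u
  have sub1: "{u. \<beta>1 u \<noteq> 0} \<subset> A" using w0 by (auto simp: \<beta>1_def)
  have w1: "weight K \<beta>1" by (rule weight_vsetsI[OF K A(1)]) (use sub1 mle in \<open>auto simp: \<beta>1_def\<close>)
  have CA: "C - A \<in> vsets K" using vsets_subset[OF K C] by blast
  have sub2: "{u. \<beta>2 u \<noteq> 0} \<subseteq> C - A" by (auto simp: \<beta>2_def C_def split: if_splits)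
  have w2: "weight K \<beta>2" by (rule weight_vsetsI[OF K CA sub2]) (use b0 in \<open>simp add: \<beta>2_def\<close>)
  obtain z1 where z1: "z1 \<in> \<Union>K" "\<beta>1 = (\<lambda>u. (\<Sum>u\<in>V. \<beta>1 u) * bary K z1 u)" "(\<Sum>u\<in>V. \<beta>1 u) *\<^sub>R z1 = (\<Sum>u\<in>V. \<beta>1 u *\<^sub>R u)"
      "(\<Sum>u\<in>V. \<beta>1 u) \<noteq> 0 \<Longrightarrow> z1 \<in> convex hull {u. \<beta>1 u \<noteq> 0}" "0 \<le> (\<Sum>u\<in>V. \<beta>1 u)"
    by (rule weight_normalize[OF K w1 xM]) blast
  obtain z2 where z2: "z2 \<in> \<Union>K" "\<beta>2 = (\<lambda>u. (\<Sum>u\<in>V. \<beta>2 u) * bary K z2 u)" "(\<Sum>u\<in>V. \<beta>2 u) *\<^sub>R z2 = (\<Sum>u\<in>V. \<beta>2 u *\<^sub>R u)"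
      "(\<Sum>u\<in>V. \<beta>2 u) \<noteq> 0 \<Longrightarrow> z2 \<in> convex hull {u. \<beta>2 u \<noteq> 0}" "0 \<le> (\<Sum>u\<in>V. \<beta>2 u)"
    by (rule weight_normalize[OF K w2 xM]) blast
  define a where "a = (\<Sum>u\<in>V. \<beta>1 u)"
  define b where "b = (\<Sum>u\<in>V. \<beta>2 u)"
  \<comment> \<open>The constant part \<open>m\<close> drops out because the vertices of
    \<open>A\<close> are balanced around the centroid.\<close>
  have \<Theta>1: "\<Theta>1 x = a *\<^sub>R (z1 - cA)"
  proof -
    have "\<Theta>1 x = (\<Sum>u\<in>A. \<beta>1 u *\<^sub>R (u - cA) + m *\<^sub>R (u - cA))"
      unfolding \<Theta>1_def by (rule sum.cong) (simp_all add: \<beta>1_def \<beta>_def flip: scaleR_left_distrib)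
    also have "\<dots> = (\<Sum>u\<in>A. \<beta>1 u *\<^sub>R (u - cA)) + m *\<^sub>R (\<Sum>u\<in>A. u - cA)" by (simp add: sum.distrib scaleR_sum_right)
    also have "\<dots> = (\<Sum>u\<in>A. \<beta>1 u *\<^sub>R (u - cA))" by (simp only: cA_sum scaleR_zero_right add_0_right)
    also have "\<dots> = (\<Sum>u\<in>A. \<beta>1 u *\<^sub>R u) - (\<Sum>u\<in>A. \<beta>1 u) *\<^sub>R cA"
      by (simp add: scaleR_diff_right sum_subtractf scaleR_left.sum)
    also have "\<dots> = a *\<^sub>R z1 - a *\<^sub>R cA"
      using z1(3) weight_sum[OF K psubset_imp_subset[OF sub1] AV] by (simp add: a_def)
    finally show ?thesis by (simp add: scaleR_diff_right)
  qed
  have \<Theta>2: "\<Theta>2 x = b *\<^sub>R \<phi> z2"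
  proof -
    have "\<beta>2 u = 0" if "u \<in> V - (V - A)" for u using that by (simp add: \<beta>2_def)
    then have "(\<Sum>u\<in>V. \<beta>2 u) = (\<Sum>u\<in>V - A. \<beta>2 u)" "(\<Sum>u\<in>V. \<beta>2 u *\<^sub>R u) = (\<Sum>u\<in>V - A. \<beta>2 u *\<^sub>R u)"
      using finV by (auto intro!: sum.mono_neutral_right)
    moreover have "(\<Sum>u\<in>V - A. \<beta>2 u) = (\<Sum>u\<in>V - A. \<beta> u)" "(\<Sum>u\<in>V - A. \<beta>2 u *\<^sub>R u) = (\<Sum>u\<in>V - A. \<beta> u *\<^sub>R u)"
      by (auto intro!: sum.cong simp: \<beta>2_def)
    ultimately have "(\<Sum>u\<in>V - A. \<beta> u) = b" "(\<Sum>u\<in>V - A. \<beta> u *\<^sub>R u) = b *\<^sub>R z2"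
      using z2(3) by (simp_all add: b_def)
    then show ?thesis unfolding \<Theta>2_def Let_def \<beta>_def[symmetric] by (cases "b = 0") simp_all
  qed
  have F1: "R1.cone_sum v (\<Theta>1 x) = flag_sum v \<beta>1" for v
  proof -
    have "R1.cone_sum v (a *\<^sub>R (z1 - cA)) = a * flag_sum v (bary K z1)"
    proof (cases "a = 0")
      case False
      then have "z1 \<in> X1" using z1(4) sub1 X1_iff by (auto simp: a_def)
      then show ?thesis using R1.cone_sum_ray[of z1 a] z1(5) by (simp add: a_def)
    qed (simp add: R1.cone_sum_def)
    also have "\<dots> = flag_sum v (\<lambda>u. a * bary K z1 u)"
      using flag_sum_scale[OF chainrep_bary[OF K z1(1)], of a v] z1(5) by (simp add: a_def)
    finally show ?thesis using z1(2) \<Theta>1 by (simp add: a_def)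
  qed
  have F2: "R2.cone_sum v (\<Theta>2 x) = flag_sum v \<beta>2" for v
  proof -
    have "R2.cone_sum v (b *\<^sub>R \<phi> z2) = b * flag_sum v (bary K z2)"
    proof (cases "b = 0")
      case False
      then have "z2 \<in> convex hull (C - A)" using z2(4) hull_mono[OF sub2, of convex] by (auto simp: b_def)
      moreover have "A \<union> (C - A) \<in> vsets K" using C AC by (simp add: Un_absorb1)
      ultimately have "z2 \<in> X2" using X2_iff by blast
      then show ?thesis using R2.cone_sum_ray[of z2 b] z2(5) by (simp add: b_def)
    qed (simp add: R2.cone_sum_def)
    also have "\<dots> = flag_sum v (\<lambda>u. b * bary K z2 u)"
      using flag_sum_scale[OF chainrep_bary[OF K z2(1)], of b v] z2(5) by (simp add: b_def)
    finally show ?thesis using z2(2) \<Theta>2 by (simp add: b_def)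
  qed
  define c1 where "c1 = coef \<beta>1"
  define c2 where "c2 = coef \<beta>2"
  have rep1: "chainrep \<beta>1 c1" unfolding c1_def
    by (rule chainrep_coef) (use weight_ge0[OF K w1] finite_subset[OF psubset_imp_subset[OF sub1] finA] in auto)
  have rep2: "chainrep \<beta>2 c2" unfolding c2_def
    by (rule chainrep_coef) (use weight_ge0[OF K w2] finite_subset[OF sub2] vsets_finite[OF K CA] in auto)
  have c1A: "B \<subset> A" if "c1 B \<noteq> 0" for B using chainrep_support[OF rep1 that] sub1 by blast
  have c2A: "B \<inter> A = {}" "B \<noteq> {}" "finite B" if "c2 B \<noteq> 0" for B
    using chainrep_support[OF rep2 that] sub2 rep2 that by (auto simp: chainrep_def)
  define S2 where "S2 = {B. c2 B \<noteq> 0}"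
  have finS2: "finite S2" using rep2 by (simp add: S2_def chainrep_def)
  define t where "t = (\<Sum>B\<in>S2. c2 B)"
  have tm: "t \<le> m"
  proof -
    have "t \<le> (\<Sum>u\<in>V. \<beta>2 u)"
    proof -
      have "(\<Sum>u\<in>V. \<beta>2 u *\<^sub>R (1::real)) = (\<Sum>B\<in>S2. c2 B *\<^sub>R (\<Sum>u\<in>B. 1))"
        by (rule chainrep_total[OF rep2 finV _ finS2]) (use sub2 vsets_vertices[OF K CA] in \<open>auto simp: S2_def\<close>)
      moreover have "c2 B \<le> c2 B * card B" if "B \<in> S2" for B
      proof -
        have "1 \<le> card B" using c2A[of B] that by (simp add: S2_def Suc_le_eq card_gt_0_iff)
        then show ?thesis using mult_left_mono[of 1 "real (card B)" "c2 B"] chainrep_nonneg[OF rep2, of B] by simp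
      qed
      then have "t \<le> (\<Sum>B\<in>S2. c2 B * card B)" unfolding t_def by (rule sum_mono)
      ultimately show ?thesis by simp
    qed
    also have "\<dots> = (\<Sum>u\<in>V - A. \<beta> u)"
      using finV by (intro sum.mono_neutral_cong_right) (auto simp: \<beta>2_def)
    also have "\<dots> \<le> m" using low[OF w0(1)] w0(2) by simp
    finally show ?thesis .
  qed
  \<comment> \<open>Enlarging every outer set by \<open>A\<close> adds its height to all points of
    \<open>A\<close>, in total \<open>t\<close>; the layer \<open>A\<close> itself gets the
    remaining \<open>m - t\<close>, which is nonnegative by \<open>tm\<close>.\<close>
  define e where "e B = (if B = A then m - t else if A \<subset> B then c2 (B - A) else 0)" for B
  have inj: "inj_on ((\<union>) A) S2"
  proof (rule inj_onI)
    fix B B' assume "B \<in> S2" "B' \<in> S2" "A \<union> B = A \<union> B'"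
    then show "B = B'" using c2A(1)[of B] c2A(1)[of B'] by (auto simp: S2_def)
  qed
  have eU: "e (A \<union> B) = c2 B" if "B \<in> S2" for B
  proof -
    have "A \<subset> A \<union> B" "A \<union> B - A = B" using c2A[of B] that by (auto simp: S2_def)
    then show ?thesis by (auto simp: e_def)
  qed
  have AS2: "A \<notin> (\<union>) A ` S2"
  proof
    assume "A \<in> (\<union>) A ` S2"
    then obtain B where "c2 B \<noteq> 0" "A = A \<union> B" by (auto simp: S2_def)
    then show False using c2A(1,2)[of B] by blast
  qed
  have eS: "B = A \<or> B \<in> (\<union>) A ` S2" if "e B \<noteq> 0" for B
  proof (cases "B = A")
    case False
    then have "A \<subset> B" "c2 (B - A) \<noteq> 0" using that by (auto simp: e_def split: if_splits)
    then have "B = A \<union> (B - A)" "B - A \<in> S2" by (auto simp: S2_def)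
    then show ?thesis by blast
  qed simp
  have rep3: "chainrep (\<lambda>u. (if u \<in> A then m else 0) + \<beta>2 u) e"
  proof (rule chainrepI[of _ "insert A ((\<union>) A ` S2)"])
    show "0 \<le> e B" for B using tm chainrep_nonneg[OF rep2] by (simp add: e_def)
    show "finite (insert A ((\<union>) A ` S2))" using finS2 by simp
    show "{C. e C \<noteq> 0} \<subseteq> insert A ((\<union>) A ` S2)" using eS by blast
    show "B \<subseteq> B' \<or> B' \<subseteq> B" if "e B \<noteq> 0" "e B' \<noteq> 0" for B B'
    proof -
      have ch: "P \<subseteq> Q \<or> Q \<subseteq> P" if "P \<in> S2" "Q \<in> S2" for P Q using rep2 that by (auto simp: chainrep_def S2_def)
      from eS[OF that(1)] eS[OF that(2)] show ?thesis using ch by auto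
    qed
    show "finite B" if "e B \<noteq> 0" for B using eS[OF that] finA c2A(3) by (auto simp: S2_def)
    show "B \<noteq> {}" if "e B \<noteq> 0" for B using eS[OF that] A(2) by auto
    show "(if u \<in> A then m else 0) + \<beta>2 u = (\<Sum>B\<in>insert A ((\<union>) A ` S2). if u \<in> B then e B else 0)" for u
    proof -
      have "(\<Sum>B\<in>insert A ((\<union>) A ` S2). if u \<in> B then e B else 0)
          = (if u \<in> A then m - t else 0) + (\<Sum>B\<in>S2. if u \<in> A \<union> B then e (A \<union> B) else 0)"
        using finS2 AS2 by (simp add: sum.reindex[OF inj] e_def)
      also have "(\<Sum>B\<in>S2. if u \<in> A \<union> B then e (A \<union> B) else 0) = (\<Sum>B\<in>S2. if u \<in> A \<union> B then c2 B else 0)"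
        by (intro sum.cong) (auto simp: eU)
      also have "\<dots> = (if u \<in> A then t else \<beta>2 u)"
        using chainrep_sum[OF rep2 finS2, of u] by (simp add: t_def S2_def)
      finally show ?thesis by (simp add: \<beta>2_def)
    qed
  qed
  have "chainrep (\<lambda>u. 1 * \<beta>1 u + 1 * ((if u \<in> A then m else 0) + \<beta>2 u)) (\<lambda>B. 1 * c1 B + 1 * e B)"
  proof (rule chainrep_combine[OF rep1 rep3])
    fix B B' assume "c1 B \<noteq> 0" "e B' \<noteq> 0"
    then show "B \<subseteq> B' \<or> B' \<subseteq> B" using c1A[of B] eS[of B'] by auto
  qed auto
  moreover have "(\<lambda>u. 1 * \<beta>1 u + 1 * ((if u \<in> A then m else 0) + \<beta>2 u)) = \<beta>" by (auto simp: \<beta>1_def \<beta>2_def)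
  ultimately have rep: "chainrep \<beta> (\<lambda>B. c1 B + e B)" by simp
  have coef: "coef \<beta> = (\<lambda>B. c1 B + e B)" by (rule coef_eq[OF rep])
  define S1 where "S1 = {B. c1 B \<noteq> 0}"
  have finS1: "finite S1" using rep1 by (simp add: S1_def chainrep_def)
  let ?T = "S1 \<union> insert A ((\<union>) A ` S2)"
  have finT: "finite ?T" using finS1 finS2 by simp
  have subT': "{B. c1 B + e B \<noteq> 0} \<subseteq> ?T" unfolding S1_def using eS by fastforce
  then have subT: "{B. coef \<beta> B \<noteq> 0} \<subseteq> ?T" unfolding coef .
  \<comment> \<open>As the total mass is 1, \<open>h A\<close> can be subtracted inside the sum,
    where the contribution of \<open>A\<close> itself then vanishes.\<close>
  have "(\<Sum>B\<in>?T. coef \<beta> B * card B) = 1"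
  proof -
    have "(\<Sum>u\<in>V. \<beta> u *\<^sub>R (1::real)) = (\<Sum>B\<in>?T. (c1 B + e B) *\<^sub>R (\<Sum>u\<in>B. 1))"
      by (rule chainrep_total[OF rep finV _ finT subT']) (unfold \<beta>_def, rule bary_support_vertices[OF K xM])
    then show ?thesis using w(2) by (simp add: coef)
  qed
  then have "flag_sum h \<beta> - h A = (\<Sum>B\<in>?T. coef \<beta> B * card B * h B) - (\<Sum>B\<in>?T. coef \<beta> B * card B) * h A"
    using flag_sum_eq[OF finT subT, of h] by simp
  also have "\<dots> = (\<Sum>B\<in>?T. coef \<beta> B * card B * (h B - h A))"
    by (simp add: sum_distrib_right sum_subtractf right_diff_distrib)
  also have "\<dots> = (\<Sum>B\<in>?T. c1 B * card B * (h B - h A)) + (\<Sum>B\<in>?T. e B * card B * (h B - h A))"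
    by (simp add: coef distrib_right sum.distrib)
  also have "(\<Sum>B\<in>?T. c1 B * card B * (h B - h A)) = flag_sum (\<lambda>C. h C - h A) \<beta>1"
    unfolding c1_def by (rule flag_sum_eq[symmetric]) (use finT in \<open>auto simp: S1_def c1_def\<close>)
  also have "(\<Sum>B\<in>?T. e B * card B * (h B - h A)) = (\<Sum>B\<in>(\<union>) A ` S2. e B * card B * (h B - h A))"
    by (rule sum.mono_neutral_right) (use finT eS in auto)
  also have "\<dots> = (\<Sum>B\<in>S2. c2 B * card (A \<union> B) * (h (A \<union> B) - h A))"
    by (simp add: sum.reindex[OF inj] eU)
  also have "\<dots> = (\<Sum>B\<in>S2. c2 B * card B * upper h B)"
  proof (rule sum.cong[OF refl])
    fix B assume "B \<in> S2"
    then have "card B \<noteq> 0" using c2A[of B] by (simp add: S2_def)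
    then show "c2 B * card (A \<union> B) * (h (A \<union> B) - h A) = c2 B * card B * upper h B" by (simp add: upper_def)
  qed
  also have "\<dots> = flag_sum (upper h) \<beta>2" by (simp add: flag_sum_def S2_def c2_def)
  finally have "flag_sum h \<beta> = h A + flag_sum (\<lambda>C. h C - h A) \<beta>1 + flag_sum (upper h) \<beta>2" by simp
  then show ?thesis by (simp add: F1 F2 \<beta>_def)
qed

end


subsection \<open>Regular and critical barycentres\<close>

lemma pwa_fst_snd:
  fixes f :: "'a::euclidean_space \<Rightarrow> 'c::euclidean_space" and g :: "'b::euclidean_space \<Rightarrow> 'c"
  assumes "polytope P" "polytope Q" "P' = P" "Q' = Q"
  shows "pwa P f \<Longrightarrow> pwa (P' \<times> Q') (\<lambda>y. f (fst y))" "pwa Q g \<Longrightarrow> pwa (P' \<times> Q') (\<lambda>y. g (snd y))"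
proof -
  have "pwa (P \<times> Q) (fst :: 'a \<times> 'b \<Rightarrow> 'a)" "pwa (P \<times> Q) (snd :: 'a \<times> 'b \<Rightarrow> 'b)"
    using affine_on_linear[OF linear_fst affine_on_id] affine_on_linear[OF linear_snd affine_on_id]
    by (auto intro!: pwa_affine polytope_Times assms)
  then show "pwa P f \<Longrightarrow> pwa (P' \<times> Q') (\<lambda>y. f (fst y))" "pwa Q g \<Longrightarrow> pwa (P' \<times> Q') (\<lambda>y. g (snd y))"
    unfolding assms(3,4) by (auto intro: pwa_compose)
qed

lemma inj_on_Pair_map:
  "inj_on f A \<Longrightarrow> inj_on g B \<Longrightarrow> inj_on (\<lambda>y. (f (fst y), g (snd y))) (A \<times> B)"
  by (auto simp: inj_on_def)

lemma image_Pair_map: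
  "f ` A \<subseteq> C \<Longrightarrow> g ` B \<subseteq> D \<Longrightarrow> (\<lambda>y. (f (fst y), g (snd y))) ` (A \<times> B) \<subseteq> C \<times> D"
  by auto

lemma finite_uniform_positive:
  fixes P :: "'i \<Rightarrow> real \<Rightarrow> bool"
  assumes "finite I" "\<And>i. i \<in> I \<Longrightarrow> \<exists>\<eta>>0. P i \<eta>" "\<And>i \<eta> \<eta>'. P i \<eta> \<Longrightarrow> 0 < \<eta>' \<Longrightarrow> \<eta>' \<le> \<eta> \<Longrightarrow> P i \<eta>'"
  shows "\<exists>\<eta>>0. \<forall>i\<in>I. P i \<eta>"
  using assms(1,2)
proof (induction I)
  case empty
  then show ?case by (auto intro: exI[of _ 1])
next
  case (insert i I)
  then obtain a b where a: "0 < a" "P i a" and b: "0 < b" "\<forall>j\<in>I. P j b" by (metis insertCI)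
  have "P i (min a b)" by (rule assms(3)[OF a(2)]) (use a b in auto)
  moreover have "P j (min a b)" if "j \<in> I" for j by (rule assms(3)[of j b]) (use a b that in auto)
  ultimately show ?case using a b by (intro exI[of _ "min a b"]) auto
qed

context star_chart
begin

lemma pwa_E:
  fixes f g :: "'a \<Rightarrow> 'c::euclidean_space"
  shows "pwa D1 f \<Longrightarrow> pwa (D1 \<times> D) (\<lambda>y. f (fst y))" "pwa D g \<Longrightarrow> pwa (D1 \<times> D) (\<lambda>y. g (snd y))"
  using pwa_fst_snd[OF R1.polytope_D R2.polytope_D refl refl] by blast+

lemma value_at_centroid: "flag_sum h (bary K cA) = h A"
  by (rule R2.flag_sum_centroid[OF A])

text \<open>The component of \<open>\<rho> y\<close> along \<open>u\<close> is replaced by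
  \<open>G (\<rho> y)\<close>. This stays injective, because on each line parallel to
  \<open>u\<close> the function \<open>G\<close> is affine with nonzero slope, and it makes
  \<open>G\<close> the last coordinate.\<close>

lemma strongly_regular_at_centroid:
  fixes \<rho> :: "'a \<times> 'a \<Rightarrow> 'a \<times> 'a" and G :: "'a \<times> 'a \<Rightarrow> real"
  assumes \<rho>: "inj_on \<rho> E" "\<rho> ` E \<subseteq> E" "pwa (D1 \<times> D) \<rho>" "\<rho> 0 = 0"
    and G: "pwa (D1 \<times> D) (\<lambda>y. G (\<rho> y))" "\<And>y t. y \<in> E \<Longrightarrow> G (y + t *\<^sub>R e) = G y + t * \<kappa>" "\<kappa> \<noteq> 0" "e \<in> E"
    and f: "\<And>x. x \<in> core \<Longrightarrow> f x = f cA + G (\<rho> (\<Theta> x))"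
  shows "strongly_regular d M f cA"
proof -
  have "G (0 + 1 *\<^sub>R e) = G 0 + 1 * \<kappa>" by (rule G(2)) (use \<Theta>_cA subspace_0[OF subspace_E] in auto)
  then have e0: "e \<noteq> 0" using G(3) by auto
  define u where "u = (1 / norm e) *\<^sub>R e"
  have u: "u \<in> E" "norm u = 1" using e0 G(4) subspace_scale[OF subspace_E] by (auto simp: u_def)
  have uu: "u \<bullet> u = 1" using u(2) by (simp add: dot_square_norm)
  have Gu: "G (y + t *\<^sub>R u) = G y + t * (\<kappa> / norm e)" if "y \<in> E" for y t
    using G(2)[OF that, of "t / norm e"] by (simp add: u_def)
  have k: "\<kappa> / norm e \<noteq> 0" using G(3) e0 by simp
  have G0: "G 0 = 0" using f[OF cA_core] \<rho>(4) \<Theta>_cA by simp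
  define \<sigma> where "\<sigma> y = \<rho> y - (\<rho> y \<bullet> u) *\<^sub>R u + G (\<rho> y) *\<^sub>R u" for y
  have su: "\<sigma> y \<bullet> u = G (\<rho> y)" for y by (simp add: \<sigma>_def inner_add_left inner_diff_left uu)
  obtain b where b: "span (b ` {..<d}) = E" "\<And>i j. i < d \<Longrightarrow> j < d \<Longrightarrow> b i \<bullet> b j = (if i = j then 1 else 0)"
    "0 < d" "b (d - 1) = u"
    using orthonormal_enumeration_last[OF subspace_E dim_E u] by metis
  obtain U where U: "U \<subseteq> core" "pl_chart d M cA U (\<lambda>x i. if i < d then \<sigma> (\<Theta> x) \<bullet> b i else 0)"
  proof (rule chart_at_centroid[of \<sigma> b core])
    show "inj_on \<sigma> E"
    proof (rule inj_onI)
      fix x y assume xy: "x \<in> E" "y \<in> E" "\<sigma> x = \<sigma> y"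
      have rE: "\<rho> x \<in> E" "\<rho> y \<in> E" using \<rho>(2) xy by blast+
      have g: "G (\<rho> x) = G (\<rho> y)" using su[of x] su[of y] xy(3) by simp
      define t where "t = \<rho> x \<bullet> u - \<rho> y \<bullet> u"
      have "\<rho> x - (\<rho> x \<bullet> u) *\<^sub>R u = \<rho> y - (\<rho> y \<bullet> u) *\<^sub>R u" using xy(3) g by (simp add: \<sigma>_def)
      then have eq: "\<rho> x = \<rho> y + t *\<^sub>R u" by (simp add: t_def algebra_simps)
      then have "t * (\<kappa> / norm e) = 0" using Gu[OF rE(2), of t] g by simp
      then have "t = 0" using k by simp
      then have "\<rho> x = \<rho> y" using eq by simp
      then show "x = y" using inj_onD[OF \<rho>(1)] xy by blast
    qed
    show "\<sigma> ` E \<subseteq> E"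
    proof
      fix y assume "y \<in> \<sigma> ` E"
      then obtain x where x: "x \<in> E" "y = \<sigma> x" by blast
      then have "\<rho> x \<in> E" using \<rho>(2) by blast
      then show "y \<in> E" unfolding x(2) \<sigma>_def using u(1)
        by (intro subspace_add[OF subspace_E] subspace_diff[OF subspace_E] subspace_scale[OF subspace_E])
    qed
    have "pwa (D1 \<times> D) (\<lambda>y. \<rho> y \<bullet> u)"
      by (rule pwa_linear[OF _ \<rho>(3)]) (rule bounded_linear.linear[OF bounded_linear_inner_left])
    then show "pwa (D1 \<times> D) \<sigma>" unfolding \<sigma>_def by (intro pwa_add pwa_diff pwa_scaleR_left \<rho>(3) G(1))
    show "\<sigma> 0 = 0" using \<rho>(4) G0 by (simp add: \<sigma>_def)
  qed (use b core_open cA_core in auto)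
  have "\<forall>x\<in>U. f x = f cA + (if d - 1 < d then \<sigma> (\<Theta> x) \<bullet> b (d - 1) else 0)"
    using f U(1) su b(3,4) by auto
  then show ?thesis unfolding strongly_regular_def using U(2) b(3) by blast
qed

lemma core_star: assumes "x \<in> core" shows "\<Theta>1 x \<in> span D1" "\<Theta>2 x \<in> span D"
proof -
  have xM: "x \<in> M" using assms by (simp add: core_def)
  have "x \<in> star"
  proof (rule in_star[OF xM])
    fix u assume "u \<in> A"
    moreover have "0 \<le> (\<Sum>w\<in>V - A. bary K x w)" using weight_ge0[OF K bary(1)[OF K xM]] by (intro sum_nonneg)
    ultimately show "0 < bary K x u" using assms by (force simp: core_def)
  qed
  then show "\<Theta>1 x \<in> span D1" "\<Theta>2 x \<in> span D" using \<Theta>_range[of x] by (auto simp: \<Theta>_def intro: span_base)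
qed

lemma critical_at_centroid:
  assumes lower: "\<And>C. C \<in> vsets K \<Longrightarrow> C \<noteq> {} \<Longrightarrow> C \<subset> A \<Longrightarrow> h C < h A"
    and upp: "\<And>C. C \<in> vsets K \<Longrightarrow> A \<subset> C \<Longrightarrow> h A < h C"
    and f: "\<And>x. x \<in> M \<Longrightarrow> f x = flag_sum h (bary K x)"
  shows "nondegenerate_critical d M f (card A - 1) cA"
proof -
  define k where "k = card A - 1"
  define n where "n = dim D"
  have kd: "d = k + n" using dims cardA by (simp add: k_def n_def)
  have "dim (span D1) = k" using dim_D1 by (simp add: k_def)
  then obtain b1 where b1: "span (b1 ` {..<k}) = span D1" "\<And>i j. i < k \<Longrightarrow> j < k \<Longrightarrow> b1 i \<bullet> b1 j = (if i = j then 1 else 0)"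
    using orthonormal_enumeration[OF subspace_span] by metis
  have "dim (span D) = n" by (simp add: n_def)
  then obtain b2 where b2: "span (b2 ` {..<n}) = span D" "\<And>i j. i < n \<Longrightarrow> j < n \<Longrightarrow> b2 i \<bullet> b2 j = (if i = j then 1 else 0)"
    using orthonormal_enumeration[OF subspace_span] by metis
  \<comment> \<open>The boundary summand is negative away from 0, so its negative becomes an
    l1-norm. It takes the first \<open>k\<close> coordinates, \<open>k\<close> being the dimension
    of the cell, and the link summand takes the remaining ones.\<close>
  obtain \<rho>1 where \<rho>1: "\<rho>1 ` span D1 \<subseteq> span D1"
      "\<And>y. y \<in> span D1 \<Longrightarrow> R1.cone_sum (\<lambda>C. - (h C - h A)) y = (\<Sum>i<k. \<bar>\<rho>1 y \<bullet> b1 i\<bar>)" "\<rho>1 0 = 0"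
      "inj_on \<rho>1 (span D1)" "pwa D1 \<rho>1"
  proof (rule R1.l1_coordinates[OF _ b1(1), of "\<lambda>C. - (h C - h A)"])
    fix z C assume "z \<in> X1" "coef (bary K z) C \<noteq> 0"
    then show "0 < - (h C - h A)" using coef_X1[of z C] lower[of C] by simp
  qed blast
  obtain \<rho>2 where \<rho>2: "\<rho>2 ` span D \<subseteq> span D"
      "\<And>y. y \<in> span D \<Longrightarrow> R2.cone_sum (upper h) y = (\<Sum>i<n. \<bar>\<rho>2 y \<bullet> b2 i\<bar>)" "\<rho>2 0 = 0"
      "inj_on \<rho>2 (span D)" "pwa D \<rho>2"
  proof (rule R2.l1_coordinates[OF _ b2(1), of "upper h"])
    fix z C assume z: "z \<in> X2" "coef (bary K z) C \<noteq> 0"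
    have C: "A \<inter> C = {}" "A \<union> C \<in> vsets K" "C \<noteq> {}" using coef_X2[OF z] .
    then have "finite C" using vsets_finite[OF K, of "A \<union> C"] by simp
    then have "0 < card (A \<union> C)" "0 < card C" using C finA by (simp_all add: card_gt_0_iff)
    moreover have "A \<subset> A \<union> C" using C by blast
    then have "0 < h (A \<union> C) - h A" using upp[OF C(2)] by simp
    ultimately show "0 < upper h C" by (simp add: upper_def)
  qed blast
  define \<rho> where "\<rho> y = (\<rho>1 (fst y), \<rho>2 (snd y))" for y
  define b where "b i = (if i < k then (b1 i, 0) else (0, b2 (i - k)))" for i
  have b_on: "b i \<bullet> b j = (if i = j then 1 else 0)" if "i < d" "j < d" for i j
    using that b1(2) b2(2)[of "i - k" "j - k"] by (auto simp: b_def kd)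
  have im: "b ` {..<d} = (\<lambda>x. (x, 0)) ` b1 ` {..<k} \<union> (\<lambda>x. (0, x)) ` b2 ` {..<n}"
  proof
    show "b ` {..<d} \<subseteq> (\<lambda>x. (x, 0)) ` b1 ` {..<k} \<union> (\<lambda>x. (0, x)) ` b2 ` {..<n}" by (auto simp: b_def kd)
    have "(x, 0) \<in> b ` {..<d}" if "x \<in> b1 ` {..<k}" for x using that kd by (force simp: b_def)
    moreover have "(0, x) \<in> b ` {..<d}" if x: "x \<in> b2 ` {..<n}" for x
    proof -
      obtain j where "j < n" "x = b2 j" using x by auto
      then have "(0, x) = b (j + k)" "j + k < d" by (auto simp: b_def kd)
      then show ?thesis by blast
    qed
    ultimately show "(\<lambda>x. (x, 0)) ` b1 ` {..<k} \<union> (\<lambda>x. (0, x)) ` b2 ` {..<n} \<subseteq> b ` {..<d}" by blast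
  qed
  have b_span: "span (b ` {..<d}) = E"
  proof
    show "span (b ` {..<d}) \<subseteq> E"
    proof (rule span_minimal[OF _ subspace_E])
      have "b1 i \<in> span D1" if "i < k" for i using that b1(1) span_base[of "b1 i" "b1 ` {..<k}"] by auto
      moreover have "b2 i \<in> span D" if "i < n" for i using that b2(1) span_base[of "b2 i" "b2 ` {..<n}"] by auto
      ultimately show "b ` {..<d} \<subseteq> E" unfolding im by (auto simp: span_zero)
    qed
    show "E \<subseteq> span (b ` {..<d})"
    proof
      fix p assume p: "p \<in> E"
      have l: "linear (\<lambda>x::'a. (x, 0::'a))" "linear (\<lambda>x::'a. (0::'a, x))" by (auto intro!: linearI)
      have "span ((\<lambda>x::'a. (x, 0::'a)) ` b1 ` {..<k}) = (\<lambda>x. (x, 0)) ` span D1"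
        "span ((\<lambda>x::'a. (0::'a, x)) ` b2 ` {..<n}) = (\<lambda>x. (0, x)) ` span D"
        using linear_span_image[OF l(1), of "b1 ` {..<k}"] linear_span_image[OF l(2), of "b2 ` {..<n}"] b1(1) b2(1) by simp_all
      moreover have "span ((\<lambda>x. (x, 0)) ` b1 ` {..<k}) \<subseteq> span (b ` {..<d})" "span ((\<lambda>x. (0, x)) ` b2 ` {..<n}) \<subseteq> span (b ` {..<d})"
        unfolding im by (auto intro!: span_mono)
      ultimately have "(fst p, 0) \<in> span (b ` {..<d})" "(0, snd p) \<in> span (b ` {..<d})" using p by auto
      then have "(fst p, 0) + (0, snd p) \<in> span (b ` {..<d})" by (rule span_add)
      then show "p \<in> span (b ` {..<d})" by simp
    qed
  qed
  obtain U where U: "U \<subseteq> core" "pl_chart d M cA U (\<lambda>x i. if i < d then \<rho> (\<Theta> x) \<bullet> b i else 0)"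
  proof (rule chart_at_centroid[of \<rho> b core])
    show "inj_on \<rho> E" unfolding \<rho>_def by (rule inj_on_Pair_map[OF \<rho>1(4) \<rho>2(4)])
    show "\<rho> ` E \<subseteq> E" unfolding \<rho>_def by (rule image_Pair_map[OF \<rho>1(1) \<rho>2(1)])
    show "pwa (D1 \<times> D) \<rho>" unfolding \<rho>_def by (intro pwa_Pair pwa_E \<rho>1(5) \<rho>2(5))
    show "\<rho> 0 = 0" using \<rho>1(3) \<rho>2(3) by (simp add: \<rho>_def zero_prod_def)
  qed (use b_span b_on core_open cA_core in auto)
  have "f x = f cA - (\<Sum>i<k. \<bar>if i < d then \<rho> (\<Theta> x) \<bullet> b i else 0\<bar>) + (\<Sum>i=k..<d. \<bar>if i < d then \<rho> (\<Theta> x) \<bullet> b i else 0\<bar>)"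
    if "x \<in> U" for x
  proof -
    have xc: "x \<in> core" using that U(1) by blast
    have xM: "x \<in> M" using xc by (simp add: core_def)
    note \<Theta>E = core_star[OF xc]
    have s1: "(\<Sum>i<k. \<bar>if i < d then \<rho> (\<Theta> x) \<bullet> b i else 0\<bar>) = (\<Sum>i<k. \<bar>\<rho>1 (\<Theta>1 x) \<bullet> b1 i\<bar>)"
      by (rule sum.cong) (auto simp: kd b_def \<rho>_def \<Theta>_def)
    have "(\<Sum>i=k..<d. \<bar>if i < d then \<rho> (\<Theta> x) \<bullet> b i else 0\<bar>) = (\<Sum>i=k..<d. \<bar>\<rho>2 (\<Theta>2 x) \<bullet> b2 (i - k)\<bar>)"
      by (rule sum.cong) (auto simp: b_def \<rho>_def \<Theta>_def)
    also have "\<dots> = (\<Sum>i<n. \<bar>\<rho>2 (\<Theta>2 x) \<bullet> b2 i\<bar>)"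
      by (rule sum.reindex_bij_witness[of _ "\<lambda>i. i + k" "\<lambda>i. i - k"]) (auto simp: kd)
    finally have s2: "(\<Sum>i=k..<d. \<bar>if i < d then \<rho> (\<Theta> x) \<bullet> b i else 0\<bar>) = (\<Sum>i<n. \<bar>\<rho>2 (\<Theta>2 x) \<bullet> b2 i\<bar>)" .
    have "R1.cone_sum (\<lambda>C. h C - h A) (\<Theta>1 x) = - (\<Sum>i<k. \<bar>\<rho>1 (\<Theta>1 x) \<bullet> b1 i\<bar>)"
      using R1.cone_sum_uminus[OF \<Theta>E(1), of "\<lambda>C. h C - h A"] \<rho>1(2)[OF \<Theta>E(1)] by simp
    then show ?thesis
      using core_decomposition[OF xc, of h] f[OF xM] f[OF cA_M] value_at_centroid[of h] \<rho>2(2)[OF \<Theta>E(2)] s1 s2 by simp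
  qed
  moreover have "k \<le> d" using kd by simp
  ultimately show ?thesis unfolding nondegenerate_critical_def k_def[symmetric] using U(2) by blast
qed

text \<open>Here \<open>A\<close> is the smaller set of a matched pair, and the only wrong sign of
  the link summand is at the vertex \<open>q\<close>. The boundary summand may be arbitrary, because
  it is constant in the direction \<open>\<phi> q\<close>.\<close>

lemma regular_upward:
  assumes q: "q \<notin> A" "insert q A \<in> vsets K"
  obtains \<eta> where "0 < \<eta>" "\<And>h f. \<lbrakk>h A - \<eta> < h (insert q A); h (insert q A) < h A;
     \<And>C. C \<in> vsets K \<Longrightarrow> A \<subset> C \<Longrightarrow> C \<noteq> insert q A \<Longrightarrow> 1 \<le> h C - h A;
     \<And>x. x \<in> M \<Longrightarrow> f x = flag_sum h (bary K x)\<rbrakk> \<Longrightarrow> strongly_regular d M f cA"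
proof -
  have B: "{q} \<in> vsets K" using vsets_subset[OF K q(2)] by simp
  have cq: "centroid {q} = q" by (simp add: centroid_def)
  have "q \<in> X2" unfolding X2_iff by (rule exI[of _ "{q}"]) (use q in auto)
  then have "centroid {q} \<in> X2" using cq by simp
  from R2.monotone_coordinates[OF B _ this] obtain \<eta> where \<eta>: "0 < \<eta>"
    "\<And>w. \<lbrakk>- \<eta> < w {q}; w {q} < 0; \<forall>z\<in>X2. \<forall>C. coef (bary K z) C \<noteq> 0 \<longrightarrow> C \<noteq> {q} \<longrightarrow> 1 \<le> w C\<rbrakk>
     \<Longrightarrow> \<exists>G \<rho>. \<rho> ` span D \<subseteq> span D \<and> (\<forall>y\<in>span D. G (\<rho> y) = R2.cone_sum w y) \<and> \<rho> 0 = 0 \<and> inj_on \<rho> (span D) \<and> pwa D \<rho> \<and>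
         (\<forall>y\<in>span D. \<forall>t. G (y + t *\<^sub>R \<phi> (centroid {q})) = G y + t * w {q})" by blast
  \<comment> \<open>The factor contained in \<open>upper h {q}\<close>; dividing \<eta> by it turns
    the bound on \<open>upper h\<close> into one on \<open>h\<close>.\<close>
  define N where "N = real (card (insert q A))"
  have N: "0 < N" using finA by (simp add: N_def card_gt_0_iff)
  show ?thesis
  proof (rule that[of "\<eta> / N"])
    show "0 < \<eta> / N" using \<eta>(1) N by simp
    fix h f
    assume h: "h A - \<eta> / N < h (insert q A)" "h (insert q A) < h A"
      "\<And>C. C \<in> vsets K \<Longrightarrow> A \<subset> C \<Longrightarrow> C \<noteq> insert q A \<Longrightarrow> 1 \<le> h C - h A"
      and f: "\<And>x. x \<in> M \<Longrightarrow> f x = flag_sum h (bary K x)"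
    have uq: "upper h {q} = N * (h (insert q A) - h A)" by (simp add: upper_def N_def)
    have u1: "- \<eta> < upper h {q}"
    proof -
      have "N * (- (\<eta> / N)) < N * (h (insert q A) - h A)" by (rule mult_strict_left_mono) (use h N in auto)
      then show ?thesis using N by (simp add: uq)
    qed
    have u2: "upper h {q} < 0" using N h(2) by (simp add: uq mult_pos_neg)
    have u3': "1 \<le> upper h C" if z: "z \<in> X2" "coef (bary K z) C \<noteq> 0" "C \<noteq> {q}" for z C
    proof -
      have C: "A \<inter> C = {}" "A \<union> C \<in> vsets K" "C \<noteq> {}" using coef_X2[OF z(1,2)] .
      have finC: "finite C" using vsets_finite[OF K C(2)] by simp
      have "A \<union> C \<noteq> insert q A" using C(1,3) z(3) q(1) by blast
      moreover have "A \<subset> A \<union> C" using C by blast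
      ultimately have "1 \<le> h (A \<union> C) - h A" using h(3)[OF C(2)] by blast
      \<comment> \<open>The mass correction is at least 1, so the gap of 1 between the values
        survives it.\<close>
      moreover have "1 \<le> real (card (A \<union> C)) / real (card C)"
      proof -
        have "0 < card C" "card C \<le> card (A \<union> C)" using C finC finA by (auto simp: card_gt_0_iff intro: card_mono)
        then show ?thesis by simp
      qed
      ultimately have "1 * 1 \<le> real (card (A \<union> C)) / real (card C) * (h (A \<union> C) - h A)" by (intro mult_mono) auto
      then show ?thesis by (simp add: upper_def)
    qed
    then have u3: "\<forall>z\<in>X2. \<forall>C. coef (bary K z) C \<noteq> 0 \<longrightarrow> C \<noteq> {q} \<longrightarrow> 1 \<le> upper h C" by blast
    obtain G \<rho>2 where \<rho>2: "\<rho>2 ` span D \<subseteq> span D" "\<And>y. y \<in> span D \<Longrightarrow> G (\<rho>2 y) = R2.cone_sum (upper h) y" "\<rho>2 0 = 0"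
        "inj_on \<rho>2 (span D)" "pwa D \<rho>2" "\<And>y t. y \<in> span D \<Longrightarrow> G (y + t *\<^sub>R \<phi> q) = G y + t * upper h {q}"
      using \<eta>(2)[of "upper h", OF u1 u2 u3] unfolding cq by blast
    let ?F1 = "R1.cone_sum (\<lambda>C. h C - h A)"
    show "strongly_regular d M f cA"
    proof (rule strongly_regular_at_centroid[of "\<lambda>y. (fst y, \<rho>2 (snd y))" "\<lambda>y. ?F1 (fst y) + G (snd y)" "(0, \<phi> q)" "upper h {q}"])
      show "inj_on (\<lambda>y. (fst y, \<rho>2 (snd y))) E" using inj_onD[OF \<rho>2(4)] by (auto simp: inj_on_def)
      show "(\<lambda>y. (fst y, \<rho>2 (snd y))) ` E \<subseteq> E" using \<rho>2(1) by auto
      show "pwa (D1 \<times> D) (\<lambda>y. (fst y, \<rho>2 (snd y)))"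
        by (intro pwa_Pair pwa_E(2)[OF \<rho>2(5)] pwa_E(1)[where f="\<lambda>x. x"] pwa_ident[OF R1.cone_sum_pwa])
      show "(fst (0::'a \<times> 'a), \<rho>2 (snd (0::'a \<times> 'a))) = 0" using \<rho>2(3) by (simp add: zero_prod_def)
      have "pwa (D1 \<times> D) (\<lambda>y. ?F1 (fst y) + R2.cone_sum (upper h) (snd y))"
        by (intro pwa_add pwa_E R1.cone_sum_pwa R2.cone_sum_pwa)
      then show "pwa (D1 \<times> D) (\<lambda>y. ?F1 (fst (fst y, \<rho>2 (snd y))) + G (snd (fst y, \<rho>2 (snd y))))"
        by (rule pwa_cong) (auto simp: \<rho>2(2) span_base)
      show "?F1 (fst (y + t *\<^sub>R (0, \<phi> q))) + G (snd (y + t *\<^sub>R (0, \<phi> q))) = ?F1 (fst y) + G (snd y) + t * upper h {q}"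
        if "y \<in> E" for y t using that \<rho>2(6)[of "snd y" t] by auto
      show "upper h {q} \<noteq> 0" using u2 by simp
      show "(0, \<phi> q) \<in> E" using R2.\<phi>_D[OF \<open>q \<in> X2\<close>] by (auto simp: span_zero intro: span_base)
      show "f x = f cA + (?F1 (fst (fst (\<Theta> x), \<rho>2 (snd (\<Theta> x)))) + G (snd (fst (\<Theta> x), \<rho>2 (snd (\<Theta> x)))))" if x: "x \<in> core" for x
      proof -
        have "x \<in> M" using x by (simp add: core_def)
        then show ?thesis
          using core_decomposition[OF x, of h] f[of x] f[OF cA_M] value_at_centroid[of h] \<rho>2(2)[OF core_star(2)[OF x]]
          by (simp add: \<Theta>_def)
      qed
    qed
  qed
qed

text \<open>Dual situation, with \<open>A\<close> the larger set of a pair. After a change of sign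
  the boundary values are at least 1 except for a small negative one at the centroid of
  \<open>C0\<close>, so \<open>monotone_coordinates\<close> applies to the boundary sphere of the
  cell.\<close>

lemma regular_downward:
  assumes C0: "C0 \<subset> A" "C0 \<noteq> {}"
  obtains \<eta> where "0 < \<eta>" "\<And>h f. \<lbrakk>h A < h C0; h C0 < h A + \<eta>;
     \<And>C. C \<in> vsets K \<Longrightarrow> C \<noteq> {} \<Longrightarrow> C \<subset> A \<Longrightarrow> C \<noteq> C0 \<Longrightarrow> 1 \<le> h A - h C;
     \<And>x. x \<in> M \<Longrightarrow> f x = flag_sum h (bary K x)\<rbrakk> \<Longrightarrow> strongly_regular d M f cA"
proof -
  have B: "C0 \<in> vsets K" using vsets_subset[OF K A(1)] C0 by blast
  let ?q = "centroid C0"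
  have "?q \<in> convex hull C0"
  proof -
    have "finite C0" by (rule vsets_finite[OF K B])
    then have "(\<Sum>u\<in>C0. (1 / card C0) *\<^sub>R u) \<in> convex hull C0"
      using C0(2) by (intro convex_sum) (auto simp: hull_inc)
    then show ?thesis by (simp add: centroid_def scaleR_sum_right)
  qed
  then have q: "?q \<in> X1" using X1_iff C0(1) by blast
  from R1.monotone_coordinates[OF B C0(2) q] obtain \<eta> where \<eta>: "0 < \<eta>"
    "\<And>w. \<lbrakk>- \<eta> < w C0; w C0 < 0; \<forall>z\<in>X1. \<forall>C. coef (bary K z) C \<noteq> 0 \<longrightarrow> C \<noteq> C0 \<longrightarrow> 1 \<le> w C\<rbrakk>
     \<Longrightarrow> \<exists>G \<rho>. \<rho> ` span D1 \<subseteq> span D1 \<and> (\<forall>y\<in>span D1. G (\<rho> y) = R1.cone_sum w y) \<and> \<rho> 0 = 0 \<and> inj_on \<rho> (span D1) \<and> pwa D1 \<rho> \<and>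
         (\<forall>y\<in>span D1. \<forall>t. G (y + t *\<^sub>R (?q - cA)) = G y + t * w C0)" by blast
  show ?thesis
  proof (rule that[OF \<eta>(1)])
    fix h f
    assume h: "h A < h C0" "h C0 < h A + \<eta>"
      "\<And>C. C \<in> vsets K \<Longrightarrow> C \<noteq> {} \<Longrightarrow> C \<subset> A \<Longrightarrow> C \<noteq> C0 \<Longrightarrow> 1 \<le> h A - h C"
      and f: "\<And>x. x \<in> M \<Longrightarrow> f x = flag_sum h (bary K x)"
    define w where "w C = - (h C - h A)" for C
    have w1: "- \<eta> < w C0" "w C0 < 0" using h by (auto simp: w_def)
    have "1 \<le> w C" if "z \<in> X1" "coef (bary K z) C \<noteq> 0" "C \<noteq> C0" for z C
      using coef_X1[OF that(1,2)] h(3)[of C] that(3) by (simp add: w_def)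
    then have w3: "\<forall>z\<in>X1. \<forall>C. coef (bary K z) C \<noteq> 0 \<longrightarrow> C \<noteq> C0 \<longrightarrow> 1 \<le> w C" by blast
    obtain G \<rho>1 where \<rho>1: "\<rho>1 ` span D1 \<subseteq> span D1" "\<And>y. y \<in> span D1 \<Longrightarrow> G (\<rho>1 y) = R1.cone_sum w y" "\<rho>1 0 = 0"
        "inj_on \<rho>1 (span D1)" "pwa D1 \<rho>1" "\<And>y t. y \<in> span D1 \<Longrightarrow> G (y + t *\<^sub>R (?q - cA)) = G y + t * w C0"
      using \<eta>(2)[of w, OF w1 w3] by blast
    let ?F2 = "R2.cone_sum (upper h)"
    show "strongly_regular d M f cA"
    proof (rule strongly_regular_at_centroid[of "\<lambda>y. (\<rho>1 (fst y), snd y)" "\<lambda>y. - G (fst y) + ?F2 (snd y)" "(?q - cA, 0)" "- w C0"])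
      show "inj_on (\<lambda>y. (\<rho>1 (fst y), snd y)) E" using inj_onD[OF \<rho>1(4)] by (auto simp: inj_on_def)
      show "(\<lambda>y. (\<rho>1 (fst y), snd y)) ` E \<subseteq> E" using \<rho>1(1) by auto
      show "pwa (D1 \<times> D) (\<lambda>y. (\<rho>1 (fst y), snd y))"
        by (intro pwa_Pair pwa_E(1)[OF \<rho>1(5)] pwa_E(2)[where g="\<lambda>x. x"] pwa_ident[OF R2.cone_sum_pwa])
      show "(\<rho>1 (fst (0::'a \<times> 'a)), snd (0::'a \<times> 'a)) = 0" using \<rho>1(3) by (simp add: zero_prod_def)
      have "pwa (D1 \<times> D) (\<lambda>y. ?F2 (snd y) - R1.cone_sum w (fst y))"
        by (intro pwa_diff pwa_E R1.cone_sum_pwa R2.cone_sum_pwa)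
      then show "pwa (D1 \<times> D) (\<lambda>y. - G (fst (\<rho>1 (fst y), snd y)) + ?F2 (snd (\<rho>1 (fst y), snd y)))"
        by (rule pwa_cong) (auto simp: \<rho>1(2) span_base)
      show "- G (fst (y + t *\<^sub>R (?q - cA, 0))) + ?F2 (snd (y + t *\<^sub>R (?q - cA, 0))) = - G (fst y) + ?F2 (snd y) + t * - w C0"
        if "y \<in> E" for y t using that \<rho>1(6)[of "fst y" t] by auto
      show "- w C0 \<noteq> 0" using w1 by simp
      show "(?q - cA, 0) \<in> E" using R1.\<phi>_D[OF q] by (auto simp: span_zero intro: span_base)
      show "f x = f cA + (- G (fst (\<rho>1 (fst (\<Theta> x)), snd (\<Theta> x))) + ?F2 (snd (\<rho>1 (fst (\<Theta> x)), snd (\<Theta> x))))" if x: "x \<in> core" for x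
      proof -
        have "x \<in> M" using x by (simp add: core_def)
        moreover have "R1.cone_sum (\<lambda>C. h C - h A) (\<Theta>1 x) = - R1.cone_sum w (\<Theta>1 x)"
          using R1.cone_sum_uminus[OF core_star(1)[OF x], of "\<lambda>C. h C - h A"] by (simp add: w_def[abs_def])
        ultimately show ?thesis
          using core_decomposition[OF x, of h] f[of x] f[OF cA_M] value_at_centroid[of h] \<rho>1(2)[OF core_star(1)[OF x]]
          by (simp add: \<Theta>_def)
      qed
    qed
  qed
qed

end


subsection \<open>Combinatorial manifolds\<close>

text \<open>The simplex bounded by the model sphere is translated so that 0 becomes a relatively
  interior point. A cell of dimension \<open>d\<close> has the empty sphere as its link, and then
  this simplex is a single point.\<close>

lemma star_chart_exists:
  assumes M: "combinatorial_manifold d K" and A: "A \<in> vsets K" "A \<noteq> {}"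
  obtains \<phi> D where "star_chart K A \<phi> D d"
proof -
  have K: "simplicial_complex K" using M by (simp add: combinatorial_manifold_def)
  let ?S = "convex hull A"
  have indA: "\<not> affine_dependent A" and finA: "finite A" using A vsets_finite[OF K] by (auto simp: vsets_def)
  have "?S \<in> cells K" using A by (auto simp: cells_def vsets_def)
  then have "pl_sphere (int d - aff_dim ?S - 1) (\<Union>(link_of ?S K))" using M by (simp add: combinatorial_manifold_def)
  moreover have aA: "aff_dim ?S = int (card A) - 1"
    using aff_dim_affine_independent[OF indA] by (simp add: aff_dim_convex_hull)
  ultimately have m: "- 1 \<le> int d - int (card A)" and "\<exists>D0::'a set. (int d - int (card A) + 1) simplex D0 \<and>
      (\<exists>f h. homeomorphism (\<Union>(link_of ?S K)) (rel_frontier D0) f h \<and> pl_map_on (\<Union>(link_of ?S K)) f)"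
    by (auto simp: pl_sphere_def pl_homeomorphic_def)
  then obtain D0 :: "'a set" and f h where D0: "(int d - int (card A) + 1) simplex D0"
    and hom: "homeomorphism (\<Union>(link_of ?S K)) (rel_frontier D0) f h" and pl: "pl_map_on (\<Union>(link_of ?S K)) f"
    by blast
  have aD: "aff_dim D0 = int d - int (card A) + 1" using D0 by (rule aff_dim_simplex)
  then have "D0 \<noteq> {}" using m by auto
  then obtain x0 where x0: "x0 \<in> rel_interior D0" using rel_interior_eq_empty convex_simplex[OF D0] by blast
  define D where "D = (+) (- x0) ` D0"
  have "radial (\<Union>(link_of ?S K)) (\<lambda>z. f z - x0) D"
  proof
    show "polytope D" unfolding D_def polytope_translation_eq using D0 by (rule simplex_imp_polytope)
    show z: "0 \<in> rel_interior D" unfolding D_def rel_interior_translation using x0 by auto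
    have "rel_frontier D = (+) (- x0) ` f ` (\<Union>(link_of ?S K))"
      unfolding D_def rel_frontier_translation using hom by (simp add: homeomorphism_def)
    also have "\<dots> = (\<lambda>z. f z - x0) ` \<Union>(link_of ?S K)" by (simp add: image_image)
    finally have "(\<lambda>z. f z - x0) ` \<Union>(link_of ?S K) = rel_frontier D" ..
    moreover have "inj_on f (\<Union>(link_of ?S K))" using hom by (metis homeomorphism_def inj_on_inverseI)
    then have "inj_on (\<lambda>z. f z - x0) (\<Union>(link_of ?S K))" by (auto simp: inj_on_def)
    ultimately show "bij_betw (\<lambda>z. f z - x0) (\<Union>(link_of ?S K)) (rel_frontier D)" by (simp add: bij_betw_def)
    have "pwa (\<Union>(link_of ?S K)) f" using pl by (rule pl_map_on_pwa)
    then show "pwa (\<Union>(link_of ?S K)) (\<lambda>z. f z - x0)" by (intro pwa_diff pwa_const)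
  qed
  moreover have "dim D + card A = d + 1"
  proof -
    have "x0 \<in> D0" using x0 rel_interior_subset by blast
    then have "0 \<in> D" by (force simp: D_def)
    then have "0 \<in> affine hull D" by (rule hull_inc)
    then have "int (dim D) = aff_dim D" by (simp add: aff_dim_zero)
    also have "\<dots> = aff_dim D0" unfolding D_def by (rule aff_dim_translation_eq)
    finally show ?thesis using aD by simp
  qed
  ultimately have "star_chart K A (\<lambda>z. f z - x0) D d" using K A by (simp add: star_chart_def)
  then show ?thesis by (rule that)
qed

text \<open>The two ways of being matched, with \<open>A\<close> below or above its partner
  \<open>B\<close>, form one predicate so that a single \<eta> can be obtained for all
  pairs.\<close>

definition regular_pair :: "'a::euclidean_space set set \<Rightarrow> ('a set \<Rightarrow> real) \<Rightarrow> real \<Rightarrow> 'a set \<Rightarrow> 'a set \<Rightarrow> bool"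
  where "regular_pair K h \<eta> A B \<longleftrightarrow>
    (\<exists>q. q \<notin> A \<and> B = insert q A \<and> h A - \<eta> < h B \<and> h B < h A \<and>
       (\<forall>C\<in>vsets K. A \<subset> C \<longrightarrow> C \<noteq> B \<longrightarrow> 1 \<le> h C - h A)) \<or>
    (B \<subset> A \<and> h A < h B \<and> h B < h A + \<eta> \<and> (\<forall>C\<in>vsets K. C \<noteq> {} \<longrightarrow> C \<subset> A \<longrightarrow> C \<noteq> B \<longrightarrow> 1 \<le> h A - h C))"

text \<open>The bounds from the individual cells are finitely many and may be decreased, since a
  smaller \<eta> only strengthens \<open>regular_pair\<close>. The common bound does not depend on
  \<open>h\<close>, so the values may be chosen afterwards.\<close>

lemma regular_pair_uniform:
  assumes M: "combinatorial_manifold d K"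
  obtains \<eta> where "0 < \<eta>" "\<And>A B h f. \<lbrakk>A \<in> vsets K; A \<noteq> {}; B \<in> vsets K; B \<noteq> {}; regular_pair K h \<eta> A B;
      \<And>x. x \<in> \<Union>K \<Longrightarrow> f x = flag_sum h (bary K x)\<rbrakk> \<Longrightarrow> strongly_regular d (\<Union>K) f (centroid A)"
proof -
  have K: "simplicial_complex K" using M by (simp add: combinatorial_manifold_def)
  let ?I = "(vsets K - {{}}) \<times> (vsets K - {{}})"
  let ?P = "\<lambda>p \<eta>. \<forall>h f. regular_pair K h \<eta> (fst p) (snd p) \<longrightarrow> (\<forall>x\<in>\<Union>K. f x = flag_sum h (bary K x)) \<longrightarrow>
      strongly_regular d (\<Union>K) f (centroid (fst p))"
  have "\<exists>\<eta>>0. \<forall>p\<in>?I. ?P p \<eta>"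
  proof (rule finite_uniform_positive)
    show "finite ?I" using finite_vsets[OF K] by simp
    show "?P p \<eta>'" if "?P p \<eta>" "0 < \<eta>'" "\<eta>' \<le> \<eta>" for p \<eta> \<eta>'
    proof -
      have "regular_pair K h \<eta> (fst p) (snd p)" if "regular_pair K h \<eta>' (fst p) (snd p)" for h
        using that \<open>\<eta>' \<le> \<eta>\<close> unfolding regular_pair_def by (smt (verit))
      then show ?thesis using that(1) by blast
    qed
    show "\<exists>\<eta>>0. ?P p \<eta>" if p: "p \<in> ?I" for p
    proof -
      obtain A B where AB: "p = (A, B)" "A \<in> vsets K" "A \<noteq> {}" "B \<in> vsets K" "B \<noteq> {}" using p by auto
      obtain \<phi> D where "star_chart K A \<phi> D d" using star_chart_exists[OF M AB(2,3)] by blast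
      then interpret star_chart K A \<phi> D d .
      consider "\<exists>q. q \<notin> A \<and> B = insert q A" | "B \<subset> A" | "\<not> (\<exists>q. q \<notin> A \<and> B = insert q A)" "\<not> B \<subset> A" by blast
      then show ?thesis
      proof cases
        case 1
        then obtain q where q: "q \<notin> A" "B = insert q A" by blast
        obtain \<eta> where \<eta>: "0 < \<eta>" "\<And>h f. \<lbrakk>h A - \<eta> < h (insert q A); h (insert q A) < h A;
           \<And>C. C \<in> vsets K \<Longrightarrow> A \<subset> C \<Longrightarrow> C \<noteq> insert q A \<Longrightarrow> 1 \<le> h C - h A;
           \<And>x. x \<in> M \<Longrightarrow> f x = flag_sum h (bary K x)\<rbrakk> \<Longrightarrow> strongly_regular d M f cA"
          using regular_upward[of q] q AB(4) by blast
        have "?P p \<eta>"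
        proof (intro allI impI)
          fix h f assume r: "regular_pair K h \<eta> (fst p) (snd p)" and f: "\<forall>x\<in>\<Union>K. f x = flag_sum h (bary K x)"
          have "\<not> B \<subset> A" using q by blast
          then have r': "h A - \<eta> < h B" "h B < h A" "\<forall>C\<in>vsets K. A \<subset> C \<longrightarrow> C \<noteq> B \<longrightarrow> 1 \<le> h C - h A"
            using r unfolding regular_pair_def AB(1) fst_conv snd_conv by blast+
          show "strongly_regular d (\<Union>K) f (centroid (fst p))"
            unfolding AB(1) fst_conv by (rule \<eta>(2)[of h]) (use r' f q in blast)+
        qed
        then show ?thesis using \<eta>(1) by blast
      next
        case 2
        obtain \<eta> where \<eta>: "0 < \<eta>" "\<And>h f. \<lbrakk>h A < h B; h B < h A + \<eta>;
           \<And>C. C \<in> vsets K \<Longrightarrow> C \<noteq> {} \<Longrightarrow> C \<subset> A \<Longrightarrow> C \<noteq> B \<Longrightarrow> 1 \<le> h A - h C;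
           \<And>x. x \<in> M \<Longrightarrow> f x = flag_sum h (bary K x)\<rbrakk> \<Longrightarrow> strongly_regular d M f cA"
          using regular_downward[OF 2 AB(5)] by blast
        have "?P p \<eta>"
        proof (intro allI impI)
          fix h f assume r: "regular_pair K h \<eta> (fst p) (snd p)" and f: "\<forall>x\<in>\<Union>K. f x = flag_sum h (bary K x)"
          have r': "h A < h B" "h B < h A + \<eta>" "\<forall>C\<in>vsets K. C \<noteq> {} \<longrightarrow> C \<subset> A \<longrightarrow> C \<noteq> B \<longrightarrow> 1 \<le> h A - h C"
            using r 2 unfolding regular_pair_def AB(1) fst_conv snd_conv by blast+
          show "strongly_regular d (\<Union>K) f (centroid (fst p))"
            unfolding AB(1) fst_conv by (rule \<eta>(2)[of h]) (use r' f in blast)+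
        qed
        then show ?thesis using \<eta>(1) by blast
      next
        case 3
        \<comment> \<open>Neither alternative of \<open>regular_pair\<close> can hold, so any bound
          does.\<close>
        have "?P p 1" using 3 unfolding regular_pair_def AB(1) fst_conv snd_conv by blast
        then show ?thesis using zero_less_one by blast
      qed
    qed
  qed
  then obtain \<eta> where \<eta>: "0 < \<eta>" "\<forall>p\<in>?I. ?P p \<eta>" by blast
  show ?thesis
  proof (rule that[OF \<eta>(1)])
    fix A B h f
    assume AB: "A \<in> vsets K" "A \<noteq> {}" "B \<in> vsets K" "B \<noteq> {}" "regular_pair K h \<eta> A B"
      and f: "\<And>x. x \<in> \<Union>K \<Longrightarrow> f x = flag_sum h (bary K x)"
    have "(A, B) \<in> ?I" using AB by simp
    then have "?P (A, B) \<eta>" using \<eta>(2) by blast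
    then show "strongly_regular d (\<Union>K) f (centroid A)" using AB(5) f by (metis fst_conv snd_conv)
  qed
qed

text \<open>Inverse to the convex hull on \<open>vsets\<close>: it recovers the vertex set of a cell
  that is given as a set of points.\<close>

definition corners :: "'a::real_vector set \<Rightarrow> 'a set"
  where "corners S = {x. x extreme_point_of S}"

lemma corners_hull: "\<not> affine_dependent C \<Longrightarrow> corners (convex hull C) = C" for C :: "'a::euclidean_space set"
  unfolding corners_def using extreme_point_of_convex_hull_affine_independent by auto

lemma corners_cell:
  assumes "simplicial_complex K" "S \<in> cells K"
  shows "corners S \<in> vsets K" "corners S \<noteq> {}" "convex hull (corners S) = S"
proof -
  have S: "S \<in> K" "S \<noteq> {}" using assms(2) by (auto simp: cells_def)
  obtain C where C: "C \<in> vsets K" "S = convex hull C" using simplex_vsets[OF assms(1) S(1)] by metis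
  then have "corners S = C" using corners_hull by (auto simp: vsets_def)
  then show "corners S \<in> vsets K" "corners S \<noteq> {}" "convex hull (corners S) = S" using C S by auto
qed

theorem lemma7p2:
  fixes K :: "'a::euclidean_space set set" and g :: "'a set \<Rightarrow> real" and d :: nat
  assumes "combinatorial_manifold d K"
    and "discrete_morse K g"
  shows "\<exists>v K' f.
    derived_subdivision K v K' \<and> generic_pl K' f \<and> pl_morse d K' f \<and>
    (\<forall>S\<in>cells K. \<not> critical_cell K g S \<longrightarrow> strongly_regular d (\<Union>K) f (v S)) \<and>
    (\<forall>S\<in>cells K. \<forall>k. critical_cell K g S \<and> aff_dim S = int k \<longrightarrow>
       nondegenerate_critical d (\<Union>K) f k (v S))"
proof -
  have K: "simplicial_complex K" using assms(1) by (simp add: combinatorial_manifold_def)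
  define \<V> where "\<V> = vsets K - {{}}"
  define m where "m C D \<longleftrightarrow> C \<in> \<V> \<and> D \<in> \<V> \<and> exceptional_coface K g (convex hull C) (convex hull D)" for C D
  interpret matching \<V> "\<lambda>C. g (convex hull C)" m
    using morse_matching[OF K assms(2)] unfolding \<V>_def m_def by simp
  obtain \<eta> where \<eta>: "0 < \<eta>" "\<And>A B h f. \<lbrakk>A \<in> vsets K; A \<noteq> {}; B \<in> vsets K; B \<noteq> {}; regular_pair K h \<eta> A B;
      \<And>x. x \<in> \<Union>K \<Longrightarrow> f x = flag_sum h (bary K x)\<rbrakk> \<Longrightarrow> strongly_regular d (\<Union>K) f (centroid A)"
    using regular_pair_uniform[OF assms(1)] by blast
  \<comment> \<open>The values are chosen with the bound \<eta> already fixed, so that each matched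
    reversal is small enough for the charts at both partners.\<close>
  obtain h where h: "inj_on h \<V>" "\<And>A B. A \<noteq> {} \<Longrightarrow> A \<subset> B \<Longrightarrow> B \<in> \<V> \<Longrightarrow> \<not> m A B \<Longrightarrow> 1 \<le> h B - h A"
    "\<And>A B. m A B \<Longrightarrow> 0 < h A - h B \<and> h A - h B < \<eta>"
    using perturbation[OF \<eta>(1)] by blast
  define v where "v S = centroid (corners S)" for S :: "'a set"
  define K' where "K' = {convex hull (v ` C) | C. C \<subseteq> cells K \<and> chain\<^sub>\<subseteq> C}"
  \<comment> \<open>On each simplex of \<open>K'\<close> the layers range over one fixed flag, so
    \<open>f\<close> is there the linear extension of the values \<open>h\<close>.\<close>
  define f where "f x = flag_sum h (bary K x)" for x
  have cell: "corners S \<in> \<V>" "convex hull (corners S) = S" if "S \<in> cells K" for S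
    using corners_cell[OF K that] by (auto simp: \<V>_def)
  have cell': "convex hull C \<in> cells K" "corners (convex hull C) = C" if "C \<in> \<V>" for C
    using that corners_hull[of C] by (auto simp: \<V>_def cells_def vsets_def)
  have chart: "\<exists>\<phi> D. star_chart K (corners S) \<phi> D d" if "S \<in> cells K" for S
    using star_chart_exists[OF assms(1)] corners_cell[OF K that] by metis
  have derived: "derived_subdivision K v K'"
    unfolding derived_subdivision_def K'_def
  proof (intro conjI ballI refl)
    fix S assume S: "S \<in> cells K"
    obtain \<phi> D where "star_chart K (corners S) \<phi> D d" using chart[OF S] by blast
    then interpret star_chart K "corners S" \<phi> D d .
    show "v S \<in> rel_interior S" using cA_rel_interior cell(2)[OF S] by (simp add: v_def)
  qed
  have fv: "f (v S) = h (corners S)" if S: "S \<in> cells K" for S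
  proof -
    obtain \<phi> D where "star_chart K (corners S) \<phi> D d" using chart[OF S] by blast
    then interpret star_chart K "corners S" \<phi> D d .
    show ?thesis using value_at_centroid by (simp add: f_def v_def)
  qed
  have vert: "\<exists>S\<in>cells K. p = v S" if "p \<in> vertices K'" for p
  proof -
    obtain \<C> where C: "{p} = convex hull (v ` \<C>)" "\<C> \<subseteq> cells K" using \<open>p \<in> vertices K'\<close> by (auto simp: vertices_def K'_def)
    then have "\<C> \<noteq> {}" by auto
    then obtain S where S: "S \<in> \<C>" by blast
    then have "v S \<in> {p}" unfolding C(1) by (simp add: hull_inc)
    then show ?thesis using S C(2) by auto
  qed
  have flag: "corners ` \<C> \<in> flags K" if C: "\<C> \<subseteq> cells K" "chain\<^sub>\<subseteq> \<C>" for \<C>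
    unfolding flags_def[OF K]
  proof (intro CollectI conjI ballI)
    show "corners ` \<C> \<subseteq> vsets K - {{}}" using C(1) cell(1) by (auto simp: \<V>_def)
    fix B B' assume "B \<in> corners ` \<C>" "B' \<in> corners ` \<C>"
    then obtain S S' where S: "S \<in> \<C>" "S' \<in> \<C>" "B = corners S" "B' = corners S'" by blast
    have "S \<in> cells K" "S' \<in> cells K" using S C(1) by auto
    note c = corners_cell[OF K this(1)] corners_cell[OF K this(2)]
    have "S \<subseteq> S' \<or> S' \<subseteq> S" using C(2) S by (auto simp: chain_subset_def)
    then show "B \<subseteq> B' \<or> B' \<subseteq> B"
      using vsets_hull_subset[OF K c(1,4)] vsets_hull_subset[OF K c(4,1)] c(3,6) S(3,4) by auto
  qed
  have generic: "generic_pl K' f"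
    unfolding generic_pl_def
  proof (intro conjI ballI)
    fix R assume "R \<in> K'"
    then obtain \<C> where C: "R = convex hull (v ` \<C>)" "\<C> \<subseteq> cells K" "chain\<^sub>\<subseteq> \<C>" by (auto simp: K'_def)
    have fl: "corners ` \<C> \<in> flags K" by (rule flag[OF C(2,3)])
    have im: "v ` \<C> = centroid ` corners ` \<C>" by (simp add: v_def image_image)
    have sub: "R \<subseteq> \<Union>K" unfolding C(1) im by (rule flag_hull_subset[OF K fl])
    have "affine_on R (\<lambda>x. \<Sum>C\<in>vsets K. (card C * h C) *\<^sub>R coef (bary K x) C)"
      unfolding C(1) im by (intro affine_on_sum affine_on_scaleR coef_affine[OF K fl])
    then show "affine_on R f"
    proof (rule affine_on_cong)
      show "convex R" by (simp add: C(1))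
      fix x assume "x \<in> R"
      then have x: "x \<in> \<Union>K" using sub by blast
      have "flag_sum h (bary K x) = (\<Sum>C\<in>vsets K. coef (bary K x) C * card C * h C)"
        by (rule flag_sum_eq) (use coef_vsets[OF K x] finite_vsets[OF K] in auto)
      then show "(\<Sum>C\<in>vsets K. (card C * h C) *\<^sub>R coef (bary K x) C) = f x" by (simp add: f_def mult_ac)
    qed
  next
    show "inj_on f (vertices K')"
    proof (rule inj_onI)
      fix p q assume "p \<in> vertices K'" "q \<in> vertices K'" and eq: "f p = f q"
      then obtain S S' where S: "S \<in> cells K" "p = v S" "S' \<in> cells K" "q = v S'" using vert by metis
      then have "corners S = corners S'" using eq fv inj_onD[OF h(1)] cell(1) by metis
      then show "p = q" using S by (simp add: v_def)
    qed
  qed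
  have union: "\<Union>K' = \<Union>K"
  proof
    have "\<Union>K' \<subseteq> \<Union>K"
    proof
      fix x assume "x \<in> \<Union>K'"
      then obtain \<C> where C: "x \<in> convex hull (v ` \<C>)" "\<C> \<subseteq> cells K" "chain\<^sub>\<subseteq> \<C>" by (auto simp: K'_def)
      have fl: "corners ` \<C> \<in> flags K" by (rule flag[OF C(2,3)])
      show "x \<in> \<Union>K" using flag_hull_subset[OF K fl] C(1) by (auto simp: v_def image_image)
    qed
    then show "\<Union>K' \<subseteq> \<Union>K" .
    show "\<Union>K \<subseteq> \<Union>K'"
    proof
      fix x assume x: "x \<in> \<Union>K"
      let ?C = "{C. coef (bary K x) C \<noteq> 0}"
      have fl: "?C \<in> flags K" by (rule flag_support[OF K x])
      have CV: "?C \<subseteq> \<V>" using fl by (auto simp: flags_def[OF K] \<V>_def)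
      \<comment> \<open>The hulls of the members of the flag form the chain of cells that names the
        simplex of \<open>K'\<close> containing \<open>x\<close>.\<close>
      let ?H = "(\<lambda>C. convex hull C) ` ?C"
      have cen: "v ` ?H = centroid ` ?C"
        unfolding image_image v_def by (rule image_cong[OF refl]) (simp add: cell'(2)[OF subsetD[OF CV]])
      have "C \<subseteq> C' \<or> C' \<subseteq> C" if "C \<in> ?C" "C' \<in> ?C" for C C'
        using fl that unfolding flags_def[OF K] by blast
      then have "convex hull C \<subseteq> convex hull C' \<or> convex hull C' \<subseteq> convex hull C" if "C \<in> ?C" "C' \<in> ?C" for C C'
        using that hull_mono[of C C' convex] hull_mono[of C' C convex] by blast
      then have "chain\<^sub>\<subseteq> ?H" unfolding chain_subset_def by blast
      moreover have "?H \<subseteq> cells K" using CV cell'(1) by blast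
      ultimately have "convex hull (v ` ?H) \<in> K'" unfolding K'_def by blast
      then have "convex hull (centroid ` ?C) \<in> K'" unfolding cen .
      then show "x \<in> \<Union>K'" using in_flag_hull[OF K x] by blast
    qed
  qed
  have regular: "strongly_regular d (\<Union>K) f (v S)" if S: "S \<in> cells K" "\<not> critical_cell K g S" for S
  proof -
    define A where "A = corners S"
    have A: "A \<in> \<V>" "convex hull A = S" using cell[OF S(1)] by (auto simp: A_def)
    \<comment> \<open>A noncritical cell is matched: an exceptional face makes it the larger
      partner, an exceptional coface the smaller one.\<close>
    have "(\<exists>B. m A B) \<or> (\<exists>B. m B A)"
    proof -
      consider F where "exceptional_face K g S F" | T where "exceptional_coface K g S T"
        using S by (auto simp: critical_cell_def)
      then show ?thesis
      proof cases
        case 1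
        then have F: "F \<in> cells K" by (simp add: exceptional_face_def)
        have "m (corners F) A"
          using 1 A cell[OF F] S(1) by (auto simp: m_def exceptional_face_def exceptional_coface_def)
        then show ?thesis by blast
      next
        case 2
        then have T: "T \<in> cells K" by (simp add: exceptional_coface_def)
        have "m A (corners T)" using 2 A cell[OF T] by (simp add: m_def)
        then show ?thesis by blast
      qed
    qed
    then have "\<exists>B\<in>\<V>. regular_pair K h \<eta> A B"
    proof
      assume "\<exists>B. m A B"
      then obtain B where B: "m A B" by blast
      then obtain q where q: "q \<notin> A" "B = insert q A" "B \<in> \<V>" using m_iff[of A B] by blast
      \<comment> \<open>By uniqueness of the partner, no other inclusion of \<open>A\<close> in a
        larger set is matched, so the gap of 1 applies to it.\<close>
      have "1 \<le> h C - h A" if "C \<in> vsets K" "A \<subset> C" "C \<noteq> B" for C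
        using h(2)[of A C] that A(1) up_unique[OF B, of C] by (auto simp: \<V>_def)
      then have "regular_pair K h \<eta> A B" unfolding regular_pair_def using h(3)[OF B] q(1,2) by auto
      then show ?thesis using q(3) by blast
    next
      assume "\<exists>B. m B A"
      then obtain B where B: "m B A" by blast
      then obtain q where q: "q \<notin> B" "A = insert q B" "B \<in> \<V>" using m_iff[of B A] by blast
      have "1 \<le> h A - h C" if "C \<in> vsets K" "C \<noteq> {}" "C \<subset> A" "C \<noteq> B" for C
        using h(2)[of C A] that A(1) down_unique[OF B, of C] by auto
      then have "regular_pair K h \<eta> A B" unfolding regular_pair_def using h(3)[OF B] q(1,2) by auto
      then show ?thesis using q(3) by blast
    qed
    then obtain B where "B \<in> \<V>" "regular_pair K h \<eta> A B" by blast
    then have "strongly_regular d (\<Union>K) f (centroid A)"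
      by (intro \<eta>(2)[of A B h f]) (use A(1) in \<open>auto simp: \<V>_def f_def\<close>)
    then show ?thesis by (simp add: v_def A_def)
  qed
  have critical: "nondegenerate_critical d (\<Union>K) f k (v S)"
    if S: "S \<in> cells K" "critical_cell K g S" and k: "aff_dim S = int k" for S k
  proof -
    obtain \<phi> D where "star_chart K (corners S) \<phi> D d" using chart[OF S(1)] by blast
    then interpret star_chart K "corners S" \<phi> D d .
    have cS: "corners S \<in> \<V>" "convex hull (corners S) = S" using cell[OF S(1)] by auto
    have no: "\<not> m (corners S) C" "\<not> m C (corners S)" for C
      using S(2) cS by (auto simp: m_def critical_cell_def exceptional_face_def exceptional_coface_def \<V>_def cells_def vsets_def)
    have "aff_dim S = int (card (corners S)) - 1"
      using aff_dim_affine_independent[OF indA] aff_dim_convex_hull[of "corners S"] cS(2) by simp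
    then have "k = card (corners S) - 1" using k by simp
    moreover have "nondegenerate_critical d (\<Union>K) f (card (corners S) - 1) (centroid (corners S))"
    proof (rule critical_at_centroid)
      show "h C < h (corners S)" if "C \<in> vsets K" "C \<noteq> {}" "C \<subset> corners S" for C
        using h(2)[OF that(2,3) cS(1) no(2)] by simp
      show "h (corners S) < h C" if "C \<in> vsets K" "corners S \<subset> C" for C
      proof -
        have "C \<in> \<V>" "corners S \<noteq> {}" using that cS(1) by (auto simp: \<V>_def)
        then show ?thesis using h(2)[OF _ that(2) _ no(1)] by fastforce
      qed
    qed (simp add: f_def)
    ultimately show ?thesis by (simp add: v_def)
  qed
  have "(\<exists>k. nondegenerate_critical d (\<Union>K') f k p) \<or> strongly_regular d (\<Union>K') f p" if p: "p \<in> vertices K'" for p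
  proof -
    obtain S where S: "S \<in> cells K" "p = v S" using vert[OF p] by blast
    show ?thesis
    proof (cases "critical_cell K g S")
      case True
      have "S \<noteq> {}" using S(1) by (simp add: cells_def)
      then have "0 \<le> aff_dim S" using aff_dim_negative_iff[of S] by linarith
      then have "aff_dim S = int (nat (aff_dim S))" by simp
      then show ?thesis using critical[OF S(1) True] S(2) union by metis
    next
      case False
      then show ?thesis using regular[OF S(1)] S(2) union by simp
    qed
  qed
  then have "pl_morse d K' f" using generic by (simp add: pl_morse_def)
  then show ?thesis using derived generic regular critical by blast
qed

end
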